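(* Let $(M,g,\mathcal K,\mathcal V)$ be an $(n+1)$-parameter system on a simply connected Riemannian manifold $(M,g)$ of dimension $n\ge 3$, with structure tensor $D_{ijk}$. Then the system is a restriction of a non-degenerate (second-order maximally superintegrable) system with structure tensor $$T_{ij}{}^{k}=D_{ij}{}^{k}-\frac1n\,g_{ij}\,D^{a}{}_{a}{}^{k}$$ (that is, there is a linear space $\mathcal V'\supset\mathcal V$ of functions such that $(M,g,\mathcal K,\mathcal V')$ is a non-degenerate system whose structure tensor is this $T$) if and only if the obstruction tensor $N_{ijk}$ of $D$ vanishes identically.
   Context: Everything is smooth. Indices are raised and lowered with $g$, the summation convention is used, a comma denotes the Levi-Civita covariant derivative of $g$, and $\Delta V=g^{ij}V_{,ij}$. Round brackets denote normalised symmetrisation. A Killing tensor is a symmetric tensor $K_{ij}$ with $K_{(ij,k)}=0$; it is identified with the endomorphism $K_i{}^j$. Setting. $(M,g)$ is a Riemannian manifold of dimension $n$, simply connected. $\mathcal K$ is a linear space of rank-2 Killing tensors of $g$ that forms an irreducible set of endomorphisms, i.e. the $K_i{}^j$ ($K\in\mathcal K$) have no common eigenvector. $\mathcal V\subset C^\infty(M)$ is a linear space of functions ("potentials"). For $V\in\mathcal V$ put $H=F^{(0)}=g^{ij}p_ip_j+V$ on $T^*M$. If $K\in\mathcal K$ satisfies the Bertrand–Darboux condition $d(K\,dV)=0$, put $F_K=K^{ij}p_ip_j+W_K$, where $W_K$ is a function with $dW_K=K\,dV$. $(M,g,\mathcal K,\mathcal V)$ is an $(n+1)$-parameter system if for all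 $V\in\mathcal V$, $K\in\mathcal K$: (S1) $d(K\,dV)=0$; (S2) there are $K^{(1)},\dots,K^{(2n-2)}\in\mathcal K$ such that $H,F_{K^{(1)}},\dots,F_{K^{(2n-2)}}$ are functionally independent; (S3) $\dim\mathcal V=n+1$. It is a non-degenerate system if the same holds with (S3) replaced by $\dim\mathcal V=n+2$. Structure tensor of an $(n+1)$-parameter system: the tensor field $D_{ij}{}^m$, symmetric in $i,j$, such that $V_{,ij}=D_{ij}{}^mV_{,m}$ for all $V\in\mathcal V$ (it is a standing assumption, obtained after possibly shrinking the domain, that it exists on $M$; it is then unique). Structure tensor of a non-degenerate system: the tensor field $T_{ij}{}^m$, symmetric and trace-free in $i,j$, such that $V_{,ij}=T_{ij}{}^mV_{,m}+\frac1n g_{ij}\Delta V$ for all $V$ in its space of potentials. Obstruction tensor: with $m_j=D^i{}_{ji}-D^i{}_{ij}$, $$N_{ijk}=\tfrac13\big(2D_{(ij)k}-D_{ikj}-D_{jki}\big)+\tfrac{2}{3(n-1)}g_{ij}m_k-\tfrac{2}{3(n-1)}g_{k(i}m_{j)} .$$ *)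

theory Defs
  imports "HOL-Analysis.Analysis" "HOL-Library.Function_Algebras"
begin

section \<open>Function spaces as real vector spaces\<close>

instantiation "fun" :: (type, real_vector) real_vector
begin

definition scaleR_fun_def: "r *\<^sub>R f = (\<lambda>x. r *\<^sub>R f x)"

instance
  by standard (simp_all add: scaleR_fun_def fun_eq_iff scaleR_add_right scaleR_add_left)

end

lemma scaleR_fun_apply [simp]: "(r *\<^sub>R f) x = r *\<^sub>R f x"
  by (simp add: scaleR_fun_def)


section \<open>Smooth manifolds\<close>

text \<open>On an open set, \<open>Ck_on k S f\<close> says that \<open>f\<close> is of class \<open>C\<^sup>k\<close>.\<close>

primrec Ck_on :: "nat \<Rightarrow> (real^'n) set \<Rightarrow> (real^'n \<Rightarrow> real) \<Rightarrow> bool" where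
  "Ck_on 0 S f \<longleftrightarrow> continuous_on S f"
| "Ck_on (Suc k) S f \<longleftrightarrow> f differentiable_on S \<and>
     (\<forall>i. Ck_on k S (\<lambda>x. frechet_derivative f (at x) (axis i 1)))"

definition smooth_on :: "(real^'n) set \<Rightarrow> (real^'n \<Rightarrow> real) \<Rightarrow> bool" where
  "smooth_on S f \<longleftrightarrow> (\<forall>k. Ck_on k S f)"

text \<open>The manifold is the whole type \<open>'a\<close>, of dimension \<open>CARD('n)\<close>. A chart is a pair of its
  domain and its coordinate map; the values of the coordinate map outside of the domain are
  irrelevant.\<close>

type_synonym ('a, 'n) chart = "'a set \<times> ('a \<Rightarrow> real^'n)"

abbreviation cdom :: "('a, 'n::finite) chart \<Rightarrow> 'a set" where
  "cdom \<equiv> fst"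

abbreviation cmap :: "('a, 'n::finite) chart \<Rightarrow> 'a \<Rightarrow> real^'n" where
  "cmap \<equiv> snd"

definition crange :: "('a, 'n::finite) chart \<Rightarrow> (real^'n) set" where
  "crange c = cmap c ` cdom c"

definition cinv :: "('a, 'n::finite) chart \<Rightarrow> real^'n \<Rightarrow> 'a" where
  "cinv c = inv_into (cdom c) (cmap c)"

definition smooth_atlas :: "('a::topological_space, 'n::finite) chart set \<Rightarrow> bool" where
  "smooth_atlas A \<longleftrightarrow>
     (\<Union>c\<in>A. cdom c) = UNIV \<and>
     (\<forall>c\<in>A. open (cdom c) \<and> open (crange c) \<and>
        homeomorphism (cdom c) (crange c) (cmap c) (cinv c)) \<and>
     (\<forall>c\<in>A. \<forall>c'\<in>A. \<forall>i. smooth_on (cmap c ` (cdom c \<inter> cdom c')) (\<lambda>x. cmap c' (cinv c x) $ i))"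

definition smooth_in_chart :: "('a, 'n::finite) chart \<Rightarrow> ('a \<Rightarrow> real) \<Rightarrow> bool" where
  "smooth_in_chart c f \<longleftrightarrow> smooth_on (crange c) (\<lambda>x. f (cinv c x))"

definition smooth_functions :: "('a, 'n::finite) chart set \<Rightarrow> ('a \<Rightarrow> real) set" where
  "smooth_functions A = {f. \<forall>c\<in>A. smooth_in_chart c f}"

text \<open>\<open>pd c i f p\<close> is \<open>\<partial>f/\<partial>x\<^sup>i\<close> at \<open>p\<close> in the coordinates of \<open>c\<close>.\<close>

definition pd :: "('a, 'n::finite) chart \<Rightarrow> 'n \<Rightarrow> ('a \<Rightarrow> real) \<Rightarrow> 'a \<Rightarrow> real" where
  "pd c i f p = frechet_derivative (\<lambda>x. f (cinv c x)) (at (cmap c p)) (axis i 1)"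


section \<open>Tensor fields\<close>

text \<open>A tensor field is given by its components in every chart of the atlas, subject to the
  transformation law. Components for other charts, or at points outside of the domain of the
  chart, carry no meaning.\<close>

type_synonym ('a, 'n) tensor2 = "('a, 'n) chart \<Rightarrow> 'a \<Rightarrow> real^'n^'n"
type_synonym ('a, 'n) tensor3 = "('a, 'n) chart \<Rightarrow> 'a \<Rightarrow> real^'n^'n^'n"

text \<open>\<open>jac c c' p i j = \<partial>x'\<^sup>i/\<partial>x\<^sup>j\<close>, where \<open>x\<close> and \<open>x'\<close> are the coordinates of \<open>c\<close> and \<open>c'\<close>.\<close>

definition jac :: "('a, 'n::finite) chart \<Rightarrow> ('a, 'n) chart \<Rightarrow> 'a \<Rightarrow> 'n \<Rightarrow> 'n \<Rightarrow> real" where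
  "jac c c' p i j = pd c j (\<lambda>q. cmap c' q $ i) p"

text \<open>Tensor fields with two lower indices.\<close>

definition tensor_field_02 :: "('a, 'n::finite) chart set \<Rightarrow> ('a, 'n) tensor2 \<Rightarrow> bool" where
  "tensor_field_02 A K \<longleftrightarrow>
     (\<forall>c\<in>A. \<forall>i j. smooth_in_chart c (\<lambda>p. K c p $ i $ j)) \<and>
     (\<forall>c\<in>A. \<forall>c'\<in>A. \<forall>p\<in>cdom c \<inter> cdom c'. \<forall>a b.
        K c p $ a $ b = (\<Sum>i\<in>UNIV. \<Sum>j\<in>UNIV. jac c c' p i a * jac c c' p j b * K c' p $ i $ j))"

text \<open>Tensor fields \<open>D\<^sub>i\<^sub>j\<^sup>m\<close>, with components \<open>D c p $ i $ j $ m\<close>.\<close>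

definition tensor_field_12 :: "('a, 'n::finite) chart set \<Rightarrow> ('a, 'n) tensor3 \<Rightarrow> bool" where
  "tensor_field_12 A D \<longleftrightarrow>
     (\<forall>c\<in>A. \<forall>i j m. smooth_in_chart c (\<lambda>p. D c p $ i $ j $ m)) \<and>
     (\<forall>c\<in>A. \<forall>c'\<in>A. \<forall>p\<in>cdom c \<inter> cdom c'. \<forall>a b k.
        (\<Sum>m\<in>UNIV. jac c c' p k m * D c p $ a $ b $ m) =
        (\<Sum>i\<in>UNIV. \<Sum>j\<in>UNIV. jac c c' p i a * jac c c' p j b * D c' p $ i $ j $ k))"


section \<open>Riemannian geometry\<close>

definition riemannian_metric :: "('a, 'n::finite) chart set \<Rightarrow> ('a, 'n) tensor2 \<Rightarrow> bool" where
  "riemannian_metric A g \<longleftrightarrow>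
     tensor_field_02 A g \<and>
     (\<forall>c\<in>A. \<forall>p\<in>cdom c. transpose (g c p) = g c p \<and> (\<forall>v. v \<noteq> 0 \<longrightarrow> v \<bullet> (g c p *v v) > 0))"

text \<open>\<open>g\<^sup>i\<^sup>j\<close>\<close>

definition ginv :: "('a, 'n::finite) tensor2 \<Rightarrow> ('a, 'n) tensor2" where
  "ginv g c p = matrix_inv (g c p)"

text \<open>\<open>christoffel g c k i j p\<close> is \<open>\<Gamma>\<^sup>k\<^sub>i\<^sub>j\<close>.\<close>

definition christoffel ::
    "('a, 'n::finite) tensor2 \<Rightarrow> ('a, 'n) chart \<Rightarrow> 'n \<Rightarrow> 'n \<Rightarrow> 'n \<Rightarrow> 'a \<Rightarrow> real" where
  "christoffel g c k i j p = 1/2 * (\<Sum>l\<in>UNIV. ginv g c p $ k $ l *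
     (pd c i (\<lambda>q. g c q $ j $ l) p + pd c j (\<lambda>q. g c q $ i $ l) p - pd c l (\<lambda>q. g c q $ i $ j) p))"

text \<open>\<open>cov_deriv2 g c K i j k p = K\<^sub>i\<^sub>j\<^sub>,\<^sub>k\<close> and \<open>hess g c V i j p = V\<^sub>,\<^sub>i\<^sub>j\<close>.\<close>

definition cov_deriv2 :: "('a, 'n::finite) tensor2 \<Rightarrow> ('a, 'n) chart \<Rightarrow> ('a, 'n) tensor2 \<Rightarrow>
    'n \<Rightarrow> 'n \<Rightarrow> 'n \<Rightarrow> 'a \<Rightarrow> real" where
  "cov_deriv2 g c K i j k p = pd c k (\<lambda>q. K c q $ i $ j) p
     - (\<Sum>a\<in>UNIV. christoffel g c a k i p * K c p $ a $ j)
     - (\<Sum>a\<in>UNIV. christoffel g c a k j p * K c p $ i $ a)"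

definition hess :: "('a, 'n::finite) tensor2 \<Rightarrow> ('a, 'n) chart \<Rightarrow> ('a \<Rightarrow> real) \<Rightarrow>
    'n \<Rightarrow> 'n \<Rightarrow> 'a \<Rightarrow> real" where
  "hess g c V i j p = pd c i (pd c j V) p - (\<Sum>k\<in>UNIV. christoffel g c k i j p * pd c k V p)"

definition laplacian :: "('a, 'n::finite) tensor2 \<Rightarrow> ('a, 'n) chart \<Rightarrow> ('a \<Rightarrow> real) \<Rightarrow> 'a \<Rightarrow> real" where
  "laplacian g c V p = (\<Sum>i\<in>UNIV. \<Sum>j\<in>UNIV. ginv g c p $ i $ j * hess g c V i j p)"

definition killing_tensor ::
    "('a, 'n::finite) chart set \<Rightarrow> ('a, 'n) tensor2 \<Rightarrow> ('a, 'n) tensor2 \<Rightarrow> bool" where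
  "killing_tensor A g K \<longleftrightarrow>
     tensor_field_02 A K \<and>
     (\<forall>c\<in>A. \<forall>p\<in>cdom c. transpose (K c p) = K c p) \<and>
     (\<forall>c\<in>A. \<forall>p\<in>cdom c. \<forall>i j k.
        1/6 * (cov_deriv2 g c K i j k p + cov_deriv2 g c K j k i p + cov_deriv2 g c K k i j p +
               cov_deriv2 g c K j i k p + cov_deriv2 g c K i k j p + cov_deriv2 g c K k j i p) = 0)"

text \<open>\<open>K\<^sub>i\<^sup>j\<close>\<close>

definition mixed :: "('a, 'n::finite) tensor2 \<Rightarrow> ('a, 'n) tensor2 \<Rightarrow> ('a, 'n) tensor2" where
  "mixed g K c p = (\<chi> i j. \<Sum>a\<in>UNIV. K c p $ i $ a * ginv g c p $ a $ j)"

text \<open>\<open>K\<^sup>i\<^sup>j\<close>\<close>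

definition raised :: "('a, 'n::finite) tensor2 \<Rightarrow> ('a, 'n) tensor2 \<Rightarrow> ('a, 'n) tensor2" where
  "raised g K c p = (\<chi> i j. \<Sum>a\<in>UNIV. \<Sum>b\<in>UNIV. ginv g c p $ i $ a * ginv g c p $ j $ b * K c p $ a $ b)"

text \<open>Irreducibility is a condition at every point: the endomorphisms \<open>v\<^sup>i \<mapsto> v\<^sup>i K\<^sub>i\<^sup>j\<close> of the
  tangent space have no common eigenvector.\<close>

definition irreducible_set ::
    "('a, 'n::finite) chart set \<Rightarrow> ('a, 'n) tensor2 \<Rightarrow> ('a, 'n) tensor2 set \<Rightarrow> bool" where
  "irreducible_set A g \<K> \<longleftrightarrow>
     (\<forall>c\<in>A. \<forall>p\<in>cdom c. \<not> (\<exists>v. v \<noteq> 0 \<and> (\<forall>K\<in>\<K>. \<exists>l. v v* mixed g K c p = l *\<^sub>R v)))"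


section \<open>Superintegrable systems\<close>

text \<open>The components of the one-form \<open>K dV\<close>.\<close>

definition K_dV :: "('a, 'n::finite) tensor2 \<Rightarrow> ('a, 'n) tensor2 \<Rightarrow> ('a \<Rightarrow> real) \<Rightarrow>
    ('a, 'n) chart \<Rightarrow> 'n \<Rightarrow> 'a \<Rightarrow> real" where
  "K_dV g K V c i p = (\<Sum>j\<in>UNIV. mixed g K c p $ i $ j * pd c j V p)"

definition bertrand_darboux :: "('a, 'n::finite) chart set \<Rightarrow> ('a, 'n) tensor2 \<Rightarrow>
    ('a, 'n) tensor2 \<Rightarrow> ('a \<Rightarrow> real) \<Rightarrow> bool" where
  "bertrand_darboux A g K V \<longleftrightarrow>
     (\<forall>c\<in>A. \<forall>p\<in>cdom c. \<forall>i j. pd c i (K_dV g K V c j) p - pd c j (K_dV g K V c i) p = 0)"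

text \<open>\<open>W\<close> is a function with \<open>dW = K dV\<close>.\<close>

definition is_potential_part :: "('a, 'n::finite) chart set \<Rightarrow> ('a, 'n) tensor2 \<Rightarrow>
    ('a, 'n) tensor2 \<Rightarrow> ('a \<Rightarrow> real) \<Rightarrow> ('a \<Rightarrow> real) \<Rightarrow> bool" where
  "is_potential_part A g K V W \<longleftrightarrow>
     W \<in> smooth_functions A \<and> (\<forall>c\<in>A. \<forall>p\<in>cdom c. \<forall>i. pd c i W p = K_dV g K V c i p)"

text \<open>A function on the cotangent bundle is represented by its expressions in the canonical
  coordinates \<open>(x\<^sup>i, p\<^sub>i)\<close> induced by the charts. The following is \<open>Q\<^sup>i\<^sup>j p\<^sub>i p\<^sub>j + W\<close>.\<close>

type_synonym ('a, 'n) cotangent_fun = "('a, 'n) chart \<Rightarrow> (real^'n) \<times> (real^'n) \<Rightarrow> real"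

definition quadratic_integral :: "('a, 'n::finite) tensor2 \<Rightarrow> ('a \<Rightarrow> real) \<Rightarrow> ('a, 'n) cotangent_fun" where
  "quadratic_integral Q W c z = (case z of (x, \<xi>) \<Rightarrow>
     (\<Sum>i\<in>UNIV. \<Sum>j\<in>UNIV. Q c (cinv c x) $ i $ j * \<xi> $ i * \<xi> $ j) + W (cinv c x))"

text \<open>Functional independence of \<open>F 0, \<dots>, F (N - 1)\<close>: the differentials are linearly independent
  on a dense subset of the cotangent bundle. (For smooth functions this subset is open.)\<close>

definition functionally_independent ::
    "('a, 'n::finite) chart set \<Rightarrow> nat \<Rightarrow> (nat \<Rightarrow> ('a, 'n) cotangent_fun) \<Rightarrow> bool" where
  "functionally_independent A N F \<longleftrightarrow>
     (\<forall>c\<in>A. crange c \<times> UNIV \<subseteq> closure {z \<in> crange c \<times> UNIV.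
        \<forall>a::nat \<Rightarrow> real. (\<forall>w. (\<Sum>k<N. a k * frechet_derivative (F k c) (at z) w) = 0)
          \<longrightarrow> (\<forall>k<N. a k = 0)})"

text \<open>Everything that \<open>(n+1)\<close>-parameter systems and non-degenerate systems have in common, that
  is, all but the dimension of the space of potentials.\<close>

definition superintegrable_system :: "('a, 'n::finite) chart set \<Rightarrow> ('a, 'n) tensor2 \<Rightarrow>
    ('a, 'n) tensor2 set \<Rightarrow> ('a \<Rightarrow> real) set \<Rightarrow> bool" where
  "superintegrable_system A g \<K> \<V> \<longleftrightarrow>
     subspace \<K> \<and> (\<forall>K\<in>\<K>. killing_tensor A g K) \<and> irreducible_set A g \<K> \<and>
     subspace \<V> \<and> \<V> \<subseteq> smooth_functions A \<and>
     (\<forall>V\<in>\<V>. \<forall>K\<in>\<K>. bertrand_darboux A g K V) \<and>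
     (\<forall>V\<in>\<V>. \<exists>K W.
        (\<forall>k\<in>{1..2 * CARD('n) - 2}. K k \<in> \<K> \<and> is_potential_part A g (K k) V (W k)) \<and>
        functionally_independent A (2 * CARD('n) - 1)
          (\<lambda>k. if k = 0 then quadratic_integral (ginv g) V
               else quadratic_integral (raised g (K k)) (W k)))"

definition np1_parameter_system :: "('a, 'n::finite) chart set \<Rightarrow> ('a, 'n) tensor2 \<Rightarrow>
    ('a, 'n) tensor2 set \<Rightarrow> ('a \<Rightarrow> real) set \<Rightarrow> bool" where
  "np1_parameter_system A g \<K> \<V> \<longleftrightarrow> superintegrable_system A g \<K> \<V> \<and> dim \<V> = CARD('n) + 1"

definition nondegenerate_system :: "('a, 'n::finite) chart set \<Rightarrow> ('a, 'n) tensor2 \<Rightarrow>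
    ('a, 'n) tensor2 set \<Rightarrow> ('a \<Rightarrow> real) set \<Rightarrow> bool" where
  "nondegenerate_system A g \<K> \<V> \<longleftrightarrow> superintegrable_system A g \<K> \<V> \<and> dim \<V> = CARD('n) + 2"


section \<open>Structure tensors and the obstruction tensor\<close>

definition np1_structure_tensor :: "('a, 'n::finite) chart set \<Rightarrow> ('a, 'n) tensor2 \<Rightarrow>
    ('a \<Rightarrow> real) set \<Rightarrow> ('a, 'n) tensor3 \<Rightarrow> bool" where
  "np1_structure_tensor A g \<V> D \<longleftrightarrow>
     tensor_field_12 A D \<and>
     (\<forall>c\<in>A. \<forall>p\<in>cdom c. \<forall>i j m. D c p $ i $ j $ m = D c p $ j $ i $ m) \<and>
     (\<forall>V\<in>\<V>. \<forall>c\<in>A. \<forall>p\<in>cdom c. \<forall>i j.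
        hess g c V i j p = (\<Sum>m\<in>UNIV. D c p $ i $ j $ m * pd c m V p))"

definition nondegenerate_structure_tensor :: "('a, 'n::finite) chart set \<Rightarrow> ('a, 'n) tensor2 \<Rightarrow>
    ('a \<Rightarrow> real) set \<Rightarrow> ('a, 'n) tensor3 \<Rightarrow> bool" where
  "nondegenerate_structure_tensor A g \<V> T \<longleftrightarrow>
     tensor_field_12 A T \<and>
     (\<forall>c\<in>A. \<forall>p\<in>cdom c. \<forall>i j m. T c p $ i $ j $ m = T c p $ j $ i $ m) \<and>
     (\<forall>c\<in>A. \<forall>p\<in>cdom c. \<forall>m. (\<Sum>i\<in>UNIV. \<Sum>j\<in>UNIV. ginv g c p $ i $ j * T c p $ i $ j $ m) = 0) \<and>
     (\<forall>V\<in>\<V>. \<forall>c\<in>A. \<forall>p\<in>cdom c. \<forall>i j.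
        hess g c V i j p = (\<Sum>m\<in>UNIV. T c p $ i $ j $ m * pd c m V p)
          + 1 / real CARD('n) * g c p $ i $ j * laplacian g c V p)"

text \<open>\<open>D\<^sub>i\<^sub>j\<^sup>k - 1/n g\<^sub>i\<^sub>j D\<^sup>a\<^sub>a\<^sup>k\<close>\<close>

definition trace_free_part :: "('a, 'n::finite) tensor2 \<Rightarrow> ('a, 'n) tensor3 \<Rightarrow> ('a, 'n) tensor3" where
  "trace_free_part g D c p = (\<chi> i j k. D c p $ i $ j $ k - 1 / real CARD('n) * g c p $ i $ j *
     (\<Sum>a\<in>UNIV. \<Sum>b\<in>UNIV. ginv g c p $ a $ b * D c p $ b $ a $ k))"

text \<open>\<open>D\<^sub>i\<^sub>j\<^sub>k\<close>\<close>

definition lowered :: "('a, 'n::finite) tensor2 \<Rightarrow> ('a, 'n) tensor3 \<Rightarrow> ('a, 'n) tensor3" where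
  "lowered g D c p = (\<chi> i j k. \<Sum>m\<in>UNIV. D c p $ i $ j $ m * g c p $ m $ k)"

text \<open>\<open>m\<^sub>j = D\<^sup>i\<^sub>j\<^sub>i - D\<^sup>i\<^sub>i\<^sub>j\<close>\<close>

definition trace_difference :: "('a, 'n::finite) tensor2 \<Rightarrow> ('a, 'n) tensor3 \<Rightarrow>
    ('a, 'n) chart \<Rightarrow> 'a \<Rightarrow> real^'n" where
  "trace_difference g D c p = (\<chi> j. \<Sum>i\<in>UNIV. \<Sum>a\<in>UNIV. ginv g c p $ i $ a *
     (lowered g D c p $ a $ j $ i - lowered g D c p $ a $ i $ j))"

definition obstruction_tensor :: "('a, 'n::finite) tensor2 \<Rightarrow> ('a, 'n) tensor3 \<Rightarrow> ('a, 'n) tensor3" where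
  "obstruction_tensor g D c p = (\<chi> i j k.
     let L = lowered g D c p; m = trace_difference g D c p; n = real CARD('n) in
       1/3 * (2 * ((L $ i $ j $ k + L $ j $ i $ k) / 2) - L $ i $ k $ j - L $ j $ k $ i)
       + 2 / (3 * (n - 1)) * g c p $ i $ j * m $ k
       - 2 / (3 * (n - 1)) * ((g c p $ k $ i * m $ j + g c p $ k $ j * m $ i) / 2))"

end

theory Submission
  imports Defs
begin

text \<open>
  Let \<open>v\<^sub>\<alpha>\<close> be \<open>n\<close> potentials of the \<open>(n+1)\<close>-parameter system whose differentials are a basis at one
  point. Since the system \<open>V\<^sub>,\<^sub>i\<^sub>j = D\<^sub>i\<^sub>j\<^sup>m V\<^sub>,\<^sub>m\<close> is an ordinary differential equation for the gradient along
  curves, they are a coframe everywhere, and the \<open>v\<^sub>\<alpha>\<close> are flat coordinates of the connection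
  \<open>\<nabla> - D\<close>. With the one-forms \<open>\<Theta>\<^sub>\<alpha>\<close> defined by \<open>g = \<Sum>\<^sub>\<alpha> dv\<^sub>\<alpha> \<otimes> \<Theta>\<^sub>\<alpha>\<close>, the differentials \<open>d\<Theta>\<^sub>\<alpha>\<close> are
  the antisymmetric part \<open>D\<^sub>i\<^sub>j\<^sub>k - D\<^sub>i\<^sub>k\<^sub>j\<close>, and the obstruction tensor vanishes if and only if
  \<open>d\<Theta>\<^sub>\<alpha> = -\<mu> \<and> \<Theta>\<^sub>\<alpha>\<close>, where \<open>\<mu> = m / (n - 1)\<close>.

  A further potential \<open>U\<close> has the Hessian \<open>D dU + s g\<close>. Writing \<open>dU = \<Sum>\<^sub>\<alpha> u\<^sub>\<alpha> dv\<^sub>\<alpha>\<close>, this means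
  \<open>du\<^sub>\<alpha> = s \<Theta>\<^sub>\<alpha>\<close>. Hence \<open>d(s \<Theta>\<^sub>\<alpha>) = 0\<close>, whose trace is \<open>ds = s \<mu>\<close>; so \<open>s\<close> is nowhere zero and the
  obstruction vanishes. Conversely, if the obstruction vanishes, then \<open>d\<mu> \<and> \<Theta>\<^sub>\<alpha> = 0\<close> for all \<open>\<alpha>\<close>, which
  gives \<open>d\<mu> = 0\<close> for \<open>n \<ge> 3\<close>. On a simply connected manifold one can then integrate successively
  \<open>ds = s \<mu>\<close>, \<open>du\<^sub>\<alpha> = s \<Theta>\<^sub>\<alpha>\<close> and \<open>dU = \<Sum>\<^sub>\<alpha> u\<^sub>\<alpha> dv\<^sub>\<alpha>\<close>. The Bertrand-Darboux condition for \<open>U\<close> follows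
  from the symmetry of the Killing tensors, and functional independence for arbitrary potentials
  from the case of the zero potential by scaling the momenta.
\<close>


section \<open>Calculus on open subsets of Euclidean space\<close>

text \<open>The equation for dU is solved by variation of constants: in the coframe dv the
  Christoffel symbols and D drop out, and only the trace term s g survives. The count n + 1 enters
  twice. A solution of the homogeneous equation is fixed by its value and gradient at one point, so
  \<V> is already the full solution space; this provides the coframe, and it prevents a potential
  outside \<V> from having s identically zero, from which s is shown to vanish nowhere. The
  normalisation n - 1 in \<mu> comes from tracing g_ij \<mu>_k - g_ik \<mu>_j, and n >= 3 enters
  because the trace of d\<mu> \<and> \<Theta> = 0 is (n - 2) d\<mu> = 0. Two obstacles shape the
  rest. Tensors are given by components in charts, so the functions s, u and U of the construction
  need a global source: a theorem on closed one-forms, proved by continuing local primitives along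
  merely continuous paths. And the Killing tensors in (S2) may depend on the potential, so for a new
  potential those belonging to the zero potential are reused.\<close>

abbreviation partial :: "'n::finite \<Rightarrow> (real^'n \<Rightarrow> real) \<Rightarrow> real^'n \<Rightarrow> real" where
  "partial i f x \<equiv> frechet_derivative f (at x) (axis i 1)"

lemma partial_eqI: "(f has_derivative f') (at x) \<Longrightarrow> partial i f x = f' (axis i 1)"
  by (simp add: frechet_derivative_at[symmetric])

lemma has_derivative_partials:
  fixes f :: "real^'n::finite \<Rightarrow> real"
  assumes "f differentiable at x"
  shows "(f has_derivative (\<lambda>v. \<Sum>i\<in>UNIV. v $ i * partial i f x)) (at x)"
proof -
  have d: "(f has_derivative frechet_derivative f (at x)) (at x)"
    using assms by (simp add: frechet_derivative_works)
  then have l: "linear (frechet_derivative f (at x))" by (rule has_derivative_linear)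
  have "frechet_derivative f (at x) v = (\<Sum>i\<in>UNIV. v $ i * partial i f x)" for v
  proof -
    have "frechet_derivative f (at x) v = frechet_derivative f (at x) (\<Sum>i\<in>UNIV. (v $ i) *\<^sub>R axis i 1)"
      using basis_expansion[of v] by (simp add: scalar_mult_eq_scaleR)
    also have "\<dots> = (\<Sum>i\<in>UNIV. v $ i * partial i f x)"
      using l by (simp add: linear_sum linear_scale)
    finally show ?thesis .
  qed
  then show ?thesis using d by (metis (no_types, lifting) ext)
qed

lemma partial_transform:
  assumes "open S" "x \<in> S" "\<And>y. y \<in> S \<Longrightarrow> f y = g y"
  shows "partial i f x = partial i g x"
proof -
  have "(f has_derivative f') (at x) \<longleftrightarrow> (g has_derivative f') (at x)" for f'
    using has_derivative_transform_within_open[of f f' x UNIV S g]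
      has_derivative_transform_within_open[of g f' x UNIV S f] assms by auto
  then show ?thesis by (simp add: frechet_derivative_def)
qed

lemma differentiable_transform:
  assumes "open S" "x \<in> S" "\<And>y. y \<in> S \<Longrightarrow> f y = g y" "f differentiable at x"
  shows "g differentiable at x"
  using assms has_derivative_transform_within_open[of f _ x UNIV S g] unfolding differentiable_def by blast

section \<open>Closure properties of C^k and smooth functions\<close>

lemma Ck_on_cong:
  assumes "open S" "\<And>x. x \<in> S \<Longrightarrow> f x = g x" "Ck_on k S f"
  shows "Ck_on k S g"
  using assms(2,3)
proof (induction k arbitrary: f g)
  case 0
  then show ?case by (auto cong: continuous_on_cong)
next
  case (Suc k)
  have "g differentiable_on S"
    using Suc.prems assms(1) differentiable_transform[OF assms(1), of _ f g]
    by (simp add: differentiable_on_eq_differentiable_at)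
  moreover have "Ck_on k S (\<lambda>x. partial i g x)" for i
  proof (rule Suc.IH[of "\<lambda>x. partial i f x"])
    show "partial i f x = partial i g x" if "x \<in> S" for x
      by (rule partial_transform[OF assms(1) that]) (use Suc.prems in auto)
    show "Ck_on k S (\<lambda>x. partial i f x)" using Suc.prems by auto
  qed
  ultimately show ?case by simp
qed

lemma Ck_on_Suc: "Ck_on (Suc k) S f \<Longrightarrow> Ck_on k S f"
proof (induction k arbitrary: f)
  case 0
  then show ?case by (simp add: differentiable_imp_continuous_on)
next
  case (Suc k)
  then show ?case by (metis Ck_on.simps(2))
qed

lemma Ck_on_continuous_on: "Ck_on k S f \<Longrightarrow> continuous_on S f"
  by (induction k) (auto simp: differentiable_imp_continuous_on)

lemma Ck_on_const: "Ck_on k S (\<lambda>x. a)"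
  by (induction k arbitrary: a) auto

lemma partial_add:
  assumes "f differentiable at x" "g differentiable at x"
  shows "partial i (\<lambda>x. f x + g x) x = partial i f x + partial i g x"
proof -
  have "((\<lambda>x. f x + g x) has_derivative (\<lambda>h. frechet_derivative f (at x) h + frechet_derivative g (at x) h)) (at x)"
    using assms by (intro has_derivative_add) (auto simp: frechet_derivative_works)
  from partial_eqI[OF this] show ?thesis by simp
qed

lemma Ck_on_add:
  assumes "open S" "Ck_on k S f" "Ck_on k S g"
  shows "Ck_on k S (\<lambda>x. f x + g x)"
  using assms(2,3)
proof (induction k arbitrary: f g)
  case (Suc k)
  have *: "f differentiable at x" "g differentiable at x" if "x \<in> S" for x
    using Suc.prems that assms(1) by (auto simp: differentiable_on_eq_differentiable_at)
  have "Ck_on k S (\<lambda>x. partial i f x + partial i g x)" for i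
    using Suc by auto
  then have "Ck_on k S (partial i (\<lambda>x. f x + g x))" for i
    by (rule Ck_on_cong[OF assms(1), rotated]) (use * in \<open>auto simp: partial_add\<close>)
  then show ?case using Suc.prems by (auto intro: derivative_intros)
qed (auto intro: continuous_intros)

lemma partial_mult:
  assumes "f differentiable at x" "g differentiable at x"
  shows "partial i (\<lambda>x. f x * g x) x = partial i f x * g x + f x * partial i g x"
proof -
  have "((\<lambda>x. f x * g x) has_derivative (\<lambda>h. f x * frechet_derivative g (at x) h + frechet_derivative f (at x) h * g x)) (at x)"
    using assms by (intro has_derivative_mult) (auto simp: frechet_derivative_works)
  from partial_eqI[OF this] show ?thesis by simp
qed

lemma Ck_on_mult:
  assumes "open S" "Ck_on k S f" "Ck_on k S g"
  shows "Ck_on k S (\<lambda>x. f x * g x)"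
  using assms(2,3)
proof (induction k arbitrary: f g)
  case (Suc k)
  have *: "f differentiable at x" "g differentiable at x" if "x \<in> S" for x
    using Suc.prems that assms(1) by (auto simp: differentiable_on_eq_differentiable_at)
  have "Ck_on k S f" "Ck_on k S g" using Suc.prems Ck_on_Suc by blast+
  then have "Ck_on k S (\<lambda>x. partial i f x * g x + f x * partial i g x)" for i
    using Suc by (intro Ck_on_add[OF assms(1)]) auto
  then have "Ck_on k S (partial i (\<lambda>x. f x * g x))" for i
    by (rule Ck_on_cong[OF assms(1), rotated]) (use * in \<open>auto simp: partial_mult\<close>)
  then show ?case using Suc.prems by (auto intro: derivative_intros)
qed (auto intro: continuous_intros)

lemma partial_real_compose:
  fixes h :: "real \<Rightarrow> real"
  assumes "f differentiable at x" "(h has_real_derivative h') (at (f x))"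
  shows "partial i (\<lambda>x. h (f x)) x = h' * partial i f x" "(\<lambda>x. h (f x)) differentiable at x"
proof -
  have "((\<lambda>x. h (f x)) has_derivative (\<lambda>v. h' * frechet_derivative f (at x) v)) (at x)"
    using has_derivative_compose[of f "frechet_derivative f (at x)" x UNIV h "(*) h'"] assms
    by (auto simp: frechet_derivative_works has_field_derivative_def)
  then show "partial i (\<lambda>x. h (f x)) x = h' * partial i f x" "(\<lambda>x. h (f x)) differentiable at x"
    by (auto simp: partial_eqI intro: differentiableI)
qed

text \<open>The derivative contains the inverse itself, so the induction bootstraps: C^k for the
  inverse and for the partial derivatives of \<open>f\<close> gives C^(k+1) for the inverse.\<close>

lemma Ck_on_inverse:
  assumes "open S" "Ck_on k S f" "\<And>x. x \<in> S \<Longrightarrow> f x \<noteq> 0"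
  shows "Ck_on k S (\<lambda>x. inverse (f x))"
  using assms(2,3)
proof (induction k arbitrary: f)
  case (Suc k)
  have *: "f differentiable at x" if "x \<in> S" for x
    using Suc.prems that assms(1) by (auto simp: differentiable_on_eq_differentiable_at)
  have d: "partial i (\<lambda>x. inverse (f x)) x = - 1 * (inverse (f x) * inverse (f x)) * partial i f x"
    "(\<lambda>x. inverse (f x)) differentiable at x" if "x \<in> S" for x i
  proof -
    have "(inverse has_real_derivative - (inverse (f x) * inverse (f x))) (at (f x))"
      using that Suc.prems by (auto intro!: derivative_eq_intros)
    from partial_real_compose[OF *[OF that] this]
    show "partial i (\<lambda>x. inverse (f x)) x = - 1 * (inverse (f x) * inverse (f x)) * partial i f x"
      "(\<lambda>x. inverse (f x)) differentiable at x" by auto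
  qed
  have "Ck_on k S (\<lambda>x. inverse (f x))" using Suc Ck_on_Suc by blast
  then have "Ck_on k S (\<lambda>x. - 1 * (inverse (f x) * inverse (f x)) * partial i f x)" for i
    using Suc.prems by (intro Ck_on_mult[OF assms(1)] Ck_on_const) auto
  then have "Ck_on k S (partial i (\<lambda>x. inverse (f x)))" for i
    by (rule Ck_on_cong[OF assms(1), rotated]) (use d in auto)
  then show ?case using d assms(1) by (simp add: differentiable_on_eq_differentiable_at)
qed (auto intro!: continuous_intros)

lemma Ck_on_exp:
  assumes "open S" "Ck_on k S f"
  shows "Ck_on k S (\<lambda>x. exp (f x))"
  using assms(2)
proof (induction k arbitrary: f)
  case (Suc k)
  have *: "f differentiable at x" if "x \<in> S" for x
    using Suc.prems that assms(1) by (auto simp: differentiable_on_eq_differentiable_at)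
  have d: "partial i (\<lambda>x. exp (f x)) x = exp (f x) * partial i f x"
    "(\<lambda>x. exp (f x)) differentiable at x" if "x \<in> S" for x i
    using partial_real_compose[OF *, of x exp "exp (f x)"] that
    by (auto intro!: derivative_eq_intros)
  have "Ck_on k S (\<lambda>x. exp (f x))" using Suc Ck_on_Suc by blast
  then have "Ck_on k S (\<lambda>x. exp (f x) * partial i f x)" for i
    using Suc.prems by (intro Ck_on_mult[OF assms(1)]) auto
  then have "Ck_on k S (partial i (\<lambda>x. exp (f x)))" for i
    by (rule Ck_on_cong[OF assms(1), rotated]) (use d in auto)
  then show ?case using d assms(1) by (simp add: differentiable_on_eq_differentiable_at)
qed (auto intro!: continuous_intros)

lemma smooth_on_cong:
  "open S \<Longrightarrow> (\<And>x. x \<in> S \<Longrightarrow> f x = g x) \<Longrightarrow> smooth_on S f \<Longrightarrow> smooth_on S g"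
  unfolding smooth_on_def using Ck_on_cong by blast

lemma smooth_on_differentiable_at:
  "open S \<Longrightarrow> smooth_on S f \<Longrightarrow> x \<in> S \<Longrightarrow> f differentiable at x"
  unfolding smooth_on_def by (metis Ck_on.simps(2) differentiable_on_eq_differentiable_at)

lemma smooth_on_continuous_on: "smooth_on S f \<Longrightarrow> continuous_on S f"
  unfolding smooth_on_def using Ck_on_continuous_on by blast

lemma smooth_on_partial: "smooth_on S f \<Longrightarrow> smooth_on S (partial i f)"
  unfolding smooth_on_def by (metis Ck_on.simps(2))

lemma smooth_onI:
  assumes "f differentiable_on S" "\<And>i. smooth_on S (partial i f)"
  shows "smooth_on S f"
  unfolding smooth_on_def
proof
  fix k show "Ck_on k S f"
    using assms unfolding smooth_on_def by (cases k) (auto simp: differentiable_imp_continuous_on)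
qed

text \<open>Schwarz's theorem. The second difference over a small square is symmetric in the two
  directions, while two applications of the mean value theorem turn it into either mixed derivative
  at a nearby point; continuity then compares both with their values at \<open>x\<close>.\<close>

lemma partial_commute:
  fixes f :: "real^'n::finite \<Rightarrow> real"
  assumes "open S" "smooth_on S f" "x \<in> S"
  shows "partial i (partial j f) x = partial j (partial i f) x"
proof (rule ccontr)
  assume ne: "partial i (partial j f) x \<noteq> partial j (partial i f) x"
  \<comment> \<open>Half of the supposed gap: two errors below \<open>e\<close> cannot bridge
    it.\<close>
  define e where "e = \<bar>partial i (partial j f) x - partial j (partial i f) x\<bar> / 2"
  have e: "e > 0" using ne by (simp add: e_def)
  have line: "((\<lambda>s. F (y + s *\<^sub>R axis a 1)) has_real_derivative partial a F (y + s *\<^sub>R axis a 1)) (at s)"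
    if "smooth_on S F" "y + s *\<^sub>R axis a 1 \<in> S" for F y a s
  proof -
    have "(F has_derivative frechet_derivative F (at (y + s *\<^sub>R axis a 1))) (at (y + s *\<^sub>R axis a 1))"
      using smooth_on_differentiable_at[OF assms(1) that] by (simp add: frechet_derivative_works)
    then have "((\<lambda>s. F (y + s *\<^sub>R axis a 1)) has_derivative
        (\<lambda>h. frechet_derivative F (at (y + s *\<^sub>R axis a 1)) (h *\<^sub>R axis a 1))) (at s)"
      by (intro has_derivative_compose[of "\<lambda>s. y + s *\<^sub>R axis a 1" _ s UNIV F])
        (auto intro!: derivative_eq_intros)
    moreover have "frechet_derivative F (at (y + s *\<^sub>R axis a 1)) (h *\<^sub>R axis a 1)
        = partial a F (y + s *\<^sub>R axis a 1) * h" for h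
      using smooth_on_differentiable_at[OF assms(1) that]
      by (simp add: linear_frechet_derivative linear_scale)
    ultimately show ?thesis by (simp add: has_field_derivative_def)
  qed
  have near: "\<exists>d>0. \<forall>y. dist y x < d \<longrightarrow> y \<in> S \<and> \<bar>partial a (partial b f) y - partial a (partial b f) x\<bar> < e" for a b
  proof -
    have "isCont (partial a (partial b f)) x"
      using smooth_on_continuous_on[OF smooth_on_partial[OF smooth_on_partial[OF assms(2)]]] assms
      by (simp add: continuous_on_eq_continuous_at)
    then obtain d1 where "d1 > 0" "\<forall>y. dist y x < d1 \<longrightarrow> \<bar>partial a (partial b f) y - partial a (partial b f) x\<bar> < e"
      using e unfolding continuous_at_eps_delta dist_real_def by blast
    moreover obtain d2 where "d2 > 0" "\<forall>y. dist y x < d2 \<longrightarrow> y \<in> S"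
      using assms unfolding open_dist by blast
    ultimately show ?thesis by (intro exI[of _ "min d1 d2"]) auto
  qed
  obtain d1 where d1: "d1 > 0" "\<forall>y. dist y x < d1 \<longrightarrow> y \<in> S \<and> \<bar>partial i (partial j f) y - partial i (partial j f) x\<bar> < e"
    using near by blast
  obtain d2 where d2: "d2 > 0" "\<forall>y. dist y x < d2 \<longrightarrow> y \<in> S \<and> \<bar>partial j (partial i f) y - partial j (partial i f) x\<bar> < e"
    using near by blast
  \<comment> \<open>Points of the square have distance at most 2 h from \<open>x\<close>, which has
    to stay below both radii.\<close>
  define h where "h = min d1 d2 / 4"
  have h: "h > 0" "2 * h < d1" "2 * h < d2" using d1 d2 by (auto simp: h_def)
  have dd: "dist (x + s *\<^sub>R axis a 1 + t *\<^sub>R axis b 1) x \<le> 2 * h"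
    if "0 \<le> s" "s \<le> h" "0 \<le> t" "t \<le> h" for s t and a b :: 'n
  proof -
    have "norm (s *\<^sub>R axis a 1 + t *\<^sub>R axis b (1::real) :: real^'n) \<le> norm (s *\<^sub>R axis a 1 :: real^'n) + norm (t *\<^sub>R axis b 1 :: real^'n)"
      by (rule norm_triangle_ineq)
    then show ?thesis using that by (simp add: dist_norm add.assoc)
  qed
  \<comment> \<open>The second difference quotient is a value of either mixed partial derivative.\<close>
  have key: "\<exists>y. dist y x \<le> 2 * h \<and> f (x + h *\<^sub>R axis a 1 + h *\<^sub>R axis b 1) - f (x + h *\<^sub>R axis a 1)
      - f (x + h *\<^sub>R axis b 1) + f x = h * h * partial b (partial a f) y" for a b
  proof -
    have inS: "x + s *\<^sub>R axis a 1 + t *\<^sub>R axis b 1 \<in> S" if "0 \<le> s" "s \<le> h" "0 \<le> t" "t \<le> h" for s t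
      using dd[OF that, of a b] d1 h by auto
    have inS': "x + t *\<^sub>R axis b 1 + s *\<^sub>R axis a 1 \<in> S" if "0 \<le> s" "s \<le> h" "0 \<le> t" "t \<le> h" for s t
      using inS[OF that] by (simp add: algebra_simps)
    have "\<exists>z>0. z < h \<and>
      (f (x + h *\<^sub>R axis b 1 + h *\<^sub>R axis a 1) - f (x + 0 *\<^sub>R axis b 1 + h *\<^sub>R axis a 1))
      - (f (x + h *\<^sub>R axis b 1 + 0 *\<^sub>R axis a 1) - f (x + 0 *\<^sub>R axis b 1 + 0 *\<^sub>R axis a 1))
      = (h - 0) * (partial a f (x + h *\<^sub>R axis b 1 + z *\<^sub>R axis a 1) - partial a f (x + 0 *\<^sub>R axis b 1 + z *\<^sub>R axis a 1))"
      by (rule MVT2) (use h inS' assms(2) in \<open>auto intro!: DERIV_diff line\<close>, use inS'[of _ 0] in auto)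
    then obtain s where s: "s > 0" "s < h"
      "(f (x + h *\<^sub>R axis b 1 + h *\<^sub>R axis a 1) - f (x + 0 *\<^sub>R axis b 1 + h *\<^sub>R axis a 1))
      - (f (x + h *\<^sub>R axis b 1 + 0 *\<^sub>R axis a 1) - f (x + 0 *\<^sub>R axis b 1 + 0 *\<^sub>R axis a 1))
      = (h - 0) * (partial a f (x + h *\<^sub>R axis b 1 + s *\<^sub>R axis a 1) - partial a f (x + 0 *\<^sub>R axis b 1 + s *\<^sub>R axis a 1))"
      by blast
    have "\<exists>z>0. z < h \<and>
      partial a f (x + s *\<^sub>R axis a 1 + h *\<^sub>R axis b 1) - partial a f (x + s *\<^sub>R axis a 1 + 0 *\<^sub>R axis b 1)
      = (h - 0) * partial b (partial a f) (x + s *\<^sub>R axis a 1 + z *\<^sub>R axis b 1)"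
      by (rule MVT2) (use h inS s smooth_on_partial[OF assms(2)] in \<open>auto intro!: line\<close>)
    then obtain t where t: "t > 0" "t < h"
      "partial a f (x + s *\<^sub>R axis a 1 + h *\<^sub>R axis b 1) - partial a f (x + s *\<^sub>R axis a 1 + 0 *\<^sub>R axis b 1)
      = (h - 0) * partial b (partial a f) (x + s *\<^sub>R axis a 1 + t *\<^sub>R axis b 1)"
      by blast
    show ?thesis
      using s t dd[of s t a b] by (intro exI[of _ "x + s *\<^sub>R axis a 1 + t *\<^sub>R axis b 1"])
        (auto simp: add.commute add.left_commute)
  qed
  obtain y where y: "dist y x \<le> 2 * h" "f (x + h *\<^sub>R axis i 1 + h *\<^sub>R axis j 1) - f (x + h *\<^sub>R axis i 1)
      - f (x + h *\<^sub>R axis j 1) + f x = h * h * partial j (partial i f) y" using key by blast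
  obtain z where z: "dist z x \<le> 2 * h" "f (x + h *\<^sub>R axis j 1 + h *\<^sub>R axis i 1) - f (x + h *\<^sub>R axis j 1)
      - f (x + h *\<^sub>R axis i 1) + f x = h * h * partial i (partial j f) z" using key by blast
  have eq: "x + h *\<^sub>R axis j 1 + h *\<^sub>R axis i 1 = x + h *\<^sub>R axis i 1 + h *\<^sub>R axis j 1"
    by simp
  have "h * h * partial i (partial j f) z = h * h * partial j (partial i f) y"
    using y(2) z(2)[unfolded eq] by linarith
  then have "partial i (partial j f) z = partial j (partial i f) y" using h(1)
    by (metis mult_cancel_left less_irrefl no_zero_divisors)
  moreover have "\<bar>partial j (partial i f) y - partial j (partial i f) x\<bar> < e" using y d2 h by auto
  moreover have "\<bar>partial i (partial j f) z - partial i (partial j f) x\<bar> < e" using z d1 h by auto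
  ultimately show False unfolding e_def by (simp add: abs_if field_simps split: if_splits)
qed

text \<open>On a small closed ball let M be the maximum of the sum of all |y_b|. The mean value
  inequality from the centre, where all y_b vanish, gives M <= B r M; once B r < 1, this forces M =
  0. It replaces Gronwall's inequality and treats all directions at once.\<close>

lemma linear_ode_unique:
  fixes y :: "'b::finite \<Rightarrow> real^'n::finite \<Rightarrow> real"
  assumes S: "open S" "x0 \<in> S"
    and y: "\<And>b x. x \<in> S \<Longrightarrow> y b differentiable at x"
    and C: "\<And>i b d. continuous_on S (C i b d)"
    and eq: "\<And>i b x. x \<in> S \<Longrightarrow> partial i (y b) x = (\<Sum>d\<in>UNIV. C i b d x * y d x)"
    and init: "\<And>b. y b x0 = 0"
  shows "\<exists>r>0. \<forall>x\<in>ball x0 r. \<forall>b. y b x = 0"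
proof -
  \<comment> \<open>Adding 1 to each coefficient at the centre leaves room for a bound on a whole
    neighbourhood.\<close>
  define B where "B = (\<Sum>b\<in>UNIV. \<Sum>i\<in>UNIV. \<Sum>d\<in>UNIV. \<bar>C i b d x0\<bar> + 1)"
  have "\<forall>\<^sub>F x in nhds x0. \<forall>i b d. \<bar>C i b d x\<bar> < \<bar>C i b d x0\<bar> + 1"
  proof (intro eventually_all_finite)
    fix i b d
    have "isCont (C i b d) x0" using C[of i b d] S by (simp add: continuous_on_eq_continuous_at)
    then have "isCont (\<lambda>x. \<bar>C i b d x\<bar>) x0" by (intro continuous_intros)
    then have "\<forall>\<^sub>F x in at x0. \<bar>C i b d x\<bar> < \<bar>C i b d x0\<bar> + 1"
      unfolding isCont_def by (rule order_tendstoD) simp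
    then show "\<forall>\<^sub>F x in nhds x0. \<bar>C i b d x\<bar> < \<bar>C i b d x0\<bar> + 1"
      by (simp add: eventually_nhds_conv_at)
  qed
  moreover have "\<forall>\<^sub>F x in nhds x0. x \<in> S" using S by (rule eventually_nhds_in_open)
  ultimately have "\<forall>\<^sub>F x in nhds x0. (\<forall>i b d. \<bar>C i b d x\<bar> < \<bar>C i b d x0\<bar> + 1) \<and> x \<in> S"
    by (rule eventually_conj)
  then obtain d where d: "d > 0" "\<And>x. dist x x0 < d \<Longrightarrow> (\<forall>i b d. \<bar>C i b d x\<bar> < \<bar>C i b d x0\<bar> + 1) \<and> x \<in> S"
    unfolding eventually_nhds_metric by blast
  have B0: "B \<ge> 0" unfolding B_def by (intro sum_nonneg) auto
  \<comment> \<open>The first entry keeps the closed ball inside the neighbourhood where the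
    coefficients are bounded, the second makes \<open>r * B < 1\<close>; the 1 added to
    \<open>B\<close> avoids division by zero.\<close>
  define r where "r = min (d / 2) (1 / (2 * (B + 1)))"
  have r: "r > 0" "r < d" "r * B < 1"
  proof -
    show "r > 0" "r < d" using d B0 by (auto simp: r_def)
    have "r * B \<le> 1 / (2 * (B + 1)) * B" using B0 by (intro mult_right_mono) (auto simp: r_def)
    also have "\<dots> < 1" using B0 by (simp add: divide_simps)
    finally show "r * B < 1" .
  qed
  define M where "M x = (\<Sum>b\<in>UNIV. \<bar>y b x\<bar>)" for x
  have sub: "cball x0 r \<subseteq> S" using d(2) r by (auto simp: dist_commute)
  have "continuous_on (cball x0 r) (y b)" for b
    using y sub by (intro continuous_at_imp_continuous_on ballI differentiable_imp_continuous_within) blast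
  then have "continuous_on (cball x0 r) M"
    unfolding M_def by (intro continuous_intros)
  then obtain x1 where x1: "x1 \<in> cball x0 r" "\<And>x. x \<in> cball x0 r \<Longrightarrow> M x \<le> M x1"
    using continuous_attains_sup[of "cball x0 r" M] r by auto
  have M0: "M x \<ge> 0" for x unfolding M_def by (intro sum_nonneg) auto
  have bound: "\<bar>y b x\<bar> \<le> (\<Sum>i\<in>UNIV. \<Sum>d\<in>UNIV. (\<bar>C i b d x0\<bar> + 1)) * M x1 * r"
    if "x \<in> cball x0 r" for b x
  proof -
    let ?K = "(\<Sum>i\<in>UNIV. \<Sum>d\<in>UNIV. (\<bar>C i b d x0\<bar> + 1)) * M x1"
    have K0: "?K \<ge> 0" using M0 by (intro mult_nonneg_nonneg sum_nonneg) auto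
    have "norm (y b x - y b x0) \<le> ?K * norm (x - x0)"
    proof (rule differentiable_bound[of "cball x0 r"])
      show "(y b has_derivative (\<lambda>v. \<Sum>i\<in>UNIV. v $ i * partial i (y b) z)) (at z within cball x0 r)"
        if "z \<in> cball x0 r" for z
        using has_derivative_partials[OF y] that sub by (blast intro: has_derivative_at_withinI)
      show "onorm (\<lambda>v. \<Sum>i\<in>UNIV. v $ i * partial i (y b) z) \<le> ?K" if z: "z \<in> cball x0 r" for z
      proof (rule onorm_le)
        fix v :: "real^'n"
        have p: "\<bar>partial i (y b) z\<bar> \<le> (\<Sum>d\<in>UNIV. (\<bar>C i b d x0\<bar> + 1)) * M x1" for i
        proof -
          have "\<bar>partial i (y b) z\<bar> \<le> (\<Sum>d\<in>UNIV. \<bar>C i b d z\<bar> * \<bar>y d z\<bar>)"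
            using eq[OF subsetD[OF sub z], of b i] by (auto simp: abs_mult[symmetric])
          also have "\<dots> \<le> (\<Sum>d\<in>UNIV. (\<bar>C i b d x0\<bar> + 1) * M x1)"
          proof (rule sum_mono)
            fix e
            have "\<bar>y e z\<bar> \<le> M z" unfolding M_def by (rule member_le_sum) auto
            then have "\<bar>y e z\<bar> \<le> M x1" using x1(2)[OF z] by linarith
            moreover have "\<bar>C i b e z\<bar> \<le> \<bar>C i b e x0\<bar> + 1"
              using d(2)[of z] z r by (auto simp: dist_commute less_imp_le)
            ultimately show "\<bar>C i b e z\<bar> * \<bar>y e z\<bar> \<le> (\<bar>C i b e x0\<bar> + 1) * M x1"
              by (intro mult_mono) auto
          qed
          finally show ?thesis by (simp add: sum_distrib_right)
        qed
        have "norm (\<Sum>i\<in>UNIV. v $ i * partial i (y b) z) \<le> (\<Sum>i\<in>UNIV. norm v * ((\<Sum>d\<in>UNIV. (\<bar>C i b d x0\<bar> + 1)) * M x1))"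
          using p by (intro order_trans[OF norm_sum] sum_mono) (auto simp: abs_mult intro!: mult_mono component_le_norm_cart)
        then show "norm (\<Sum>i\<in>UNIV. v $ i * partial i (y b) z) \<le> ?K * norm v"
          by (simp add: sum_distrib_right sum_distrib_left mult_ac)
      qed
    qed (use that r in auto)
    also have "\<dots> \<le> ?K * r" using that K0 by (intro mult_left_mono) (auto simp: dist_norm norm_minus_commute)
    finally show ?thesis using init by simp
  qed
  have "M x1 \<le> (\<Sum>b\<in>UNIV. (\<Sum>i\<in>UNIV. \<Sum>d\<in>UNIV. (\<bar>C i b d x0\<bar> + 1)) * M x1 * r)"
    unfolding M_def[of x1] using bound[OF x1(1)] by (intro sum_mono) (auto simp: M_def)
  also have "\<dots> = B * r * M x1"
    unfolding B_def by (simp add: sum_distrib_right sum_distrib_left mult_ac)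
  finally have "M x1 \<le> B * r * M x1" .
  then have "M x1 = 0" using M0[of x1] r(3)
    by (smt (verit) mult.commute mult_left_less_imp_less mult_cancel_left1 mult_less_cancel_right1)
  then have "M x = 0" if "x \<in> cball x0 r" for x using x1(2)[OF that] M0[of x] by linarith
  then have "y b x = 0" if "x \<in> cball x0 r" for x b
    using that unfolding M_def by (subst (asm) sum_nonneg_eq_0_iff) auto
  then show ?thesis using r(1) by (intro exI[of _ r]) auto
qed


text \<open>The primitive is the integral of the form along the radius from the centre.
  Differentiating under the integral sign gives integrands \<open>G j\<close>, which closedness
  turns into the derivative of t \<omega>_j along the radius; the fundamental theorem then returns
  \<omega>_j at the endpoint.\<close>

lemma poincare_ball:
  fixes \<omega> :: "'n::finite \<Rightarrow> real^'n \<Rightarrow> real"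
  assumes S: "open S" "ball x0 r \<subseteq> S"
    and sm: "\<And>i. smooth_on S (\<omega> i)"
    and closed: "\<And>i j x. x \<in> S \<Longrightarrow> partial i (\<omega> j) x = partial j (\<omega> i) x"
  obtains F where "\<And>x. x \<in> ball x0 r \<Longrightarrow> (F has_derivative (\<lambda>v. \<Sum>i\<in>UNIV. v $ i * \<omega> i x)) (at x)"
proof -
  let ?U = "ball x0 r"
  define \<gamma> where "\<gamma> x t = x0 + t *\<^sub>R (x - x0)" for x and t :: real
  define F where "F x = integral (cbox 0 1) (\<lambda>t. \<Sum>i\<in>UNIV. \<omega> i (\<gamma> x t) * (x $ i - x0 $ i))" for x
  \<comment> \<open>The partial derivative in direction \<open>j\<close> of the integrand of
    \<open>F\<close>.\<close>
  define G where "G j x t = \<omega> j (\<gamma> x t) + t * (\<Sum>i\<in>UNIV. partial j (\<omega> i) (\<gamma> x t) * (x $ i - x0 $ i))" for j x t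
  \<comment> \<open>The coordinate projections as bounded linear functions: differentiation under
    the integral sign expects the derivative as a continuous family \<open>fx\<close> of such
    functions.\<close>
  define P :: "'n \<Rightarrow> (real^'n) \<Rightarrow>\<^sub>L real" where "P j = Blinfun (\<lambda>v. v $ j)" for j
  define fx where "fx x t = (\<Sum>j\<in>UNIV. G j x t *\<^sub>R P j)" for x t
  have P: "blinfun_apply (P j) v = v $ j" for j v
    unfolding P_def by (subst bounded_linear_Blinfun_apply) (auto intro: bounded_linear_vec_nth)
  have fx: "blinfun_apply (fx x t) v = (\<Sum>j\<in>UNIV. G j x t * v $ j)" for x t v
    by (simp add: fx_def P blinfun.sum_left blinfun.scaleR_left)
  have in_S: "\<gamma> x t \<in> S" if "x \<in> ?U" "t \<in> cbox 0 1" for x t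
  proof -
    have "norm (t *\<^sub>R (x - x0)) \<le> norm (x - x0)" using that by (simp add: mult_left_le_one_le)
    then have "\<gamma> x t \<in> ?U" using that by (simp add: \<gamma>_def dist_norm norm_minus_commute)
    then show ?thesis using S by blast
  qed
  have cont: "continuous_on S (\<omega> i)" "continuous_on S (partial j (\<omega> i))" for i j
    using sm smooth_on_continuous_on smooth_on_partial by blast+
  have \<gamma>c: "continuous_on X (\<lambda>z. \<gamma> (p z) (q z))" if "continuous_on X p" "continuous_on X q" for X p and q :: "'b::topological_space \<Rightarrow> real"
    unfolding \<gamma>_def using that by (intro continuous_intros)
  have "(F has_derivative (\<lambda>v. \<Sum>i\<in>UNIV. v $ i * \<omega> i x)) (at x)" if x: "x \<in> ?U" for x
  proof -
    have der: "((\<lambda>x. \<Sum>i\<in>UNIV. \<omega> i (\<gamma> x t) * (x $ i - x0 $ i)) has_derivative blinfun_apply (fx x t)) (at x within ?U)"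
      if "x \<in> ?U" "t \<in> cbox 0 1" for x t
    proof -
      have d: "((\<lambda>x. \<omega> i (\<gamma> x t)) has_derivative (\<lambda>v. \<Sum>j\<in>UNIV. (t *\<^sub>R v) $ j * partial j (\<omega> i) (\<gamma> x t))) (at x)" for i
      proof (rule has_derivative_compose[where f = "\<lambda>x. \<gamma> x t" and g = "\<omega> i"])
        show "((\<lambda>x. \<gamma> x t) has_derivative (\<lambda>v. t *\<^sub>R v)) (at x)"
          unfolding \<gamma>_def by (auto intro!: derivative_eq_intros)
        show "(\<omega> i has_derivative (\<lambda>v. \<Sum>j\<in>UNIV. v $ j * partial j (\<omega> i) (\<gamma> x t))) (at (\<gamma> x t))"
          by (intro has_derivative_partials smooth_on_differentiable_at[OF S(1) sm] in_S that)
      qed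
      have "((\<lambda>x. \<Sum>i\<in>UNIV. \<omega> i (\<gamma> x t) * (x $ i - x0 $ i)) has_derivative
         (\<lambda>v. \<Sum>i\<in>UNIV. \<omega> i (\<gamma> x t) * v $ i + (\<Sum>j\<in>UNIV. (t *\<^sub>R v) $ j * partial j (\<omega> i) (\<gamma> x t)) * (x $ i - x0 $ i))) (at x)"
        by (intro has_derivative_sum has_derivative_mult d)
          (auto intro!: derivative_eq_intros bounded_linear_imp_has_derivative bounded_linear_vec_nth)
      moreover have "(\<Sum>i\<in>UNIV. \<omega> i (\<gamma> x t) * v $ i + (\<Sum>j\<in>UNIV. (t *\<^sub>R v) $ j * partial j (\<omega> i) (\<gamma> x t)) * (x $ i - x0 $ i))
        = blinfun_apply (fx x t) v" for v
      proof -
        have "(\<Sum>i\<in>UNIV. (\<Sum>j\<in>UNIV. (t *\<^sub>R v) $ j * partial j (\<omega> i) (\<gamma> x t)) * (x $ i - x0 $ i))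
          = (\<Sum>j\<in>UNIV. (t * (\<Sum>i\<in>UNIV. partial j (\<omega> i) (\<gamma> x t) * (x $ i - x0 $ i))) * v $ j)"
          by (simp add: sum_distrib_left sum_distrib_right, subst sum.swap) (simp add: mult_ac)
        then show ?thesis unfolding fx G_def by (simp add: sum.distrib distrib_right)
      qed
      ultimately show ?thesis by (simp add: has_derivative_at_withinI)
    qed
    have "((\<lambda>x. integral (cbox 0 1) (\<lambda>t. \<Sum>i\<in>UNIV. \<omega> i (\<gamma> x t) * (x $ i - x0 $ i)))
        has_derivative blinfun_apply (integral (cbox 0 1) (fx x))) (at x within ?U)"
    proof (rule leibniz_rule[OF der])
      show "(\<lambda>t. \<Sum>i\<in>UNIV. \<omega> i (\<gamma> x t) * (x $ i - x0 $ i)) integrable_on cbox 0 1" if "x \<in> ?U" for x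
        by (intro integrable_continuous continuous_intros continuous_on_compose2[OF cont(1)] \<gamma>c) (use in_S that in auto)
      show "continuous_on (?U \<times> cbox 0 1) (\<lambda>(x, t). fx x t)"
        unfolding fx_def G_def case_prod_beta
        by (intro continuous_intros continuous_on_compose2[OF cont(1)] continuous_on_compose2[OF cont(2)] \<gamma>c)
         (use in_S in \<open>auto simp del: mem_box_real\<close>)
    qed (use x in auto)
    then have F: "(F has_derivative blinfun_apply (integral (cbox 0 1) (fx x))) (at x)"
      using x by (simp add: F_def[abs_def] at_within_open[of _ ?U])
    \<comment> \<open>Here closedness enters: it exchanges the indices in the second summand of
      \<open>G j x t\<close>, which thereby becomes t times the derivative of \<omega>_j along the
      radius.\<close>
    have G: "(G j x has_integral \<omega> j x) (cbox 0 1)" for j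
    proof -
      have "(G j x has_integral 1 * \<omega> j (\<gamma> x 1) - 0 * \<omega> j (\<gamma> x 0)) {0..1}"
      proof (rule fundamental_theorem_of_calculus)
        fix t :: real assume t: "t \<in> {0..1}"
        then have gS: "\<gamma> x t \<in> S" using in_S[OF x, of t] by auto
        have "((\<lambda>t. \<omega> j (\<gamma> x t)) has_derivative (\<lambda>h. \<Sum>i\<in>UNIV. (h *\<^sub>R (x - x0)) $ i * partial i (\<omega> j) (\<gamma> x t))) (at t)"
        proof (rule has_derivative_compose[where f = "\<lambda>t. \<gamma> x t" and g = "\<omega> j"])
          show "((\<lambda>t. \<gamma> x t) has_derivative (\<lambda>h. h *\<^sub>R (x - x0))) (at t)"
            unfolding \<gamma>_def by (auto intro!: derivative_eq_intros)
          show "(\<omega> j has_derivative (\<lambda>v. \<Sum>i\<in>UNIV. v $ i * partial i (\<omega> j) (\<gamma> x t))) (at (\<gamma> x t))"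
            by (intro has_derivative_partials smooth_on_differentiable_at[OF S(1) sm] gS)
        qed
        then have "((\<lambda>t. \<omega> j (\<gamma> x t)) has_real_derivative (\<Sum>i\<in>UNIV. (x $ i - x0 $ i) * partial i (\<omega> j) (\<gamma> x t))) (at t)"
          unfolding has_field_derivative_def
          by (rule has_derivative_eq_rhs) (auto simp: fun_eq_iff sum_distrib_left sum_distrib_right mult_ac)
        then have "((\<lambda>t. t * \<omega> j (\<gamma> x t)) has_real_derivative
           (\<Sum>i\<in>UNIV. (x $ i - x0 $ i) * partial i (\<omega> j) (\<gamma> x t)) * t + 1 * \<omega> j (\<gamma> x t)) (at t)"
          by (rule DERIV_mult[OF DERIV_ident, THEN DERIV_cong]) simp
        moreover have "(\<Sum>i\<in>UNIV. (x $ i - x0 $ i) * partial i (\<omega> j) (\<gamma> x t)) * t + 1 * \<omega> j (\<gamma> x t) = G j x t"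
          unfolding G_def using closed[OF gS, of _ j] by (simp add: mult_ac)
        ultimately show "((\<lambda>t. t * \<omega> j (\<gamma> x t)) has_vector_derivative G j x t) (at t within {0..1})"
          by (simp add: has_real_derivative_iff_has_vector_derivative[symmetric] has_field_derivative_at_within)
      qed simp
      then show ?thesis by (simp add: \<gamma>_def)
    qed
    have "((\<lambda>t. \<Sum>j\<in>UNIV. G j x t *\<^sub>R P j) has_integral (\<Sum>j\<in>UNIV. \<omega> j x *\<^sub>R P j)) (cbox 0 1)"
      by (intro has_integral_sum has_integral_scaleR_left G) auto
    then have "integral (cbox 0 1) (fx x) = (\<Sum>j\<in>UNIV. \<omega> j x *\<^sub>R P j)"
      unfolding fx_def[abs_def] by (rule integral_unique)
    then have "blinfun_apply (integral (cbox 0 1) (fx x)) = (\<lambda>v. \<Sum>i\<in>UNIV. v $ i * \<omega> i x)"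
      by (simp add: fun_eq_iff P blinfun.sum_left blinfun.scaleR_left mult.commute)
    then show ?thesis using F by simp
  qed
  then show ?thesis by (rule that)
qed


section \<open>Global primitives on simply connected spaces\<close>

text \<open>The pairs in \<open>\<F>\<close> are local primitives \<open>f\<close> with their domains \<open>S\<close>. The function \<open>h\<close> continues them
  along \<open>\<gamma>\<close>: it differs from each of the \<open>f \<circ> \<gamma>\<close> by a locally constant function.\<close>

definition along :: "('a set \<times> ('a \<Rightarrow> real)) set \<Rightarrow> ('b::topological_space \<Rightarrow> 'a) \<Rightarrow> 'b set \<Rightarrow> ('b \<Rightarrow> real) \<Rightarrow> bool" where
  "along \<F> \<gamma> X h \<longleftrightarrow> (\<forall>x\<in>X. \<forall>(S, f)\<in>\<F>. \<gamma> x \<in> S \<longrightarrow>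
     (\<forall>\<^sub>F y in nhds x. y \<in> X \<longrightarrow> h y - f (\<gamma> y) = h x - f (\<gamma> x)))"

lemma alongD:
  "along \<F> \<gamma> X h \<Longrightarrow> x \<in> X \<Longrightarrow> (S, f) \<in> \<F> \<Longrightarrow> \<gamma> x \<in> S \<Longrightarrow>
    \<forall>\<^sub>F y in nhds x. y \<in> X \<longrightarrow> h y - f (\<gamma> y) = h x - f (\<gamma> x)"
  unfolding along_def by blast

lemma alongI:
  "(\<And>x S f. x \<in> X \<Longrightarrow> (S, f) \<in> \<F> \<Longrightarrow> \<gamma> x \<in> S \<Longrightarrow>
    \<forall>\<^sub>F y in nhds x. y \<in> X \<longrightarrow> h y - f (\<gamma> y) = h x - f (\<gamma> x)) \<Longrightarrow> along \<F> \<gamma> X h"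
  unfolding along_def by blast

lemma continuous_on_eventually_nhds:
  assumes "continuous_on X \<gamma>" "x \<in> X" "eventually P (nhds (\<gamma> x))"
  shows "\<forall>\<^sub>F y in nhds x. y \<in> X \<longrightarrow> P (\<gamma> y)"
proof -
  have "(\<gamma> \<longlongrightarrow> \<gamma> x) (at x within X)" using assms by (simp add: continuous_on)
  then have "\<forall>\<^sub>F y in at x within X. P (\<gamma> y)"
    using assms(3) by (simp add: filterlim_iff)
  then have "\<forall>\<^sub>F y in nhds x. y \<noteq> x \<longrightarrow> y \<in> X \<longrightarrow> P (\<gamma> y)"
    by (simp add: eventually_at_filter)
  then show ?thesis
    by eventually_elim (use eventually_nhds_x_imp_x[OF assms(3)] in blast)
qed

lemma along_subset: "along \<F> \<gamma> X h \<Longrightarrow> Y \<subseteq> X \<Longrightarrow> along \<F> \<gamma> Y h"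
  by (rule alongI) (auto elim!: eventually_mono dest!: alongD)

lemma along_cong:
  assumes "along \<F> \<gamma> X h" "\<And>x. x \<in> X \<Longrightarrow> \<gamma> x = \<gamma>' x" "\<And>x. x \<in> X \<Longrightarrow> h x = h' x"
  shows "along \<F> \<gamma>' X h'"
proof (rule alongI)
  fix x S f assume *: "x \<in> X" "(S, f) \<in> \<F>" "\<gamma>' x \<in> S"
  have "\<forall>\<^sub>F y in nhds x. y \<in> X \<longrightarrow> h y - f (\<gamma> y) = h x - f (\<gamma> x)"
    using alongD[OF assms(1)] * assms(2) by auto
  then show "\<forall>\<^sub>F y in nhds x. y \<in> X \<longrightarrow> h' y - f (\<gamma>' y) = h' x - f (\<gamma>' x)"
    by eventually_elim (use * assms in auto)
qed

lemma along_compose: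
  assumes "along \<F> \<gamma> X h" "continuous_on Y r" "r ` Y \<subseteq> X"
  shows "along \<F> (\<lambda>y. \<gamma> (r y)) Y (\<lambda>y. h (r y))"
proof (rule alongI)
  fix x S f assume *: "x \<in> Y" "(S, f) \<in> \<F>" "\<gamma> (r x) \<in> S"
  then have "\<forall>\<^sub>F y in nhds (r x). y \<in> X \<longrightarrow> h y - f (\<gamma> y) = h (r x) - f (\<gamma> (r x))"
    using assms by (intro alongD) auto
  from continuous_on_eventually_nhds[OF assms(2) *(1) this]
  show "\<forall>\<^sub>F y in nhds x. y \<in> Y \<longrightarrow> h (r y) - f (\<gamma> (r y)) = h (r x) - f (\<gamma> (r x))"
    by eventually_elim (use assms in auto)
qed

text \<open>One of the continuations is shifted by the constant by which they differ on the overlap.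
  Since both pieces are closed, a point outside one of them has a neighbourhood missing it, so the
  local condition can be checked on each piece separately.\<close>

lemma along_glue:
  assumes X: "along \<F> \<gamma> X h" "closed X" and Y: "along \<F> \<gamma> Y h'" "closed Y"
    and const: "\<And>x y. x \<in> X \<inter> Y \<Longrightarrow> y \<in> X \<inter> Y \<Longrightarrow> h x - h' x = h y - h' y"
  shows "\<exists>k. along \<F> \<gamma> (X \<union> Y) k"
proof -
  obtain c where c: "\<And>x. x \<in> X \<inter> Y \<Longrightarrow> h x = h' x + c"
  proof (cases "X \<inter> Y = {}")
    case False
    then obtain z where "z \<in> X \<inter> Y" by blast
    from that[of "h z - h' z"] const[OF _ this] show ?thesis by (simp add: algebra_simps)
  qed (use that in auto)
  define k where "k x = (if x \<in> X then h x else h' x + c)" for x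
  have kY: "k x = h' x + c" if "x \<in> Y" for x using c that by (auto simp: k_def)
  have "along \<F> \<gamma> (X \<union> Y) k"
  proof (rule alongI)
    fix x S f assume *: "x \<in> X \<union> Y" "(S, f) \<in> \<F>" "\<gamma> x \<in> S"
    have "\<forall>\<^sub>F y in nhds x. y \<in> X \<longrightarrow> k y - f (\<gamma> y) = k x - f (\<gamma> x)"
    proof (cases "x \<in> X")
      case True
      from alongD[OF X(1) True *(2,3)] show ?thesis
        by eventually_elim (use True in \<open>auto simp: k_def\<close>)
    next
      case False
      then have "\<forall>\<^sub>F y in nhds x. y \<in> - X" using X(2) by (intro eventually_nhds_in_open) auto
      then show ?thesis by eventually_elim auto
    qed
    moreover have "\<forall>\<^sub>F y in nhds x. y \<in> Y \<longrightarrow> k y - f (\<gamma> y) = k x - f (\<gamma> x)"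
    proof (cases "x \<in> Y")
      case True
      from alongD[OF Y(1) True *(2,3)] show ?thesis
        by eventually_elim (use True in \<open>auto simp: kY\<close>)
    next
      case False
      then have "\<forall>\<^sub>F y in nhds x. y \<in> - Y" using Y(2) by (intro eventually_nhds_in_open) auto
      then show ?thesis by eventually_elim auto
    qed
    ultimately show "\<forall>\<^sub>F y in nhds x. y \<in> X \<union> Y \<longrightarrow> k y - f (\<gamma> y) = k x - f (\<gamma> x)"
      by eventually_elim auto
  qed
  then show ?thesis by blast
qed

text \<open>Simple connectedness is stated by free homotopies between arbitrary loops, constant ones
  included. A homotopy from the constant loop at \<open>p\<close> to that at \<open>q\<close> moves
  the base point along a path from \<open>p\<close> to \<open>q\<close>.\<close>

lemma simply_connected_path:
  fixes p q :: "'a::topological_space"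
  assumes sc: "simply_connected (UNIV :: 'a set)"
  shows "\<exists>\<gamma>. path \<gamma> \<and> pathstart \<gamma> = p \<and> pathfinish \<gamma> = q"
proof -
  have "homotopic_loops UNIV (\<lambda>_. p) (\<lambda>_. q)"
    using sc unfolding simply_connected_def by (auto simp: path_def pathfinish_def pathstart_def)
  then obtain H where H: "continuous_on ({0..1::real} \<times> {0..1::real}) H" "\<forall>x\<in>{0..1}. H (0, x) = p" "\<forall>x\<in>{0..1}. H (1, x) = q"
    unfolding homotopic_loops by auto
  have "path (\<lambda>t. H (t, 0))" unfolding path_def
    by (rule continuous_on_compose2[OF H(1)]) (auto intro: continuous_intros)
  then show ?thesis using H by (intro exI[of _ "\<lambda>t. H (t, 0)"]) (auto simp: pathstart_def pathfinish_def)
qed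

lemma simply_connected_connected:
  assumes "simply_connected (UNIV :: 'a::topological_space set)"
  shows "connected (UNIV :: 'a set)"
  using simply_connected_path[OF assms]
  by (intro path_connected_imp_connected) (auto simp: path_connected_def)

text \<open>What continuation needs of a closed one-form: primitives on an open cover whose
  differences are locally constant, and short connecting paths. The differentiable structure is left
  out, so that paths and homotopies need only be continuous.\<close>

locale local_primitives =
  fixes \<F> :: "('a::topological_space set \<times> ('a \<Rightarrow> real)) set"
  assumes cover: "\<exists>S f. (S, f) \<in> \<F> \<and> p \<in> S"
    and open_dom: "(S, f) \<in> \<F> \<Longrightarrow> open S"
    and compat: "(S, f) \<in> \<F> \<Longrightarrow> (S', f') \<in> \<F> \<Longrightarrow> p \<in> S \<Longrightarrow> p \<in> S' \<Longrightarrow>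
      \<forall>\<^sub>F q in nhds p. f q - f' q = f p - f' p"
    and locally_path: "open S \<Longrightarrow> p \<in> S \<Longrightarrow> \<exists>N. open N \<and> p \<in> N \<and>
      (\<forall>q\<in>N. \<exists>\<delta>. path \<delta> \<and> path_image \<delta> \<subseteq> S \<and> pathstart \<delta> = p \<and> pathfinish \<delta> = q)"
begin

lemma along_local:
  assumes "continuous_on X \<gamma>" "\<gamma> ` X \<subseteq> S" "(S, f) \<in> \<F>"
  shows "along \<F> \<gamma> X (\<lambda>x. f (\<gamma> x))"
proof (rule alongI)
  fix x S' f' assume *: "x \<in> X" "(S', f') \<in> \<F>" "\<gamma> x \<in> S'"
  then have "\<forall>\<^sub>F q in nhds (\<gamma> x). f q - f' q = f (\<gamma> x) - f' (\<gamma> x)"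
    using assms by (intro compat[OF assms(3) *(2)]) auto
  from continuous_on_eventually_nhds[OF assms(1) *(1) this]
  show "\<forall>\<^sub>F y in nhds x. y \<in> X \<longrightarrow> f (\<gamma> y) - f' (\<gamma> y) = f (\<gamma> x) - f' (\<gamma> x)" .
qed

text \<open>Both continuations differ from the same local primitive by locally constant functions,
  so their difference is locally constant on a connected set.\<close>

lemma along_unique:
  assumes "connected X" "along \<F> \<gamma> X h" "along \<F> \<gamma> X h'" "x \<in> X" "y \<in> X"
  shows "h x - h' x = h y - h' y"
proof (rule connected_local_const[OF assms(1,4,5), of "\<lambda>x. h x - h' x"], rule ballI)
  fix a assume a: "a \<in> X"
  obtain S f where S: "(S, f) \<in> \<F>" "\<gamma> a \<in> S" using cover by blast
  from alongD[OF assms(2) a S] alongD[OF assms(3) a S]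
  have "\<forall>\<^sub>F b in nhds a. b \<in> X \<longrightarrow> h a - h' a = h b - h' b"
    by eventually_elim auto
  then show "\<forall>\<^sub>F b in at a within X. h a - h' a = h b - h' b"
    by (simp add: eventually_at_filter eventually_mono)
qed

lemma along_glue_connected:
  assumes "along \<F> \<gamma> X h" "closed X" "along \<F> \<gamma> Y h'" "closed Y" "connected (X \<inter> Y)"
  shows "\<exists>k. along \<F> \<gamma> (X \<union> Y) k"
  by (rule along_glue[OF assms(1-4)])
    (use along_unique[OF assms(5) along_subset[OF assms(1)] along_subset[OF assms(3)]] in blast)

text \<open>The monodromy argument. Small rectangles lie in the domain of one primitive; they are
  glued along common edges, first horizontally to thin strips and then vertically to the square.
  Bisection of intervals takes the place of a Lebesgue number in both directions.\<close>

lemma along_square: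
  assumes H: "continuous_on ({0..1::real} \<times> {0..1::real}) H"
  shows "\<exists>h. along \<F> H ({0..1} \<times> {0..1}) h"
proof -
  let ?I = "{0..1::real}"
  \<comment> \<open>The intervals produced by bisection are intersected with the unit interval
    throughout, so that the domain of \<open>H\<close> is never left.\<close>
  have ivl: "({a..b} \<inter> ?I) \<times> J \<union> ({b..c} \<inter> ?I) \<times> J = ({a..c} \<inter> ?I) \<times> J"
    "J \<times> ({a..b} \<inter> ?I) \<union> J \<times> ({b..c} \<inter> ?I) = J \<times> ({a..c} \<inter> ?I)"
    "({a..b} \<inter> ?I) \<times> J \<inter> ({b..c} \<inter> ?I) \<times> J = ({b..b} \<inter> ?I) \<times> J"
    "J \<times> ({a..b} \<inter> ?I) \<inter> J \<times> ({b..c} \<inter> ?I) = J \<times> ({b..b} \<inter> ?I)"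
    if "a \<le> b" "b \<le> c" for a b c :: real and J :: "real set"
  proof -
    have "{a..c} = {a..b} \<union> {b..c}" "{b..b} = {a..b} \<inter> {b..c}" using that by (auto simp: ivl_disj_un_two_touch)
    then show "({a..b} \<inter> ?I) \<times> J \<union> ({b..c} \<inter> ?I) \<times> J = ({a..c} \<inter> ?I) \<times> J"
      "J \<times> ({a..b} \<inter> ?I) \<union> J \<times> ({b..c} \<inter> ?I) = J \<times> ({a..c} \<inter> ?I)"
      "({a..b} \<inter> ?I) \<times> J \<inter> ({b..c} \<inter> ?I) \<times> J = ({b..b} \<inter> ?I) \<times> J"
      "J \<times> ({a..b} \<inter> ?I) \<inter> J \<times> ({b..c} \<inter> ?I) = J \<times> ({b..b} \<inter> ?I)"
      by blast+
  qed
  have clos: "closed (({a..b} \<inter> ?I) \<times> ({c..d} \<inter> ?I))" for a b c d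
    by (intro closed_Times closed_Int closed_atLeastAtMost)
  have conn: "connected ((A \<inter> ?I) \<times> (B \<inter> ?I))" if "connected A" "connected B" for A B :: "real set"
    using that by (intro connected_Times) (simp_all add: is_interval_connected_1[symmetric] is_interval_Int is_interval_cc)
  \<comment> \<open>The height \<open>d\<close> of the strip is quantified inside the predicate
    because each gluing has to pass to the smaller of two heights.\<close>
  have strip: "\<exists>d>0. \<exists>h. along \<F> H (({0..1} \<inter> ?I) \<times> ({t - d..t + d} \<inter> ?I)) h" if t: "t \<in> ?I" for t
  proof (rule Bolzano[of 0 1 "\<lambda>a b. \<exists>d>0. \<exists>h. along \<F> H (({a..b} \<inter> ?I) \<times> ({t - d..t + d} \<inter> ?I)) h"], simp)
    fix a b c :: real assume ab: "a \<le> b" "b \<le> c"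
    assume "\<exists>d>0. \<exists>h. along \<F> H (({a..b} \<inter> ?I) \<times> ({t - d..t + d} \<inter> ?I)) h"
    then obtain d1 h1 where 1: "d1 > 0" "along \<F> H (({a..b} \<inter> ?I) \<times> ({t - d1..t + d1} \<inter> ?I)) h1" by (elim exE conjE)
    assume "\<exists>d>0. \<exists>h. along \<F> H (({b..c} \<inter> ?I) \<times> ({t - d..t + d} \<inter> ?I)) h"
    then obtain d2 h2 where 2: "d2 > 0" "along \<F> H (({b..c} \<inter> ?I) \<times> ({t - d2..t + d2} \<inter> ?I)) h2" by (elim exE conjE)
    define d where "d = min d1 d2"
    let ?X = "({a..b} \<inter> ?I) \<times> ({t - d..t + d} \<inter> ?I)" and ?Y = "({b..c} \<inter> ?I) \<times> ({t - d..t + d} \<inter> ?I)"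
    have "\<exists>k. along \<F> H (?X \<union> ?Y) k"
    proof (rule along_glue_connected)
      show "along \<F> H ?X h1" by (rule along_subset[OF 1(2)]) (auto simp: d_def)
      show "along \<F> H ?Y h2" by (rule along_subset[OF 2(2)]) (auto simp: d_def)
      show "connected (?X \<inter> ?Y)" unfolding ivl(3)[OF ab] by (rule conn) auto
    qed (rule clos)+
    moreover have "d > 0" using 1 2 by (simp add: d_def)
    ultimately show "\<exists>d>0. \<exists>h. along \<F> H (({a..c} \<inter> ?I) \<times> ({t - d..t + d} \<inter> ?I)) h"
      unfolding ivl(1)[OF ab] by blast
  next
    fix x :: real assume x: "0 \<le> x" "x \<le> 1"
    obtain S f where S: "(S, f) \<in> \<F>" "H (x, t) \<in> S" using cover by blast
    have "\<forall>\<^sub>F z in nhds (x, t). z \<in> ?I \<times> ?I \<longrightarrow> H z \<in> S"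
      using x t S open_dom by (intro continuous_on_eventually_nhds[OF H] eventually_nhds_in_open) auto
    then obtain e where e: "e > 0" "\<And>z. dist z (x, t) < e \<Longrightarrow> z \<in> ?I \<times> ?I \<Longrightarrow> H z \<in> S"
      unfolding eventually_nhds_metric by blast
    \<comment> \<open>Width below e/2 and height at most e/4 on either side keep the rectangle
      inside the ball of radius \<open>e\<close>.\<close>
    have "along \<F> H (({a..b} \<inter> ?I) \<times> ({t - e/4..t + e/4} \<inter> ?I)) (\<lambda>z. f (H z))"
      if ab: "a \<le> x" "x \<le> b" "b - a < e / 2" for a b
    proof (rule along_local[OF _ _ S(1)])
      show "continuous_on (({a..b} \<inter> ?I) \<times> ({t - e/4..t + e/4} \<inter> ?I)) H"
        by (rule continuous_on_subset[OF H]) auto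
      have "H (u, v) \<in> S" if uv: "u \<in> {a..b} \<inter> ?I" "v \<in> {t - e/4..t + e/4} \<inter> ?I" for u v
      proof (rule e(2))
        have "dist (u, v) (x, t) \<le> \<bar>u - x\<bar> + \<bar>v - t\<bar>"
          unfolding dist_Pair_Pair dist_real_def using sqrt_sum_squares_le_sum_abs[of "\<bar>u - x\<bar>" "\<bar>v - t\<bar>"] by simp
        moreover have "\<bar>u - x\<bar> < e / 2" using uv(1) ab unfolding Int_iff atLeastAtMost_iff by linarith
        moreover have "\<bar>v - t\<bar> \<le> e / 4" using uv(2) unfolding Int_iff atLeastAtMost_iff by linarith
        ultimately show "dist (u, v) (x, t) < e" using e(1) by linarith
        show "(u, v) \<in> ?I \<times> ?I" using uv by simp
      qed
      then show "H ` (({a..b} \<inter> ?I) \<times> ({t - e/4..t + e/4} \<inter> ?I)) \<subseteq> S" by blast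
    qed
    then have "\<forall>a b. a \<le> x \<and> x \<le> b \<and> b - a < e / 2 \<longrightarrow>
        (\<exists>h. along \<F> H (({a..b} \<inter> ?I) \<times> ({t - e/4..t + e/4} \<inter> ?I)) h)" by blast
    moreover have "e / 2 > 0" "e / 4 > 0" using e(1) by auto
    ultimately
    show "\<exists>d>0. \<forall>a b. a \<le> x \<and> x \<le> b \<and> b - a < d \<longrightarrow> (\<exists>d>0. \<exists>h. along \<F> H (({a..b} \<inter> ?I) \<times> ({t - d..t + d} \<inter> ?I)) h)"
      by meson
  qed
  have "\<exists>h. along \<F> H (({0..1} \<inter> ?I) \<times> ({0..1} \<inter> ?I)) h"
  proof (rule Bolzano[of 0 1 "\<lambda>a b. \<exists>h. along \<F> H (({0..1} \<inter> ?I) \<times> ({a..b} \<inter> ?I)) h"], simp)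
    fix a b c :: real assume ab: "a \<le> b" "b \<le> c"
    assume "\<exists>h. along \<F> H (({0..1} \<inter> ?I) \<times> ({a..b} \<inter> ?I)) h"
    then obtain h1 where 1: "along \<F> H (({0..1} \<inter> ?I) \<times> ({a..b} \<inter> ?I)) h1" by (elim exE conjE)
    assume "\<exists>h. along \<F> H (({0..1} \<inter> ?I) \<times> ({b..c} \<inter> ?I)) h"
    then obtain h2 where 2: "along \<F> H (({0..1} \<inter> ?I) \<times> ({b..c} \<inter> ?I)) h2" by (elim exE conjE)
    let ?X = "({0..1} \<inter> ?I) \<times> ({a..b} \<inter> ?I)" and ?Y = "({0..1} \<inter> ?I) \<times> ({b..c} \<inter> ?I)"
    have "\<exists>k. along \<F> H (?X \<union> ?Y) k"
    proof (rule along_glue_connected[OF 1 _ 2])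
      show "connected (?X \<inter> ?Y)" unfolding ivl(4)[OF ab] by (rule conn) auto
    qed (rule clos)+
    then show "\<exists>h. along \<F> H (({0..1} \<inter> ?I) \<times> ({a..c} \<inter> ?I)) h"
      unfolding ivl(2)[OF ab] .
  next
    fix x :: real assume x: "0 \<le> x" "x \<le> 1"
    then obtain d h where d: "d > 0" "along \<F> H (({0..1} \<inter> ?I) \<times> ({x - d..x + d} \<inter> ?I)) h"
      using strip[of x] by auto
    have "along \<F> H (({0..1} \<inter> ?I) \<times> ({a..b} \<inter> ?I)) h" if "a \<le> x" "x \<le> b" "b - a < d" for a b
      by (rule along_subset[OF d(2)]) (use that in auto)
    then show "\<exists>d>0. \<forall>a b. a \<le> x \<and> x \<le> b \<and> b - a < d \<longrightarrow> (\<exists>h. along \<F> H (({0..1} \<inter> ?I) \<times> ({a..b} \<inter> ?I)) h)"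
      using d(1) by blast
  qed
  then show ?thesis by simp
qed

text \<open>The line integral of the one-form along a merely continuous path. The choice is
  harmless, since by \<open>along_unique\<close> two continuations along a path differ by a
  constant.\<close>

definition increment :: "(real \<Rightarrow> 'a) \<Rightarrow> real" where
  "increment \<gamma> = (SOME h. along \<F> \<gamma> {0..1} h) 1 - (SOME h. along \<F> \<gamma> {0..1} h) 0"

lemma increment_eq:
  assumes "along \<F> \<gamma> {0..1} h"
  shows "increment \<gamma> = h 1 - h 0"
proof -
  have "along \<F> \<gamma> {0..1} (SOME h. along \<F> \<gamma> {0..1} h)" by (rule someI[of _ h]) (rule assms)
  from along_unique[OF _ this assms, of 1 0] show ?thesis unfolding increment_def by simp
qed

text \<open>A path is a square that does not depend on its second coordinate.\<close>

lemma along_path: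
  assumes "path \<gamma>"
  shows "\<exists>h. along \<F> \<gamma> {0..1} h"
proof -
  have "continuous_on ({0..1} \<times> {0..1::real}) (\<lambda>z. \<gamma> (fst z))"
    by (rule continuous_on_compose2[of "{0..1}" \<gamma>]) (use assms in \<open>auto simp: path_def intro: continuous_intros\<close>)
  then obtain h where h: "along \<F> (\<lambda>z. \<gamma> (fst z)) ({0..1} \<times> {0..1::real}) h" using along_square by blast
  have "along \<F> \<gamma> {0..1} (\<lambda>s. h (s, 0))"
    by (rule along_cong[OF along_compose[OF h, of "{0..1}" "\<lambda>s. (s, 0)"]]) (auto intro!: continuous_intros)
  then show ?thesis by blast
qed

lemma increment_join:
  assumes "path \<gamma>" "path \<delta>" "pathfinish \<gamma> = pathstart \<delta>"
  shows "increment (\<gamma> +++ \<delta>) = increment \<gamma> + increment \<delta>"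
proof -
  obtain h where h: "along \<F> (\<gamma> +++ \<delta>) {0..1} h" using along_path[OF path_join_imp[OF assms]] by blast
  have 1: "along \<F> \<gamma> {0..1} (\<lambda>t. h (t / 2))"
  proof (rule along_cong[OF along_compose[OF h, of "{0..1}" "\<lambda>t. t / 2"]])
    show "continuous_on {0..1} (\<lambda>t::real. t / 2)" by (intro continuous_intros) auto
    show "(\<gamma> +++ \<delta>) (t / 2) = \<gamma> t" if "t \<in> {0..1}" for t
      using that by (simp add: joinpaths_def)
  qed auto
  have 2: "along \<F> \<delta> {0..1} (\<lambda>t. h ((1 + t) / 2))"
  proof (rule along_cong[OF along_compose[OF h, of "{0..1}" "\<lambda>t. (1 + t) / 2"]])
    show "continuous_on {0..1} (\<lambda>t::real. (1 + t) / 2)" by (intro continuous_intros) auto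
    \<comment> \<open>At the parameter 1/2 the joined path still follows its first half, so t = 0
      needs that the endpoints agree.\<close>
    show "(\<gamma> +++ \<delta>) ((1 + t) / 2) = \<delta> t" if "t \<in> {0..1}" for t
    proof (cases "t = 0")
      case True
      then show ?thesis using assms(3) by (simp add: joinpaths_def pathfinish_def pathstart_def)
    next
      case False
      then have "\<not> (1 + t) / 2 \<le> 1 / 2" using that by auto
      moreover have "2 * ((1 + t) / 2) - 1 = t" by (simp only: nonzero_mult_div_cancel_left times_divide_eq_right)
      ultimately show ?thesis by (simp only: joinpaths_def if_False)
    qed
  qed auto
  show ?thesis using increment_eq[OF h] increment_eq[OF 1] increment_eq[OF 2] by simp
qed

text \<open>The homotopy is free, so the base point may move; but it traces the same path on the two
  sides of the square where the loop parameter is 0 and 1. The increments along these sides agree,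
  hence the loop has the same increment as the constant loop at the other end.\<close>

lemma increment_loop:
  assumes "simply_connected (UNIV :: 'a set)" "path \<gamma>" "pathfinish \<gamma> = pathstart \<gamma>"
  shows "increment \<gamma> = 0"
proof -
  let ?I = "{0..1::real}"
  have "homotopic_loops UNIV \<gamma> (\<lambda>_. \<gamma> 0)"
    using assms unfolding simply_connected_def by (auto simp: path_def pathfinish_def pathstart_def)
  then obtain H where H: "continuous_on (?I \<times> ?I) H" "\<forall>x\<in>?I. H (0, x) = \<gamma> x" "\<forall>x\<in>?I. H (1, x) = \<gamma> 0"
    "\<forall>t\<in>?I. H (t, 1) = H (t, 0)"
    unfolding homotopic_loops by (auto simp: pathfinish_def pathstart_def)
  obtain k where k: "along \<F> H (?I \<times> ?I) k" using along_square[OF H(1)] by blast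
  have side: "along \<F> (\<lambda>t. H (t, 1)) ?I (\<lambda>t. k (t, 1))" "along \<F> (\<lambda>t. H (t, 0)) ?I (\<lambda>t. k (t, 0))"
    by (rule along_compose[OF k]; auto intro!: continuous_intros)+
  have "along \<F> (\<lambda>t. H (t, 1)) ?I (\<lambda>t. k (t, 0))"
    by (rule along_cong[OF side(2)]) (use H in auto)
  from along_unique[OF _ side(1) this, of 0 1]
  have "k (0, 1) - k (0, 0) = k (1, 1) - k (1, 0)" by simp
  moreover have "along \<F> \<gamma> ?I (\<lambda>x. k (0, x))"
    by (rule along_cong[OF along_compose[OF k, of ?I "\<lambda>x. (0, x)"]]) (use H in \<open>auto intro: continuous_intros\<close>)
  then have "increment \<gamma> = k (0, 1) - k (0, 0)" by (rule increment_eq)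
  moreover have const: "along \<F> (\<lambda>_. \<gamma> 0) ?I (\<lambda>x. k (1, x))"
    by (rule along_cong[OF along_compose[OF k, of ?I "\<lambda>x. (1, x)"]]) (use H in \<open>auto intro: continuous_intros\<close>)
  have "along \<F> (\<lambda>_. \<gamma> 0) ?I (\<lambda>x. 0)" by (rule alongI) auto
  from along_unique[OF _ const this, of 1 0] have "k (1, 1) = k (1, 0)" by simp
  ultimately show ?thesis by simp
qed

theorem global_primitive:
  assumes sc: "simply_connected (UNIV :: 'a set)"
  obtains F where "\<And>S f p. (S, f) \<in> \<F> \<Longrightarrow> p \<in> S \<Longrightarrow> \<forall>\<^sub>F q in nhds p. F q - f q = F p - f p"
proof -
  have indep: "increment \<gamma> = increment \<delta>" if "path \<gamma>" "path \<delta>" "pathstart \<gamma> = pathstart \<delta>" "pathfinish \<gamma> = pathfinish \<delta>" for \<gamma> \<delta>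
  proof -
    \<comment> \<open>Comparing two loops that share the return path avoids computing the increment
      of a reversed path.\<close>
    have "increment (\<gamma> +++ reversepath \<delta>) = 0" "increment (\<delta> +++ reversepath \<delta>) = 0"
      using that by (auto intro!: increment_loop[OF sc])
    then show ?thesis using increment_join[of _ "reversepath \<delta>"] that by simp
  qed
  \<comment> \<open>Any base point serves.\<close>
  define p0 :: 'a where "p0 = undefined"
  define to where "to q = (SOME \<gamma>. path \<gamma> \<and> pathstart \<gamma> = p0 \<and> pathfinish \<gamma> = q)" for q
  have to: "path (to q) \<and> pathstart (to q) = p0 \<and> pathfinish (to q) = q" for q
    unfolding to_def using someI_ex[OF simply_connected_path[OF sc, of p0 q]] .
  define F where "F q = increment (to q)" for q
  show ?thesis
  proof
    fix S f p assume S: "(S, f) \<in> \<F>" "p \<in> S"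
    obtain N where N: "open N" "p \<in> N" "\<And>q. q \<in> N \<Longrightarrow> \<exists>\<delta>. path \<delta> \<and> path_image \<delta> \<subseteq> S \<and> pathstart \<delta> = p \<and> pathfinish \<delta> = q"
      using locally_path[OF open_dom[OF S(1)] S(2)] by blast
    have "\<forall>\<^sub>F q in nhds p. q \<in> N" using N by (intro eventually_nhds_in_open)
    then show "\<forall>\<^sub>F q in nhds p. F q - f q = F p - f p"
    proof eventually_elim
      fix q assume "q \<in> N"
      then obtain \<delta> where d: "path \<delta>" "path_image \<delta> \<subseteq> S" "pathstart \<delta> = p" "pathfinish \<delta> = q" using N by blast
      have "along \<F> \<delta> {0..1} (\<lambda>t. f (\<delta> t))"
        using d by (intro along_local[OF _ _ S(1)]) (auto simp: path_def path_image_def)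
      then have "increment \<delta> = f q - f p" using d by (simp add: increment_eq pathstart_def pathfinish_def)
      moreover have "F q = increment (to p +++ \<delta>)"
        unfolding F_def using to[of p] to[of q] d by (intro indep) auto
      moreover have "increment (to p +++ \<delta>) = F p + increment \<delta>"
        unfolding F_def using to[of p] d by (intro increment_join) auto
      ultimately show "F q - f q = F p - f p" by simp
    qed
  qed
qed

end


section \<open>Calculus in charts\<close>

locale smooth_manifold =
  fixes A :: "('a::topological_space, 'n::finite) chart set"
  assumes atlas: "smooth_atlas A"
begin

lemma ex_chart: "\<exists>c\<in>A. p \<in> cdom c"
  using atlas unfolding smooth_atlas_def by blast

lemma chart_props:
  assumes "c \<in> A"
  shows "open (cdom c)" "open (crange c)" "homeomorphism (cdom c) (crange c) (cmap c) (cinv c)"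
  using atlas assms unfolding smooth_atlas_def by auto

lemma cinv_cmap: "c \<in> A \<Longrightarrow> p \<in> cdom c \<Longrightarrow> cinv c (cmap c p) = p"
  using chart_props(3) by (simp add: homeomorphism_def)

lemma cmap_cinv: "c \<in> A \<Longrightarrow> x \<in> crange c \<Longrightarrow> cmap c (cinv c x) = x"
  using chart_props(3) by (simp add: homeomorphism_def)

lemma cinv_in: "c \<in> A \<Longrightarrow> x \<in> crange c \<Longrightarrow> cinv c x \<in> cdom c"
  using chart_props(3) unfolding homeomorphism_def by blast

lemma cmap_in: "p \<in> cdom c \<Longrightarrow> cmap c p \<in> crange c"
  by (simp add: crange_def)

lemma open_cmap_image:
  assumes "c \<in> A" "open N"
  shows "open (cmap c ` (N \<inter> cdom c))"
proof -
  have "cmap c ` (N \<inter> cdom c) = crange c \<inter> cinv c -` N"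
    using assms(1) by (force simp: cinv_cmap cmap_cinv cmap_in cinv_in image_iff)
  moreover have "open (crange c \<inter> cinv c -` N)"
    using chart_props[OF assms(1)] assms(2)
    by (intro continuous_open_preimage) (auto simp: homeomorphism_def)
  ultimately show ?thesis by simp
qed

lemma open_cinv_image:
  assumes "c \<in> A" "open B" "B \<subseteq> crange c"
  shows "open (cinv c ` B)"
proof -
  have "cinv c ` B = cdom c \<inter> cmap c -` B"
    using assms by (force simp: cinv_cmap cmap_cinv cmap_in cinv_in image_iff subset_iff)
  moreover have "open (cdom c \<inter> cmap c -` B)"
    using chart_props[OF assms(1)] assms(2)
    by (intro continuous_open_preimage) (auto simp: homeomorphism_def)
  ultimately show ?thesis by simp
qed

section \<open>Functions read in a chart and their partial derivatives\<close>

abbreviation diff_at :: "('a, 'n) chart \<Rightarrow> ('a \<Rightarrow> real) \<Rightarrow> 'a \<Rightarrow> bool" where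
  "diff_at c f p \<equiv> (\<lambda>x. f (cinv c x)) differentiable at (cmap c p)"

lemma pd_cong:
  assumes "c \<in> A" "open N" "p \<in> N" "p \<in> cdom c" "\<And>q. q \<in> N \<Longrightarrow> f q = g q"
  shows "pd c i f p = pd c i g p"
  unfolding pd_def
  by (rule partial_transform[OF open_cmap_image[OF assms(1,2)]]) (use assms in \<open>auto simp: cinv_cmap\<close>)

lemma pd_cong_cdom:
  assumes "c \<in> A" "p \<in> cdom c" "\<And>q. q \<in> cdom c \<Longrightarrow> f q = g q"
  shows "pd c i f p = pd c i g p"
  by (rule pd_cong[OF assms(1) chart_props(1)[OF assms(1)]]) (use assms in auto)

lemma diff_at_cong:
  assumes "c \<in> A" "open N" "p \<in> N" "p \<in> cdom c" "\<And>q. q \<in> N \<Longrightarrow> f q = g q" "diff_at c f p"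
  shows "diff_at c g p"
  by (rule differentiable_transform[OF open_cmap_image[OF assms(1,2)] _ _ assms(6)])
    (use assms in \<open>auto simp: cinv_cmap\<close>)

lemma smooth_in_chart_cong:
  assumes "c \<in> A" "\<And>q. q \<in> cdom c \<Longrightarrow> f q = g q" "smooth_in_chart c f"
  shows "smooth_in_chart c g"
  using assms(3) unfolding smooth_in_chart_def
  by (rule smooth_on_cong[OF chart_props(2)[OF assms(1)], rotated]) (use assms cinv_in in auto)

lemma smooth_in_chart_diff_at: "c \<in> A \<Longrightarrow> smooth_in_chart c f \<Longrightarrow> p \<in> cdom c \<Longrightarrow> diff_at c f p"
  unfolding smooth_in_chart_def by (rule smooth_on_differentiable_at[OF chart_props(2)]) (auto simp: cmap_in)

lemma smooth_const: "c \<in> A \<Longrightarrow> smooth_in_chart c (\<lambda>p. a)"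
  unfolding smooth_in_chart_def smooth_on_def by (auto intro: Ck_on_const)

lemma smooth_add: "c \<in> A \<Longrightarrow> smooth_in_chart c f \<Longrightarrow> smooth_in_chart c g \<Longrightarrow> smooth_in_chart c (\<lambda>p. f p + g p)"
  unfolding smooth_in_chart_def smooth_on_def by (auto intro: Ck_on_add chart_props)

lemma smooth_mult: "c \<in> A \<Longrightarrow> smooth_in_chart c f \<Longrightarrow> smooth_in_chart c g \<Longrightarrow> smooth_in_chart c (\<lambda>p. f p * g p)"
  unfolding smooth_in_chart_def smooth_on_def by (auto intro: Ck_on_mult chart_props)

lemma smooth_exp: "c \<in> A \<Longrightarrow> smooth_in_chart c f \<Longrightarrow> smooth_in_chart c (\<lambda>p. exp (f p))"
  unfolding smooth_in_chart_def smooth_on_def by (auto intro: Ck_on_exp chart_props)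

lemma smooth_inverse:
  "c \<in> A \<Longrightarrow> smooth_in_chart c f \<Longrightarrow> (\<And>p. p \<in> cdom c \<Longrightarrow> f p \<noteq> 0) \<Longrightarrow> smooth_in_chart c (\<lambda>p. inverse (f p))"
  unfolding smooth_in_chart_def smooth_on_def by (auto intro!: Ck_on_inverse chart_props simp: cinv_in)

lemma smooth_cmult: "c \<in> A \<Longrightarrow> smooth_in_chart c f \<Longrightarrow> smooth_in_chart c (\<lambda>p. a * f p)"
  by (intro smooth_mult smooth_const)

lemma smooth_diff:
  assumes "c \<in> A" "smooth_in_chart c f" "smooth_in_chart c g"
  shows "smooth_in_chart c (\<lambda>p. f p - g p)"
  using smooth_add[OF assms(1,2) smooth_cmult[OF assms(1,3), of "-1"]] by simp

lemma smooth_divide: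
  "c \<in> A \<Longrightarrow> smooth_in_chart c f \<Longrightarrow> smooth_in_chart c g \<Longrightarrow> (\<And>p. p \<in> cdom c \<Longrightarrow> g p \<noteq> 0) \<Longrightarrow> smooth_in_chart c (\<lambda>p. f p / g p)"
  unfolding divide_inverse by (intro smooth_mult smooth_inverse)

lemma smooth_sum: "c \<in> A \<Longrightarrow> (\<And>k. k \<in> I \<Longrightarrow> smooth_in_chart c (f k)) \<Longrightarrow> smooth_in_chart c (\<lambda>p. \<Sum>k\<in>I. f k p)"
  by (induction I rule: infinite_finite_induct) (auto intro: smooth_add smooth_const)

lemma smooth_prod: "c \<in> A \<Longrightarrow> (\<And>k. k \<in> I \<Longrightarrow> smooth_in_chart c (f k)) \<Longrightarrow> smooth_in_chart c (\<lambda>p. \<Prod>k\<in>I. f k p)"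
  by (induction I rule: infinite_finite_induct) (auto intro: smooth_mult smooth_const)

lemmas smooth_intros = smooth_const smooth_add smooth_mult smooth_diff smooth_sum smooth_prod smooth_exp

lemma smooth_pd:
  assumes "c \<in> A" "smooth_in_chart c f"
  shows "smooth_in_chart c (pd c i f)"
  unfolding smooth_in_chart_def
  by (rule smooth_on_cong[OF chart_props(2)[OF assms(1)] _ smooth_on_partial[of _ "\<lambda>x. f (cinv c x)" i]])
    (use assms in \<open>auto simp: pd_def cmap_cinv smooth_in_chart_def\<close>)

text \<open>Serves to see that a primitive is smooth: its partial derivatives are the coefficients
  of a smooth form.\<close>

lemma smooth_in_chartI:
  assumes "c \<in> A" "\<And>p. p \<in> cdom c \<Longrightarrow> diff_at c f p" "\<And>i. smooth_in_chart c (pd c i f)"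
  shows "smooth_in_chart c f"
  unfolding smooth_in_chart_def
proof (rule smooth_onI)
  show "(\<lambda>x. f (cinv c x)) differentiable_on crange c"
    using assms(1,2) chart_props(2) by (auto simp: differentiable_on_eq_differentiable_at crange_def)
  show "smooth_on (crange c) (partial i (\<lambda>x. f (cinv c x)))" for i
    by (rule smooth_on_cong[OF chart_props(2)[OF assms(1)] _ assms(3)[of i, unfolded smooth_in_chart_def]])
      (use assms in \<open>auto simp: pd_def cmap_cinv\<close>)
qed

lemma pd_const [simp]: "pd c i (\<lambda>p. a) p = 0"
  by (simp add: pd_def)

lemma pd_add:
  "c \<in> A \<Longrightarrow> p \<in> cdom c \<Longrightarrow> smooth_in_chart c f \<Longrightarrow> smooth_in_chart c g \<Longrightarrow>
    pd c i (\<lambda>p. f p + g p) p = pd c i f p + pd c i g p"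
  unfolding pd_def by (intro partial_add smooth_in_chart_diff_at)

lemma pd_mult:
  "c \<in> A \<Longrightarrow> p \<in> cdom c \<Longrightarrow> smooth_in_chart c f \<Longrightarrow> smooth_in_chart c g \<Longrightarrow>
    pd c i (\<lambda>p. f p * g p) p = pd c i f p * g p + f p * pd c i g p"
  by (auto simp: pd_def cinv_cmap partial_mult smooth_in_chart_diff_at)

lemma pd_cmult:
  "c \<in> A \<Longrightarrow> p \<in> cdom c \<Longrightarrow> smooth_in_chart c f \<Longrightarrow> pd c i (\<lambda>p. a * f p) p = a * pd c i f p"
  using pd_mult[of c p "\<lambda>p. a" f i] smooth_const by simp

lemma pd_diff:
  assumes "c \<in> A" "p \<in> cdom c" "smooth_in_chart c f" "smooth_in_chart c g"
  shows "pd c i (\<lambda>p. f p - g p) p = pd c i f p - pd c i g p"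
  using pd_add[OF assms(1,2,3) smooth_cmult[OF assms(1,4), of "-1"]] pd_cmult[OF assms(1,2,4), of i "-1"] by simp

lemma pd_sum:
  "c \<in> A \<Longrightarrow> p \<in> cdom c \<Longrightarrow> (\<And>k. k \<in> I \<Longrightarrow> smooth_in_chart c (f k)) \<Longrightarrow>
    pd c i (\<lambda>p. \<Sum>k\<in>I. f k p) p = (\<Sum>k\<in>I. pd c i (f k) p)"
  by (induction I rule: infinite_finite_induct) (auto simp: pd_add smooth_sum)

lemma pd_exp:
  assumes "c \<in> A" "p \<in> cdom c" "smooth_in_chart c f"
  shows "pd c i (\<lambda>p. exp (f p)) p = exp (f p) * pd c i f p"
  using partial_real_compose(1)[OF smooth_in_chart_diff_at[OF assms(1,3,2)], of exp "exp (f p)" i]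
  by (simp add: pd_def cinv_cmap assms)

lemma pd_commute:
  assumes "c \<in> A" "p \<in> cdom c" "smooth_in_chart c f"
  shows "pd c i (pd c j f) p = pd c j (pd c i f) p"
proof -
  have "pd c i (pd c j f) p = partial i (partial j (\<lambda>x. f (cinv c x))) (cmap c p)" for i j
    unfolding pd_def[of c i]
    by (rule partial_transform[OF chart_props(2)[OF assms(1)]])
      (use assms in \<open>auto simp: cmap_in cmap_cinv pd_def\<close>)
  then show ?thesis
    using partial_commute[OF chart_props(2)[OF assms(1)] assms(3)[unfolded smooth_in_chart_def] cmap_in[OF assms(2)]]
    by simp
qed

lemma smooth_continuous:
  assumes "c \<in> A" "smooth_in_chart c f"
  shows "continuous_on (cdom c) f"
proof -
  have "continuous_on (cdom c) (\<lambda>p. f (cinv c (cmap c p)))"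
    using assms chart_props(3)[OF assms(1)] unfolding smooth_in_chart_def
    by (intro continuous_on_compose2[OF smooth_on_continuous_on, of _ "\<lambda>x. f (cinv c x)"])
      (auto simp: homeomorphism_def cmap_in)
  then show ?thesis by (rule continuous_on_cong[THEN iffD1, rotated 2]) (auto simp: cinv_cmap assms)
qed

text \<open>Only differentiability at the one point is asked of \<open>f\<close>, so that the rule
  applies to local primitives before they are known to be smooth.\<close>

lemma chain_rule:
  assumes "c \<in> A" "c' \<in> A" "p \<in> cdom c" "p \<in> cdom c'" "diff_at c' f p"
  shows "diff_at c f p" "pd c j f p = (\<Sum>i\<in>UNIV. jac c c' p i j * pd c' i f p)"
proof -
  let ?N = "cmap c ` (cdom c' \<inter> cdom c)"
  let ?\<tau> = "\<lambda>x. cmap c' (cinv c x)"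
  have N: "open ?N" using open_cmap_image chart_props assms by blast
  have pN: "cmap c p \<in> ?N" using assms by blast
  have "smooth_on ?N (\<lambda>x. ?\<tau> x $ i)" for i
    using atlas assms unfolding smooth_atlas_def by (simp add: Int_commute)
  then have \<tau>: "(\<lambda>x. ?\<tau> x $ i) differentiable at (cmap c p)" for i
    by (rule smooth_on_differentiable_at[OF N _ pN])
  define \<tau>' where "\<tau>' h = (\<chi> i. frechet_derivative (\<lambda>x. ?\<tau> x $ i) (at (cmap c p)) h)" for h
  have \<tau>': "(?\<tau> has_derivative \<tau>') (at (cmap c p))"
    unfolding \<tau>'_def has_derivative_componentwise_within[where f = ?\<tau>]
    using \<tau> by (auto simp: Basis_vec_def inner_axis frechet_derivative_works)
  have 1: "((\<lambda>x. f (cinv c' (?\<tau> x))) has_derivative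
      (\<lambda>h. \<Sum>i\<in>UNIV. \<tau>' h $ i * partial i (\<lambda>x. f (cinv c' x)) (cmap c' p))) (at (cmap c p))"
    by (rule has_derivative_compose[OF \<tau>', of "\<lambda>x. f (cinv c' x)"])
     (use has_derivative_partials[OF assms(5)] assms in \<open>simp add: cinv_cmap\<close>)
  have 2: "f (cinv c' (?\<tau> x)) = f (cinv c x)" if "x \<in> ?N" for x
    using that assms by (auto simp: cinv_cmap)
  have D: "((\<lambda>x. f (cinv c x)) has_derivative
      (\<lambda>h. \<Sum>i\<in>UNIV. \<tau>' h $ i * partial i (\<lambda>x. f (cinv c' x)) (cmap c' p))) (at (cmap c p))"
    by (rule has_derivative_transform_within_open[OF 1 N pN 2])
  then show "diff_at c f p" by (rule differentiableI)
  show "pd c j f p = (\<Sum>i\<in>UNIV. jac c c' p i j * pd c' i f p)"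
    unfolding pd_def[of c j f] partial_eqI[OF D] by (simp add: \<tau>'_def jac_def pd_def)
qed

definition Jac :: "('a, 'n) chart \<Rightarrow> ('a, 'n) chart \<Rightarrow> 'a \<Rightarrow> real^'n^'n" where
  "Jac c c' p = (\<chi> i j. jac c c' p i j)"

lemma Jac_nth [simp]: "Jac c c' p $ i $ j = jac c c' p i j"
  by (simp add: Jac_def)

lemma diff_at_cmap:
  assumes "c \<in> A" "c' \<in> A" "p \<in> cdom c" "p \<in> cdom c'"
  shows "diff_at c (\<lambda>q. cmap c' q $ i) p"
proof -
  have "smooth_on (cmap c ` (cdom c' \<inter> cdom c)) (\<lambda>x. cmap c' (cinv c x) $ i)"
    using atlas assms unfolding smooth_atlas_def by (simp add: Int_commute)
  then show ?thesis
    by (rule smooth_on_differentiable_at[rotated]) (use assms chart_props open_cmap_image in auto)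
qed

lemma pd_cmap:
  assumes "c \<in> A" "p \<in> cdom c"
  shows "pd c j (\<lambda>q. cmap c q $ k) p = (if k = j then 1 else 0)"
proof -
  have "pd c j (\<lambda>q. cmap c q $ k) p = partial j (\<lambda>x. x $ k) (cmap c p)"
    unfolding pd_def
    by (rule partial_transform[OF chart_props(2)[OF assms(1)]]) (use assms in \<open>auto simp: cmap_in cmap_cinv\<close>)
  also have "\<dots> = axis j 1 $ k"
    by (intro partial_eqI bounded_linear_imp_has_derivative bounded_linear_vec_nth)
  finally show ?thesis by (simp add: axis_def)
qed

text \<open>The chain rule applied to the coordinate functions of \<open>c\<close>
  themselves.\<close>

lemma Jac_inverse:
  assumes "c \<in> A" "c' \<in> A" "p \<in> cdom c" "p \<in> cdom c'"
  shows "Jac c' c p ** Jac c c' p = mat 1"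
proof -
  have "(\<Sum>i\<in>UNIV. jac c' c p k i * jac c c' p i j) = (if k = j then 1 else 0)" for k j
    using chain_rule(2)[OF assms diff_at_cmap[OF assms(2,1,4,3)], of j k] pd_cmap[OF assms(1,3), of j k]
    by (simp add: jac_def mult.commute)
  then show ?thesis by (simp add: vec_eq_iff matrix_matrix_mult_def mat_def)
qed

lemma smooth_functions_chart: "f \<in> smooth_functions A \<Longrightarrow> c \<in> A \<Longrightarrow> smooth_in_chart c f"
  by (simp add: smooth_functions_def)

lemma pd_transform:
  assumes "c \<in> A" "c' \<in> A" "p \<in> cdom c" "p \<in> cdom c'" "f \<in> smooth_functions A"
  shows "pd c j f p = (\<Sum>i\<in>UNIV. jac c c' p i j * pd c' i f p)"
  using chain_rule(2) smooth_in_chart_diff_at smooth_functions_chart assms by blast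

lemma locally_constant:
  assumes "c \<in> A" "open N" "p \<in> N" "p \<in> cdom c"
    "\<And>q. q \<in> N \<Longrightarrow> q \<in> cdom c \<Longrightarrow> diff_at c f q \<and> (\<forall>i. pd c i f q = 0)"
  shows "\<forall>\<^sub>F q in nhds p. f q = f p"
proof -
  obtain r where r: "r > 0" "ball (cmap c p) r \<subseteq> cmap c ` (N \<inter> cdom c)"
    using open_cmap_image[OF assms(1,2)] assms(3,4) open_contains_ball by blast
  have sub: "ball (cmap c p) r \<subseteq> crange c" using r(2) by (auto simp: crange_def)
  have "\<exists>k. \<forall>x\<in>ball (cmap c p) r. f (cinv c x) = k"
  proof (rule has_derivative_zero_constant)
    fix x assume x: "x \<in> ball (cmap c p) r"
    then obtain q where q: "q \<in> N" "q \<in> cdom c" "x = cmap c q" using r(2) by blast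
    then have "((\<lambda>x. f (cinv c x)) has_derivative (\<lambda>v. \<Sum>i\<in>UNIV. v $ i * pd c i f q)) (at x)"
      using has_derivative_partials[of "\<lambda>x. f (cinv c x)" x] assms(5) unfolding pd_def by simp
    then have "((\<lambda>x. f (cinv c x)) has_derivative (\<lambda>v. 0)) (at x)"
      using assms(5)[OF q(1,2)] by simp
    then show "((\<lambda>x. f (cinv c x)) has_derivative (\<lambda>v. 0)) (at x within ball (cmap c p) r)"
      by (rule has_derivative_at_withinI)
  qed auto
  then obtain k where k: "\<forall>x\<in>ball (cmap c p) r. f (cinv c x) = k" by blast
  have "open (cinv c ` ball (cmap c p) r)" by (rule open_cinv_image[OF assms(1) _ sub]) simp
  moreover have "p \<in> cinv c ` ball (cmap c p) r" using r(1) assms by (intro image_eqI[of _ _ "cmap c p"]) (auto simp: cinv_cmap)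
  ultimately have "\<forall>\<^sub>F q in nhds p. q \<in> cinv c ` ball (cmap c p) r" by (rule eventually_nhds_in_open)
  moreover have "f p = k" using k r(1) assms cinv_cmap by (metis centre_in_ball)
  ultimately show ?thesis using k by (auto elim!: eventually_mono)
qed

lemma constant_if_pd_zero:
  assumes "connected (UNIV :: 'a set)" "f \<in> smooth_functions A" "\<And>c i p. c \<in> A \<Longrightarrow> p \<in> cdom c \<Longrightarrow> pd c i f p = 0"
  shows "f p = f q"
proof (rule connected_local_const[OF assms(1)], auto)
  fix a
  obtain c where c: "c \<in> A" "a \<in> cdom c" using ex_chart by blast
  have "\<forall>\<^sub>F b in nhds a. f b = f a"
    by (rule locally_constant[OF c(1) open_UNIV _ c(2)])
     (use assms c smooth_in_chart_diff_at smooth_functions_chart in auto)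
  then have "\<forall>\<^sub>F b in at a. f b = f a" by (simp add: eventually_at_filter eventually_mono)
  then show "\<forall>\<^sub>F b in at a. f a = f b" by eventually_elim simp
qed

lemma linear_ode_unique_chart:
  fixes y :: "'b::finite \<Rightarrow> 'a \<Rightarrow> real"
  assumes c: "c \<in> A" "p \<in> cdom c"
    and y: "\<And>b. smooth_in_chart c (y b)"
    and C: "\<And>i b d. smooth_in_chart c (C i b d)"
    and eq: "\<And>i b q. q \<in> cdom c \<Longrightarrow> pd c i (y b) q = (\<Sum>d\<in>UNIV. C i b d q * y d q)"
    and init: "\<And>b. y b p = 0"
  shows "\<exists>N. open N \<and> p \<in> N \<and> (\<forall>q\<in>N. \<forall>b. y b q = 0)"
proof -
  have "\<exists>r>0. \<forall>x\<in>ball (cmap c p) r. \<forall>b. y b (cinv c x) = 0"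
  proof (rule linear_ode_unique[where y = "\<lambda>b x. y b (cinv c x)" and C = "\<lambda>i b d x. C i b d (cinv c x)"])
    show "open (crange c)" "cmap c p \<in> crange c" using c chart_props by (auto simp: cmap_in)
    show "(\<lambda>x. y b (cinv c x)) differentiable at x" if "x \<in> crange c" for b x
      using y[of b] smooth_on_differentiable_at chart_props(2)[OF c(1)] that unfolding smooth_in_chart_def by blast
    show "continuous_on (crange c) (\<lambda>x. C i b d (cinv c x))" for i b d
      using C smooth_on_continuous_on unfolding smooth_in_chart_def by blast
    show "partial i (\<lambda>x. y b (cinv c x)) x = (\<Sum>d\<in>UNIV. C i b d (cinv c x) * y d (cinv c x))" if "x \<in> crange c" for i b x
      using eq[OF cinv_in[OF c(1) that], of i b] that c by (simp add: pd_def cmap_cinv)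
    show "y b (cinv c (cmap c p)) = 0" for b using init c by (simp add: cinv_cmap)
  qed
  then obtain r where r: "r > 0" "\<forall>x\<in>ball (cmap c p) r. \<forall>b. y b (cinv c x) = 0" by blast
  let ?B = "ball (cmap c p) r \<inter> crange c"
  have "open (cinv c ` ?B)" by (intro open_cinv_image[OF c(1) open_Int[OF open_ball chart_props(2)[OF c(1)]] Int_lower2])
  moreover have "p \<in> cinv c ` ?B" using r(1) c by (intro image_eqI[of _ _ "cmap c p"]) (auto simp: cinv_cmap cmap_in)
  ultimately show ?thesis using r(2) by blast
qed

text \<open>The radial primitive in one chart is a primitive in all overlapping charts by the
  transformation law. Two local primitives have the same derivatives, hence a locally constant
  difference, so \<open>global_primitive\<close> continues them over the simply connected
  space.\<close>

theorem closed_form_exact: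
  assumes sc: "simply_connected (UNIV :: 'a set)"
    and sm: "\<And>c i. c \<in> A \<Longrightarrow> smooth_in_chart c (\<omega> c i)"
    and law: "\<And>c c' p j. c \<in> A \<Longrightarrow> c' \<in> A \<Longrightarrow> p \<in> cdom c \<Longrightarrow> p \<in> cdom c' \<Longrightarrow>
      \<omega> c j p = (\<Sum>i\<in>UNIV. jac c c' p i j * \<omega> c' i p)"
    and closed: "\<And>c i j p. c \<in> A \<Longrightarrow> p \<in> cdom c \<Longrightarrow> pd c i (\<omega> c j) p = pd c j (\<omega> c i) p"
  obtains F where "F \<in> smooth_functions A" "\<And>c i p. c \<in> A \<Longrightarrow> p \<in> cdom c \<Longrightarrow> pd c i F p = \<omega> c i p"
proof -
  \<comment> \<open>The derivative condition is demanded in all charts at once, so that any two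
    members can be compared in whichever chart contains the point.\<close>
  define \<F> where "\<F> = {(S, f). open S \<and> (\<forall>p\<in>S. \<forall>c\<in>A. p \<in> cdom c \<longrightarrow> diff_at c f p \<and> (\<forall>i. pd c i f p = \<omega> c i p))}"
  interpret local_primitives \<F>
  proof
    fix p
    obtain c where c: "c \<in> A" "p \<in> cdom c" using ex_chart by blast
    obtain r where r: "r > 0" "ball (cmap c p) r \<subseteq> crange c"
      using chart_props(2)[OF c(1)] cmap_in[OF c(2)] open_contains_ball by blast
    have pdw: "partial i (\<lambda>x. \<omega> c j (cinv c x)) x = pd c i (\<omega> c j) (cinv c x)" if "x \<in> crange c" for i j x
      using that c by (simp add: pd_def cmap_cinv)
    obtain F where F: "\<And>x. x \<in> ball (cmap c p) r \<Longrightarrow>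
        (F has_derivative (\<lambda>v. \<Sum>i\<in>UNIV. v $ i * \<omega> c i (cinv c x))) (at x)"
    proof (rule poincare_ball[OF chart_props(2)[OF c(1)] r(2), of "\<lambda>i x. \<omega> c i (cinv c x)"])
      show "smooth_on (crange c) (\<lambda>x. \<omega> c i (cinv c x))" for i
        using sm[OF c(1)] unfolding smooth_in_chart_def .
      show "partial i (\<lambda>x. \<omega> c j (cinv c x)) x = partial j (\<lambda>x. \<omega> c i (cinv c x)) x" if "x \<in> crange c" for i j x
        using closed[OF c(1) cinv_in[OF c(1) that]] pdw[OF that] by simp
    qed blast
    let ?S = "cinv c ` ball (cmap c p) r" and ?f = "\<lambda>q. F (cmap c q)"
    have oS: "open ?S" by (rule open_cinv_image[OF c(1) _ r(2)]) simp
    have pS: "p \<in> ?S" using r(1) c by (intro image_eqI[of _ _ "cmap c p"]) (auto simp: cinv_cmap)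
    have main: "diff_at c ?f q \<and> (\<forall>i. pd c i ?f q = \<omega> c i q)" if "q \<in> ?S" for q
    proof -
      obtain x where x: "x \<in> ball (cmap c p) r" "q = cinv c x" using \<open>q \<in> ?S\<close> by blast
      have xq: "cmap c q = x" using x r(2) c by (auto simp: cmap_cinv)
      have "((\<lambda>x. ?f (cinv c x)) has_derivative (\<lambda>v. \<Sum>i\<in>UNIV. v $ i * \<omega> c i q)) (at (cmap c q))"
        unfolding xq
        by (rule has_derivative_transform_within_open[of F _ x UNIV "ball (cmap c p) r"])
         (use F[OF x(1)] x r(2) c in \<open>auto simp: cmap_cinv\<close>)
      note D = this
      have "pd c i ?f q = \<omega> c i q" for i
        unfolding pd_def partial_eqI[OF D] by (simp add: axis_def if_distrib[of "\<lambda>x. x * _"] cong: if_cong)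
      then show ?thesis using differentiableI[OF D] by blast
    qed
    have "diff_at c' ?f q \<and> (\<forall>i. pd c' i ?f q = \<omega> c' i q)" if q: "q \<in> ?S" "c' \<in> A" "q \<in> cdom c'" for q c'
    proof -
      have qc: "q \<in> cdom c" using q r(2) c cinv_in by blast
      show ?thesis
        using chain_rule[OF q(2) c(1) q(3) qc, of ?f] main[OF q(1)] law[OF q(2) c(1) q(3) qc] by auto
    qed
    then have "(?S, ?f) \<in> \<F>" using oS unfolding \<F>_def by auto
    then show "\<exists>S f. (S, f) \<in> \<F> \<and> p \<in> S" using pS by blast
  next
    show "open S" if "(S, f) \<in> \<F>" for S f using that by (simp add: \<F>_def)
  next
    fix S f S' f' p assume S: "(S, f) \<in> \<F>" "(S', f') \<in> \<F>" "p \<in> S" "p \<in> S'"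
    obtain c where c: "c \<in> A" "p \<in> cdom c" using ex_chart by blast
    show "\<forall>\<^sub>F q in nhds p. f q - f' q = f p - f' p"
    proof (rule locally_constant[OF c(1) _ _ c(2), of "S \<inter> S'" "\<lambda>q. f q - f' q"])
      fix q assume q: "q \<in> S \<inter> S'" "q \<in> cdom c"
      have 1: "diff_at c f q" "diff_at c f' q" "\<And>i. pd c i f q = \<omega> c i q" "\<And>i. pd c i f' q = \<omega> c i q"
        using S q c unfolding \<F>_def by auto
      have "((\<lambda>x. f (cinv c x) - f' (cinv c x)) has_derivative
         (\<lambda>v. (\<Sum>i\<in>UNIV. v $ i * pd c i f q) - (\<Sum>i\<in>UNIV. v $ i * pd c i f' q))) (at (cmap c q))"
        unfolding pd_def by (intro has_derivative_diff has_derivative_partials 1)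
      then have D: "((\<lambda>x. f (cinv c x) - f' (cinv c x)) has_derivative (\<lambda>v. 0)) (at (cmap c q))"
        using 1 by simp
      show "(\<lambda>x. f (cinv c x) - f' (cinv c x)) differentiable at (cmap c q) \<and> (\<forall>i. pd c i (\<lambda>q. f q - f' q) q = 0)"
        unfolding pd_def using partial_eqI[OF D] differentiableI[OF D] by auto
    qed (use S in \<open>auto simp: \<F>_def\<close>)
  next
    fix S :: "'a set" and p assume S: "open S" "p \<in> S"
    obtain c where c: "c \<in> A" "p \<in> cdom c" using ex_chart by blast
    obtain r where r: "r > 0" "ball (cmap c p) r \<subseteq> cmap c ` (S \<inter> cdom c)"
      using open_cmap_image[OF c(1) S(1)] S(2) c(2) open_contains_ball by blast
    have sub: "ball (cmap c p) r \<subseteq> crange c" using r(2) by (auto simp: crange_def)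
    let ?N = "cinv c ` ball (cmap c p) r"
    have "open ?N" by (rule open_cinv_image[OF c(1) _ sub]) simp
    moreover have "p \<in> ?N" using r(1) c by (intro image_eqI[of _ _ "cmap c p"]) (auto simp: cinv_cmap)
    moreover have "\<exists>\<delta>. path \<delta> \<and> path_image \<delta> \<subseteq> S \<and> pathstart \<delta> = p \<and> pathfinish \<delta> = q" if q: "q \<in> ?N" for q
    proof -
      obtain x where x: "x \<in> ball (cmap c p) r" "q = cinv c x" using q by blast
      have seg: "closed_segment (cmap c p) x \<subseteq> ball (cmap c p) r"
        using x r(1) by (intro closed_segment_subset) auto
      let ?\<delta> = "cinv c \<circ> linepath (cmap c p) x"
      have cont: "continuous_on (crange c) (cinv c)" using chart_props(3)[OF c(1)] by (simp add: homeomorphism_def)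
      have "path ?\<delta>" by (rule path_continuous_image) (use seg sub cont in \<open>auto intro: continuous_on_subset\<close>)
      moreover have "path_image ?\<delta> \<subseteq> S"
      proof -
        have "cinv c ` ball (cmap c p) r \<subseteq> S" using r(2) c by (force simp: cinv_cmap)
        then show ?thesis using seg by (auto simp: path_image_compose)
      qed
      ultimately show ?thesis using x(2) c by (intro exI[of _ ?\<delta>]) (auto simp: pathstart_compose pathfinish_compose cinv_cmap)
    qed
    ultimately show "\<exists>N. open N \<and> p \<in> N \<and> (\<forall>q\<in>N. \<exists>\<delta>. path \<delta> \<and> path_image \<delta> \<subseteq> S \<and> pathstart \<delta> = p \<and> pathfinish \<delta> = q)"
      by blast
  qed
  obtain F where F: "\<And>S f p. (S, f) \<in> \<F> \<Longrightarrow> p \<in> S \<Longrightarrow> \<forall>\<^sub>F q in nhds p. F q - f q = F p - f p"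
    using global_primitive[OF sc] by blast
  have D: "diff_at c F p \<and> (\<forall>i. pd c i F p = \<omega> c i p)" if c: "c \<in> A" "p \<in> cdom c" for c p
  proof -
    obtain S f where S: "(S, f) \<in> \<F>" "p \<in> S" using cover by blast
    obtain N where N: "open N" "p \<in> N" "\<And>q. q \<in> N \<Longrightarrow> F q - f q = F p - f p"
      using F[OF S] unfolding eventually_nhds by blast
    have f: "diff_at c f p" "\<And>i. pd c i f p = \<omega> c i p" using S c unfolding \<F>_def by auto
    have eq: "f q + (F p - f p) = F q" if "q \<in> N" for q using N(3)[OF that] by simp
    have "diff_at c (\<lambda>q. f q + (F p - f p)) p" using f by (intro differentiable_add) auto
    with diff_at_cong[OF c(1) N(1,2) c(2), of "\<lambda>q. f q + (F p - f p)" F] eq have "diff_at c F p" by simp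
    moreover have "pd c i F p = \<omega> c i p" for i
    proof -
      have "pd c i F p = pd c i (\<lambda>q. f q + (F p - f p)) p"
        by (rule pd_cong[OF c(1) N(1,2) c(2)]) (simp add: eq)
      also have "\<dots> = pd c i f p" unfolding pd_def using f(1) by (subst partial_add) auto
      finally show ?thesis using f(2) by simp
    qed
    ultimately show ?thesis by blast
  qed
  have "smooth_in_chart c F" if c: "c \<in> A" for c
    by (rule smooth_in_chartI[OF c]) (use D c smooth_in_chart_cong[OF c _ sm[OF c]] in auto)
  then have "F \<in> smooth_functions A" by (simp add: smooth_functions_def)
  then show ?thesis using that D by blast
qed

end


section \<open>Functional independence after adding potentials\<close>

text \<open>Such an \<open>s\<close> is nonzero, and -1/s is an eigenvalue of \<open>f\<close>.
  Eigenvectors for distinct eigenvalues are linearly independent, so there are at most as many as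
  the dimension.\<close>

lemma finite_singular_scalings:
  fixes f :: "'e::euclidean_space \<Rightarrow> 'e"
  assumes f: "linear f"
  shows "finite {s. \<exists>v. v \<noteq> 0 \<and> v + s *\<^sub>R f v = 0}" (is "finite ?B")
proof (rule ccontr)
  assume "infinite ?B"
  define v where "v s = (SOME v. v \<noteq> 0 \<and> v + s *\<^sub>R f v = 0)" for s
  have v: "v s \<noteq> 0 \<and> v s + s *\<^sub>R f (v s) = 0" if "s \<in> ?B" for s
    using someI_ex[of "\<lambda>v. v \<noteq> 0 \<and> v + s *\<^sub>R f v = 0"] that unfolding v_def by simp
  have s0: "s \<noteq> 0" if "s \<in> ?B" for s using v[OF that] by auto
  have fv: "f (v s) = - (1 / s) *\<^sub>R v s" if "s \<in> ?B" for s
  proof -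
    have "s *\<^sub>R f (v s) = - v s" using v[OF that] by (metis add.commute add_eq_0_iff)
    then have "(1 / s) *\<^sub>R (s *\<^sub>R f (v s)) = - (1 / s) *\<^sub>R v s" by simp
    then show ?thesis using s0[OF that] by simp
  qed
  have indep: "\<forall>s\<in>T. c s = 0" if "finite T" "T \<subseteq> ?B" "(\<Sum>s\<in>T. c s *\<^sub>R v s) = 0" for T c
    using that
  proof (induction T arbitrary: c rule: finite_induct)
    case (insert t T)
    then have t: "t \<in> ?B" "T \<subseteq> ?B" by auto
    have 1: "c t *\<^sub>R v t + (\<Sum>s\<in>T. c s *\<^sub>R v s) = 0" using insert by simp
    \<comment> \<open>Applying \<open>f\<close> multiplies each eigenvector by -1/s; compared with
      the relation scaled by 1/t, the vector \<open>v t\<close> cancels and the induction hypothesis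
      applies.\<close>
    have "f (c t *\<^sub>R v t + (\<Sum>s\<in>T. c s *\<^sub>R v s)) = 0" using 1 f by (simp add: linear_0)
    then have "c t *\<^sub>R f (v t) + (\<Sum>s\<in>T. c s *\<^sub>R f (v s)) = 0"
      using f by (simp add: linear_add linear_sum linear_scale)
    then have 2: "(1 / t) *\<^sub>R (c t *\<^sub>R v t) + (\<Sum>s\<in>T. (c s / s) *\<^sub>R v s) = 0"
      using fv t by (simp add: subset_iff sum_negf add_eq_0_iff mult.commute minus_equation_iff)
    have 3: "(1 / t) *\<^sub>R (c t *\<^sub>R v t) + (\<Sum>s\<in>T. (c s / t) *\<^sub>R v s) = 0"
      using arg_cong[OF 1, of "\<lambda>x. (1 / t) *\<^sub>R x"] by (simp add: scaleR_add_right scaleR_sum_right)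
    have "(\<Sum>s\<in>T. (c s / s - c s / t) *\<^sub>R v s) = 0"
      using 2 3 by (simp add: scaleR_diff_left sum_subtractf) (metis add_left_cancel)
    from insert.IH[OF t(2) this] have "\<forall>s\<in>T. c s / s - c s / t = 0" .
    moreover have "s \<noteq> t" if "s \<in> T" for s using insert that by blast
    ultimately have T0: "\<forall>s\<in>T. c s = 0"
      using t s0 by (auto simp: field_simps subset_iff)
    then show ?case using 1 v[OF t(1)] by auto
  qed simp
  obtain T where T: "T \<subseteq> ?B" "finite T" "card T = DIM('e) + 1"
    using infinite_arbitrarily_large[OF \<open>infinite ?B\<close>] by blast
  have inj: "inj_on v T"
  proof (rule inj_onI, rule ccontr)
    fix s t assume st: "s \<in> T" "t \<in> T" "v s = v t" "s \<noteq> t"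
    have "(\<Sum>x\<in>{s, t}. (if x = s then 1 else -1) *\<^sub>R v x) = 0" using st by simp
    from indep[OF _ _ this] st T show False by auto
  qed
  have "independent (v ` T)"
  proof
    assume "dependent (v ` T)"
    then obtain u where u: "\<exists>x\<in>v ` T. u x \<noteq> 0" "(\<Sum>x\<in>v ` T. u x *\<^sub>R x) = 0"
      using T(2) by (auto simp: real_vector.dependent_finite)
    have "(\<Sum>s\<in>T. u (v s) *\<^sub>R v s) = 0" using u(2) inj by (simp add: sum.reindex)
    from indep[OF T(2,1) this] u(1) show False by auto
  qed
  then have "card (v ` T) \<le> DIM('e)" using independent_bound by blast
  then show False using T(3) inj by (simp add: card_image)
qed

text \<open>Independence of the \<open>r k\<close> allows a linear \<open>f\<close> that takes each
  \<open>r k\<close> to \<open>p k\<close>. A dependency of the perturbed family then yields a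
  nonzero u with u + s f(u) = 0, which restricts \<open>s\<close> to a finite set.\<close>

lemma independent_family_perturb:
  fixes r p :: "nat \<Rightarrow> 'e::euclidean_space"
  assumes r: "\<And>a. (\<Sum>k<N. a k *\<^sub>R r k) = 0 \<Longrightarrow> \<forall>k<N. a k = 0"
  shows "finite {s. \<not> (\<forall>a. (\<Sum>k<N. a k *\<^sub>R (r k + s *\<^sub>R p k)) = 0 \<longrightarrow> (\<forall>k<N. a k = 0))}"
proof -
  \<comment> \<open>Independence is assumed of the family, whereas linear extension works on a set;
    injectivity translates between them.\<close>
  have inj: "inj_on r {..<N}"
  proof (rule inj_onI, rule ccontr)
    fix i j assume ij: "i \<in> {..<N}" "j \<in> {..<N}" "r i = r j" "i \<noteq> j"
    have "(\<Sum>k<N. (if k = i then 1 else if k = j then -1 else 0) *\<^sub>R r k)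
        = (\<Sum>k\<in>{i, j}. (if k = i then 1 else if k = j then -1 else 0) *\<^sub>R r k)"
      using ij by (intro sum.mono_neutral_right) auto
    also have "\<dots> = 0" using ij by simp
    finally show False using r[of "\<lambda>k. if k = i then 1 else if k = j then -1 else 0"] ij by auto
  qed
  have "independent (r ` {..<N})"
  proof
    assume "dependent (r ` {..<N})"
    then obtain u where u: "\<exists>x\<in>r ` {..<N}. u x \<noteq> 0" "(\<Sum>x\<in>r ` {..<N}. u x *\<^sub>R x) = 0"
      by (auto simp: real_vector.dependent_finite)
    have "(\<Sum>k<N. u (r k) *\<^sub>R r k) = 0" using u(2) inj by (simp add: sum.reindex)
    from r[OF this] u(1) show False by auto
  qed
  from linear_independent_extend[OF this, of "\<lambda>x. p (inv_into {..<N} r x)"]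
  obtain f where f: "linear f" "\<forall>x\<in>r ` {..<N}. f x = p (inv_into {..<N} r x)"
    by blast
  have fr: "f (r k) = p k" if "k < N" for k using f(2) inj that by simp
  show ?thesis
  proof (rule finite_subset[OF _ finite_singular_scalings[OF f(1)]], rule subsetI)
    fix s assume "s \<in> {s. \<not> (\<forall>a. (\<Sum>k<N. a k *\<^sub>R (r k + s *\<^sub>R p k)) = 0 \<longrightarrow> (\<forall>k<N. a k = 0))}"
    then obtain a k where a: "(\<Sum>k<N. a k *\<^sub>R (r k + s *\<^sub>R p k)) = 0" "k < N" "a k \<noteq> 0" by blast
    let ?u = "\<Sum>k<N. a k *\<^sub>R r k"
    have "f ?u = (\<Sum>k<N. a k *\<^sub>R p k)"
      using f(1) by (simp add: linear_sum linear_scale fr)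
    then have "?u + s *\<^sub>R f ?u = (\<Sum>k<N. a k *\<^sub>R (r k + s *\<^sub>R p k))"
      by (simp add: scaleR_add_right sum.distrib scaleR_sum_right mult.commute)
    then have "?u + s *\<^sub>R f ?u = 0" using a(1) by simp
    moreover have "?u \<noteq> 0" using r[of a] a by blast
    ultimately show "s \<in> {s. \<exists>v. v \<noteq> 0 \<and> v + s *\<^sub>R f v = 0}" by blast
  qed
qed

context smooth_manifold
begin

lemma has_derivative_in_chart:
  assumes "c \<in> A" "x \<in> crange c" "smooth_in_chart c f"
  shows "((\<lambda>x. f (cinv c x)) has_derivative (\<lambda>u. \<Sum>l\<in>UNIV. u $ l * pd c l f (cinv c x))) (at x)"
proof -
  have "(\<lambda>x. f (cinv c x)) differentiable at x"
    using assms smooth_on_differentiable_at chart_props(2) unfolding smooth_in_chart_def by blast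
  from has_derivative_partials[OF this] show ?thesis
    using assms by (simp add: pd_def cmap_cinv)
qed

text \<open>Position components of the differential of a quadratic form in the momenta, homogeneous
  of degree two in \<xi>; the momentum components \<open>qgrad_p\<close> have degree one. The
  different behaviour under scaling is what the argument below rests on.\<close>

definition qgrad_x :: "('a, 'n) tensor2 \<Rightarrow> ('a, 'n) chart \<Rightarrow> real^'n \<Rightarrow> real^'n \<Rightarrow> real^'n" where
  "qgrad_x Q c x \<xi> = (\<chi> l. \<Sum>i\<in>UNIV. \<Sum>j\<in>UNIV. pd c l (\<lambda>p. Q c p $ i $ j) (cinv c x) * \<xi> $ i * \<xi> $ j)"

definition qgrad_p :: "('a, 'n) tensor2 \<Rightarrow> ('a, 'n) chart \<Rightarrow> real^'n \<Rightarrow> real^'n \<Rightarrow> real^'n" where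
  "qgrad_p Q c x \<xi> = (\<chi> l. \<Sum>j\<in>UNIV. (Q c (cinv c x) $ l $ j + Q c (cinv c x) $ j $ l) * \<xi> $ j)"

definition grad :: "('a, 'n) chart \<Rightarrow> ('a \<Rightarrow> real) \<Rightarrow> 'a \<Rightarrow> real^'n" where
  "grad c f p = (\<chi> i. pd c i f p)"

lemma quadratic_integral_has_derivative:
  assumes c: "c \<in> A" "x \<in> crange c"
    and Q: "\<And>i j. smooth_in_chart c (\<lambda>p. Q c p $ i $ j)" and W: "smooth_in_chart c W"
  shows "(quadratic_integral Q W c has_derivative
      (\<lambda>w. (qgrad_x Q c x \<xi> + grad c W (cinv c x), qgrad_p Q c x \<xi>) \<bullet> w)) (at (x, \<xi>))"
proof -
  have fst': "((\<lambda>z. f (cinv c (fst z))) has_derivative (\<lambda>w. \<Sum>l\<in>UNIV. fst w $ l * pd c l f (cinv c x))) (at (x, \<xi>))"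
    if "smooth_in_chart c f" for f
    by (rule has_derivative_compose[where f = fst and f' = fst and g = "\<lambda>x. f (cinv c x)"])
      (use has_derivative_in_chart[OF c that] in \<open>auto intro: derivative_eq_intros\<close>)
  have snd': "((\<lambda>z. snd z $ i) has_derivative (\<lambda>w. snd w $ i)) (at (x, \<xi>))" for i :: 'n
    by (intro bounded_linear_imp_has_derivative bounded_linear_compose[OF bounded_linear_vec_nth bounded_linear_snd])
  have "((\<lambda>z. (\<Sum>i\<in>UNIV. \<Sum>j\<in>UNIV. Q c (cinv c (fst z)) $ i $ j * snd z $ i * snd z $ j) + W (cinv c (fst z)))
     has_derivative (\<lambda>w. (\<Sum>i\<in>UNIV. \<Sum>j\<in>UNIV.
       (Q c (cinv c x) $ i $ j * \<xi> $ i) * snd w $ j +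
       (Q c (cinv c x) $ i $ j * snd w $ i + (\<Sum>l\<in>UNIV. fst w $ l * pd c l (\<lambda>p. Q c p $ i $ j) (cinv c x)) * \<xi> $ i) * \<xi> $ j)
       + (\<Sum>l\<in>UNIV. fst w $ l * pd c l W (cinv c x)))) (at (x, \<xi>))"
    by (rule has_derivative_add[OF has_derivative_sum[OF has_derivative_sum[OF
          has_derivative_mult[OF has_derivative_mult[OF fst'[OF Q] snd'] snd', simplified]]] fst'[OF W]])
  moreover have "(\<Sum>i\<in>UNIV. \<Sum>j\<in>UNIV.
       (Q c (cinv c x) $ i $ j * \<xi> $ i) * snd w $ j +
       (Q c (cinv c x) $ i $ j * snd w $ i + (\<Sum>l\<in>UNIV. fst w $ l * pd c l (\<lambda>p. Q c p $ i $ j) (cinv c x)) * \<xi> $ i) * \<xi> $ j)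
       + (\<Sum>l\<in>UNIV. fst w $ l * pd c l W (cinv c x))
     = (qgrad_x Q c x \<xi> + grad c W (cinv c x), qgrad_p Q c x \<xi>) \<bullet> w" for w
  proof -
    let ?q = "cinv c x"
    have 1: "(\<Sum>i\<in>UNIV. \<Sum>j\<in>UNIV. (Q c ?q $ i $ j * \<xi> $ i) * snd w $ j)
        = (\<Sum>l\<in>UNIV. \<Sum>j\<in>UNIV. Q c ?q $ j $ l * \<xi> $ j * snd w $ l)"
      by (subst sum.swap) simp
    have 2: "(\<Sum>i\<in>UNIV. \<Sum>j\<in>UNIV. (\<Sum>l\<in>UNIV. fst w $ l * pd c l (\<lambda>p. Q c p $ i $ j) ?q) * \<xi> $ i * \<xi> $ j)
        = (\<Sum>l\<in>UNIV. \<Sum>i\<in>UNIV. \<Sum>j\<in>UNIV. fst w $ l * pd c l (\<lambda>p. Q c p $ i $ j) ?q * \<xi> $ i * \<xi> $ j)"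
      by (simp add: sum_distrib_right) (subst (2) sum.swap, subst sum.swap, rule refl)
    have 3: "qgrad_x Q c x \<xi> \<bullet> fst w = (\<Sum>l\<in>UNIV. \<Sum>i\<in>UNIV. \<Sum>j\<in>UNIV. fst w $ l * pd c l (\<lambda>p. Q c p $ i $ j) ?q * \<xi> $ i * \<xi> $ j)"
      by (simp add: inner_vec_def qgrad_x_def sum_distrib_right sum_distrib_left mult_ac)
    have 4: "grad c W ?q \<bullet> fst w = (\<Sum>l\<in>UNIV. fst w $ l * pd c l W ?q)"
      by (simp add: inner_vec_def grad_def mult.commute)
    have 5: "qgrad_p Q c x \<xi> \<bullet> snd w = (\<Sum>i\<in>UNIV. \<Sum>j\<in>UNIV. Q c ?q $ i $ j * snd w $ i * \<xi> $ j)
        + (\<Sum>l\<in>UNIV. \<Sum>j\<in>UNIV. Q c ?q $ j $ l * \<xi> $ j * snd w $ l)"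
      by (simp add: inner_vec_def qgrad_p_def sum_distrib_right sum_distrib_left sum.distrib[symmetric] algebra_simps)
    show ?thesis
      unfolding inner_prod_def fst_conv snd_conv inner_add_left 3 4 5
      using 1 2 by (simp add: distrib_right sum.distrib)
  qed
  ultimately show ?thesis
    by (simp add: quadratic_integral_def[abs_def] case_prod_beta)
qed

text \<open>Scaling the momenta by \<open>\<lambda>\<close> multiplies the quadratic parts by \<open>\<lambda>\<^sup>2\<close>, so a dependency caused
  by the potentials occurs for finitely many \<open>\<lambda>\<close> only.\<close>

lemma functionally_independent_potentials:
  assumes Q: "\<And>c k i j. c \<in> A \<Longrightarrow> k < N \<Longrightarrow> smooth_in_chart c (\<lambda>p. Q k c p $ i $ j)"
    and W0: "\<And>k. k < N \<Longrightarrow> W0 k \<in> smooth_functions A" "\<And>c k i p. c \<in> A \<Longrightarrow> p \<in> cdom c \<Longrightarrow> k < N \<Longrightarrow> pd c i (W0 k) p = 0"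
    and W: "\<And>k. k < N \<Longrightarrow> W k \<in> smooth_functions A"
    and indep: "functionally_independent A N (\<lambda>k. quadratic_integral (Q k) (W0 k))"
  shows "functionally_independent A N (\<lambda>k. quadratic_integral (Q k) (W k))"
  unfolding functionally_independent_def
proof (intro ballI subsetI)
  fix c z assume c: "c \<in> A" and z: "z \<in> crange c \<times> (UNIV :: (real^'n) set)"
  \<comment> \<open>The differential of the function with index \<open>k\<close> at (x, \<xi>), as a
    gradient vector.\<close>
  define R where "R U k x \<xi> = (qgrad_x (Q k) c x \<xi> + grad c (U k) (cinv c x), qgrad_p (Q k) c x \<xi>)" for U :: "nat \<Rightarrow> 'a \<Rightarrow> real" and k x \<xi>
  have equiv: "(\<forall>w. (\<Sum>k<N. a k * frechet_derivative (quadratic_integral (Q k) (U k) c) (at (x, \<xi>)) w) = 0)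
      \<longleftrightarrow> (\<Sum>k<N. a k *\<^sub>R R U k x \<xi>) = 0"
    if "x \<in> crange c" "\<And>k. k < N \<Longrightarrow> U k \<in> smooth_functions A" for U a x \<xi>
  proof -
    have "(\<Sum>k<N. a k * frechet_derivative (quadratic_integral (Q k) (U k) c) (at (x, \<xi>)) w)
        = (\<Sum>k<N. a k *\<^sub>R R U k x \<xi>) \<bullet> w" for w
    proof -
      have "frechet_derivative (quadratic_integral (Q k) (U k) c) (at (x, \<xi>)) w = R U k x \<xi> \<bullet> w" if "k < N" for k
        using fun_cong[OF frechet_derivative_at[OF quadratic_integral_has_derivative[where Q = "Q k", OF c \<open>x \<in> crange c\<close> Q[OF c that]
          smooth_functions_chart[OF \<open>\<And>k. k < N \<Longrightarrow> U k \<in> smooth_functions A\<close>[OF that] c], of \<xi>]], of w]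
        unfolding R_def by (rule sym)
      then show ?thesis by (simp add: inner_sum_left)
    qed
    note * = this
    have "(\<forall>w. u \<bullet> w = 0) \<longleftrightarrow> u = 0" for u :: "(real^'n) \<times> (real^'n)"
      by (metis inner_eq_zero_iff inner_zero_left)
    then show ?thesis unfolding * .
  qed
  define S where "S U = {z \<in> crange c \<times> UNIV. \<forall>a::nat \<Rightarrow> real.
      (\<forall>w. (\<Sum>k<N. a k * frechet_derivative (quadratic_integral (Q k) (U k) c) (at z) w) = 0) \<longrightarrow> (\<forall>k<N. a k = 0)}" for U
  have S_iff: "(x, \<xi>) \<in> S U \<longleftrightarrow> (\<forall>a. (\<Sum>k<N. a k *\<^sub>R R U k x \<xi>) = 0 \<longrightarrow> (\<forall>k<N. a k = 0))"
    if "x \<in> crange c" "\<And>k. k < N \<Longrightarrow> U k \<in> smooth_functions A" for U x \<xi>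
    using that(1) by (simp only: S_def mem_Collect_eq equiv[OF that] mem_Times_iff fst_conv UNIV_I simp_thms)
  have "\<exists>y\<in>S W. dist y z < e" if e: "e > 0" for e
  proof -
    have "z \<in> closure (S W0)" unfolding S_def using subsetD[OF bspec[OF indep[unfolded functionally_independent_def] c] z] .
    moreover have "e / 2 > 0" using e by simp
    ultimately obtain y where y: "y \<in> S W0" "dist y z < e / 2"
      unfolding closure_approachable by blast
    obtain x \<xi> where x: "y = (x, \<xi>)" by (cases y)
    have xc: "x \<in> crange c" using y(1) unfolding x S_def by simp
    have g0: "grad c (W0 k) (cinv c x) = 0" if "k < N" for k
      using W0(2)[OF c cinv_in[OF c xc] that] by (simp add: grad_def vec_eq_iff)
    have "\<forall>k<N. a k = 0" if "(\<Sum>k<N. a k *\<^sub>R R W0 k x \<xi>) = 0" for a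
      using S_iff[of x W0 \<xi>, OF xc W0(1)] that y(1) unfolding x by blast
    from independent_family_perturb[where N = N and r = "\<lambda>k. R W0 k x \<xi>" and p = "\<lambda>k. (grad c (W k) (cinv c x), 0)", OF this]
    have fin: "finite {s. \<not> (\<forall>a. (\<Sum>k<N. a k *\<^sub>R (R W0 k x \<xi> + s *\<^sub>R (grad c (W k) (cinv c x), 0))) = 0 \<longrightarrow> (\<forall>k<N. a k = 0))}"
      (is "finite ?Bad") .
    \<comment> \<open>On l > 1 the parameter 1/l^2 determines l, so finitely many bad parameters
      exclude only finitely many scalings.\<close>
    have inj: "inj_on (\<lambda>l::real. inverse (l\<^sup>2)) {1<..}"
      by (rule inj_onI) (simp add: power2_eq_iff)
    \<comment> \<open>Scaling \<xi> by a factor between 1 and 1 + d moves it by less than e/2; the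
      added 1 covers \<xi> = 0.\<close>
    define d where "d = e / (2 * (norm \<xi> + 1))"
    have d: "d > 0" "d * norm \<xi> < e / 2"
    proof -
      show "d > 0" using e by (simp add: d_def add_nonneg_pos)
      have "d * norm \<xi> = (e / 2) * (norm \<xi> / (norm \<xi> + 1))" by (simp add: d_def)
      also have "\<dots> < (e / 2) * 1"
        using e by (intro mult_strict_left_mono) (auto simp: divide_less_eq_1 add_nonneg_pos)
      finally show "d * norm \<xi> < e / 2" by simp
    qed
    have "finite ((\<lambda>l::real. inverse (l\<^sup>2)) -` ?Bad \<inter> {1<..})"
      by (rule finite_vimage_IntI[OF fin inj])
    moreover have "infinite {1<..<1 + d}" using d by (simp add: infinite_Ioo)
    ultimately have "\<not> {1<..<1 + d} \<subseteq> (\<lambda>l::real. inverse (l\<^sup>2)) -` ?Bad \<inter> {1<..}"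
      by (meson finite_subset)
    then obtain l where l0: "l \<in> {1<..<1 + d}" "l \<notin> (\<lambda>l::real. inverse (l\<^sup>2)) -` ?Bad \<inter> {1<..}"
      unfolding subset_iff by blast
    have l: "1 < l" "l < 1 + d" using l0(1) by simp_all
    have "inverse (l\<^sup>2) \<notin> ?Bad" using l0(2) l(1) unfolding Int_iff vimage_eq greaterThan_iff by blast
    then have good: "\<And>a. (\<Sum>k<N. a k *\<^sub>R (R W0 k x \<xi> + inverse (l\<^sup>2) *\<^sub>R (grad c (W k) (cinv c x), 0))) = 0 \<Longrightarrow> (\<forall>k<N. a k = 0)"
      unfolding mem_Collect_eq not_not by blast
    have "(x, l *\<^sub>R \<xi>) \<in> S W"
    proof -
      have "\<forall>k<N. a k = 0" if a: "(\<Sum>k<N. a k *\<^sub>R R W k x (l *\<^sub>R \<xi>)) = 0" for a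
      proof -
        have x2: "qgrad_x (Q k) c x (l *\<^sub>R \<xi>) = l\<^sup>2 *\<^sub>R qgrad_x (Q k) c x \<xi>" for k
          by (simp add: vec_eq_iff qgrad_x_def sum_distrib_left power2_eq_square mult_ac)
        have p1: "qgrad_p (Q k) c x (l *\<^sub>R \<xi>) = l *\<^sub>R qgrad_p (Q k) c x \<xi>" for k
          by (simp add: vec_eq_iff qgrad_p_def sum_distrib_left mult_ac)
        \<comment> \<open>Position and momentum parts of the dependency vanish separately and may be
          rescaled by 1/l^2 and 1/l. This turns it into a dependency, with the same coefficients, at
          the unscaled point, where the potentials enter with the factor 1/l^2.\<close>
        have A1: "(\<Sum>k<N. a k *\<^sub>R (l\<^sup>2 *\<^sub>R qgrad_x (Q k) c x \<xi> + grad c (W k) (cinv c x))) = 0"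
          and A2: "(\<Sum>k<N. a k *\<^sub>R l *\<^sub>R qgrad_p (Q k) c x \<xi>) = 0"
          using arg_cong[OF a, of fst] arg_cong[OF a, of snd]
          by (simp_all add: R_def x2 p1 fst_sum snd_sum)
        have "(\<Sum>k<N. a k *\<^sub>R (R W0 k x \<xi> + inverse (l\<^sup>2) *\<^sub>R (grad c (W k) (cinv c x), 0))) =
           ((\<Sum>k<N. a k *\<^sub>R (qgrad_x (Q k) c x \<xi> + inverse (l\<^sup>2) *\<^sub>R grad c (W k) (cinv c x))),
            (\<Sum>k<N. a k *\<^sub>R qgrad_p (Q k) c x \<xi>))"
          by (simp add: prod_eq_iff fst_sum snd_sum R_def g0)
        also have "(\<Sum>k<N. a k *\<^sub>R (qgrad_x (Q k) c x \<xi> + inverse (l\<^sup>2) *\<^sub>R grad c (W k) (cinv c x)))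
           = inverse (l\<^sup>2) *\<^sub>R (\<Sum>k<N. a k *\<^sub>R (l\<^sup>2 *\<^sub>R qgrad_x (Q k) c x \<xi> + grad c (W k) (cinv c x)))"
          using l by (simp add: scaleR_sum_right scaleR_add_right mult.commute mult.left_commute)
        also have "(\<Sum>k<N. a k *\<^sub>R qgrad_p (Q k) c x \<xi>) = inverse l *\<^sub>R (\<Sum>k<N. a k *\<^sub>R l *\<^sub>R qgrad_p (Q k) c x \<xi>)"
          using l by (simp add: scaleR_sum_right field_simps)
        finally have "(\<Sum>k<N. a k *\<^sub>R (R W0 k x \<xi> + inverse (l\<^sup>2) *\<^sub>R (grad c (W k) (cinv c x), 0))) = 0"
          by (simp only: A1 A2 scaleR_zero_right zero_prod_def)
        then show ?thesis by (rule good)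
      qed
      then show ?thesis using S_iff[of x W, OF xc W] by blast
    qed
    moreover have "dist (x, l *\<^sub>R \<xi>) z < e"
    proof -
      have "dist (x, l *\<^sub>R \<xi>) (x, \<xi>) = \<bar>l - 1\<bar> * norm \<xi>"
        by (simp add: dist_Pair_Pair dist_norm norm_scaleR[symmetric] scaleR_diff_left del: norm_scaleR)
      also have "\<dots> \<le> d * norm \<xi>" using l by (intro mult_right_mono) auto
      finally have "dist (x, l *\<^sub>R \<xi>) (x, \<xi>) < e / 2" using d by simp
      then show ?thesis using y(2) dist_triangle[of "(x, l *\<^sub>R \<xi>)" z "(x, \<xi>)"] unfolding x by linarith
    qed
    ultimately show ?thesis by blast
  qed
  then have "z \<in> closure (S W)" unfolding closure_approachable by blast
  then show "z \<in> closure {z \<in> crange c \<times> UNIV. \<forall>a::nat \<Rightarrow> real.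
      (\<forall>w. (\<Sum>k<N. a k * frechet_derivative (quadratic_integral (Q k) (W k) c) (at z) w) = 0) \<longrightarrow> (\<forall>k<N. a k = 0)}"
    unfolding S_def .
qed

end


section \<open>Tensor fields in charts\<close>

lemma matrix_inv_inverse:
  fixes M :: "real^'k::finite^'k"
  assumes "invertible M"
  shows "M ** matrix_inv M = mat 1" "matrix_inv M ** M = mat 1"
  using someI_ex[of "\<lambda>A'. M ** A' = mat 1 \<and> A' ** M = mat 1"] assms
  unfolding invertible_def matrix_inv_def by auto

lemma matrix_inv_unique:
  fixes M :: "real^'k::finite^'k"
  assumes "M ** N = mat 1"
  shows "matrix_inv M = N"
proof -
  have "N ** M = mat 1" using assms matrix_left_right_inverse by blast
  then have "invertible M" using assms unfolding invertible_def by blast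
  then have "matrix_inv M = matrix_inv M ** (M ** N)" using assms by (simp add: matrix_mul_rid)
  also have "\<dots> = N" by (simp add: matrix_mul_assoc matrix_inv_inverse[OF \<open>invertible M\<close>] matrix_mul_lid)
  finally show ?thesis .
qed

lemma sum_matrix_inv:
  fixes M :: "real^'k::finite^'k"
  assumes "invertible M"
  shows "(\<Sum>a\<in>UNIV. M $ i $ a * matrix_inv M $ a $ j) = (if i = j then 1 else 0)"
    "(\<Sum>a\<in>UNIV. matrix_inv M $ i $ a * M $ a $ j) = (if i = j then 1 else 0)"
  using matrix_inv_inverse[OF assms] by (auto simp: vec_eq_iff matrix_matrix_mult_def mat_def)

text \<open>Cramer's rule exhibits the entries of the inverse as quotients of polynomials in the
  entries of \<open>M\<close>, from which smoothness follows.\<close>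

lemma matrix_inv_cramer:
  fixes M :: "real^'k::finite^'k"
  assumes "invertible M"
  shows "matrix_inv M $ k $ l = det (\<chi> i j. if j = k then axis l 1 $ i else M $ i $ j) / det M"
proof -
  have "M *v (matrix_inv M *v axis l 1) = axis l 1"
    by (simp add: matrix_vector_mul_assoc matrix_inv_inverse[OF assms])
  moreover have "det M \<noteq> 0" using assms by (simp add: invertible_det_nz)
  ultimately have "matrix_inv M *v axis l 1 = (\<chi> k. det (\<chi> i j. if j = k then axis l 1 $ i else M $ i $ j) / det M)"
    by (simp add: cramer)
  then have "(matrix_inv M *v axis l 1) $ k = det (\<chi> i j. if j = k then axis l 1 $ i else M $ i $ j) / det M" by simp
  then show ?thesis by (simp add: matrix_vector_mult_basis column_def)
qed

lemma sum_if_eq: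
  fixes f :: "'k::finite \<Rightarrow> real"
  shows "(\<Sum>a\<in>UNIV. (if a = i then 1 else 0) * f a) = f i" "(\<Sum>a\<in>UNIV. (if i = a then 1 else 0) * f a) = f i"
    "(\<Sum>a\<in>UNIV. f a * (if a = i then 1 else 0)) = f i" "(\<Sum>a\<in>UNIV. f a * (if i = a then 1 else 0)) = f i"
  by (simp_all add: if_distrib[of "\<lambda>x. x * _"] if_distrib[of "\<lambda>x. _ * x"] cong: if_cong)

lemma sum_swap4:
  fixes f :: "'b::finite \<Rightarrow> 'c::finite \<Rightarrow> 'd::finite \<Rightarrow> 'e::finite \<Rightarrow> real"
  shows "(\<Sum>a\<in>UNIV. \<Sum>b\<in>UNIV. \<Sum>i\<in>UNIV. \<Sum>j\<in>UNIV. f a b i j) = (\<Sum>i\<in>UNIV. \<Sum>j\<in>UNIV. \<Sum>a\<in>UNIV. \<Sum>b\<in>UNIV. f a b i j)"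
proof -
  have "(\<Sum>a\<in>UNIV. \<Sum>b\<in>UNIV. \<Sum>i\<in>UNIV. \<Sum>j\<in>UNIV. f a b i j) = (\<Sum>a\<in>UNIV. \<Sum>i\<in>UNIV. \<Sum>b\<in>UNIV. \<Sum>j\<in>UNIV. f a b i j)"
    by (rule sum.cong[OF refl], rule sum.swap)
  also have "\<dots> = (\<Sum>i\<in>UNIV. \<Sum>a\<in>UNIV. \<Sum>b\<in>UNIV. \<Sum>j\<in>UNIV. f a b i j)" by (rule sum.swap)
  also have "\<dots> = (\<Sum>i\<in>UNIV. \<Sum>a\<in>UNIV. \<Sum>j\<in>UNIV. \<Sum>b\<in>UNIV. f a b i j)"
    by (rule sum.cong[OF refl], rule sum.cong[OF refl], rule sum.swap)
  also have "\<dots> = (\<Sum>i\<in>UNIV. \<Sum>j\<in>UNIV. \<Sum>a\<in>UNIV. \<Sum>b\<in>UNIV. f a b i j)"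
    by (rule sum.cong[OF refl], rule sum.swap)
  finally show ?thesis .
qed

context smooth_manifold
begin

lemma smooth_det:
  fixes M :: "'a \<Rightarrow> real^'k::finite^'k"
  assumes "c \<in> A" "\<And>i j. smooth_in_chart c (\<lambda>p. M p $ i $ j)"
  shows "smooth_in_chart c (\<lambda>p. det (M p))"
  unfolding det_def using assms by (intro smooth_sum smooth_mult smooth_prod smooth_const)

lemma smooth_matrix_inv:
  fixes M :: "'a \<Rightarrow> real^'k::finite^'k"
  assumes c: "c \<in> A" and M: "\<And>i j. smooth_in_chart c (\<lambda>p. M p $ i $ j)"
    and inv: "\<And>p. p \<in> cdom c \<Longrightarrow> invertible (M p)"
  shows "smooth_in_chart c (\<lambda>p. matrix_inv (M p) $ k $ l)"
proof (rule smooth_in_chart_cong[OF c])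
  show "det (\<chi> i j. if j = k then axis l 1 $ i else M p $ i $ j) / det (M p) = matrix_inv (M p) $ k $ l"
    if "p \<in> cdom c" for p using matrix_inv_cramer[OF inv[OF that]] by simp
  have "smooth_in_chart c (\<lambda>p. (\<chi> i j. if j = k then axis l 1 $ i else M p $ i $ j) $ i $ j)" for i j :: 'k
    using M smooth_const[OF c] by (cases "j = k") auto
  then show "smooth_in_chart c (\<lambda>p. det (\<chi> i j. if j = k then axis l 1 $ i else M p $ i $ j) / det (M p))"
    using inv invertible_det_nz by (intro smooth_divide smooth_det M c) auto
qed

end

locale riemannian_manifold = smooth_manifold A
  for A :: "('a::topological_space, 'n::finite) chart set" +
  fixes g :: "('a, 'n) tensor2"
  assumes metric: "riemannian_metric A g"
begin

abbreviation G :: "('a, 'n) chart \<Rightarrow> 'a \<Rightarrow> 'n \<Rightarrow> 'n \<Rightarrow> real" where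
  "G c p i j \<equiv> g c p $ i $ j"

abbreviation GI :: "('a, 'n) chart \<Rightarrow> 'a \<Rightarrow> 'n \<Rightarrow> 'n \<Rightarrow> real" where
  "GI c p i j \<equiv> ginv g c p $ i $ j"

section \<open>The metric, its inverse and the one-forms K dV under change of chart\<close>

lemma g_tensor: "tensor_field_02 A g"
  using metric by (simp add: riemannian_metric_def)

lemma g_smooth: "c \<in> A \<Longrightarrow> smooth_in_chart c (\<lambda>p. G c p i j)"
  using g_tensor by (simp add: tensor_field_02_def)

lemma g_sym:
  assumes "c \<in> A" "p \<in> cdom c"
  shows "G c p i j = G c p j i"
proof -
  have "transpose (g c p) = g c p" using metric assms by (simp add: riemannian_metric_def)
  then have "transpose (g c p) $ i $ j = g c p $ i $ j" by simp
  then show ?thesis by (simp add: transpose_def)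
qed

lemma g_invertible:
  assumes "c \<in> A" "p \<in> cdom c"
  shows "invertible (g c p)"
proof -
  have "v = 0" if "g c p *v v = 0" for v
  proof (rule ccontr)
    assume "v \<noteq> 0"
    then have "v \<bullet> (g c p *v v) > 0" using metric assms by (simp add: riemannian_metric_def)
    then show False using that by simp
  qed
  then show ?thesis
    using matrix_left_invertible_ker[of "g c p"] invertible_left_inverse[of "g c p"] by blast
qed

lemma g_ginv:
  assumes "c \<in> A" "p \<in> cdom c"
  shows "(\<Sum>a\<in>UNIV. G c p i a * GI c p a j) = (if i = j then 1 else 0)"
    "(\<Sum>a\<in>UNIV. GI c p i a * G c p a j) = (if i = j then 1 else 0)"
  using sum_matrix_inv[OF g_invertible[OF assms]] by (auto simp: ginv_def)

lemma ginv_smooth: "c \<in> A \<Longrightarrow> smooth_in_chart c (\<lambda>p. GI c p i j)"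
  unfolding ginv_def by (intro smooth_matrix_inv g_smooth g_invertible)

lemma ginv_sym:
  assumes "c \<in> A" "p \<in> cdom c"
  shows "GI c p i j = GI c p j i"
proof -
  have "transpose (g c p) = g c p" using metric assms by (simp add: riemannian_metric_def)
  then have "g c p ** transpose (matrix_inv (g c p)) = transpose (matrix_inv (g c p) ** g c p)"
    by (simp add: matrix_transpose_mul)
  also have "\<dots> = mat 1" using matrix_inv_inverse[OF g_invertible[OF assms]] by (simp add: transpose_mat)
  finally have "matrix_inv (g c p) = transpose (matrix_inv (g c p))" by (rule matrix_inv_unique)
  then have "matrix_inv (g c p) $ i $ j = transpose (matrix_inv (g c p)) $ i $ j" by metis
  then show ?thesis by (simp add: ginv_def transpose_def)
qed

lemma tensor_02_matrix:
  assumes "tensor_field_02 A K" "c \<in> A" "c' \<in> A" "p \<in> cdom c" "p \<in> cdom c'"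
  shows "K c p = transpose (Jac c c' p) ** K c' p ** Jac c c' p"
proof -
  have "K c p $ a $ b = (\<Sum>i\<in>UNIV. \<Sum>j\<in>UNIV. jac c c' p i a * jac c c' p j b * K c' p $ i $ j)" for a b
    using assms unfolding tensor_field_02_def by blast
  also have "(\<Sum>i\<in>UNIV. \<Sum>j\<in>UNIV. jac c c' p i a * jac c c' p j b * K c' p $ i $ j) =
      (transpose (Jac c c' p) ** K c' p ** Jac c c' p) $ a $ b" for a b
    unfolding matrix_matrix_mult_def transpose_def
    by (simp add: sum_distrib_right) (subst sum.swap, simp add: mult_ac)
  finally show ?thesis by (simp add: vec_eq_iff)
qed

lemma ginv_transform:
  assumes "c \<in> A" "c' \<in> A" "p \<in> cdom c" "p \<in> cdom c'"
  shows "Jac c c' p ** ginv g c p ** transpose (Jac c c' p) = ginv g c' p"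
proof -
  let ?J = "Jac c c' p" and ?K = "Jac c' c p"
  have JK: "?J ** ?K = mat 1" "?K ** ?J = mat 1" using Jac_inverse assms by auto
  have "g c' p ** (?J ** ginv g c p ** transpose ?J) =
     (transpose ?K ** g c p ** ?K) ** (?J ** ginv g c p ** transpose ?J)"
    using tensor_02_matrix[OF g_tensor assms(2,1,4,3)] by simp
  also have "\<dots> = transpose ?K ** (g c p ** ((?K ** ?J) ** ginv g c p)) ** transpose ?J"
    by (simp add: matrix_mul_assoc)
  also have "\<dots> = transpose ?K ** transpose ?J"
    using matrix_inv_inverse[OF g_invertible[OF assms(1,3)]] JK by (simp add: ginv_def matrix_mul_lid matrix_mul_rid)
  also have "\<dots> = mat 1" using JK by (simp add: matrix_transpose_mul[symmetric] transpose_mat)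
  finally show ?thesis using matrix_inv_unique unfolding ginv_def by metis
qed

lemma ginv_transform_sum:
  assumes "c \<in> A" "c' \<in> A" "p \<in> cdom c" "p \<in> cdom c'"
  shows "(\<Sum>a\<in>UNIV. \<Sum>b\<in>UNIV. GI c p a b * jac c c' p i a * jac c c' p j b) = GI c' p i j"
proof -
  have "(Jac c c' p ** ginv g c p ** transpose (Jac c c' p)) $ i $ j = (\<Sum>a\<in>UNIV. \<Sum>b\<in>UNIV. GI c p a b * jac c c' p i a * jac c c' p j b)"
    unfolding matrix_matrix_mult_def transpose_def
    by (simp add: sum_distrib_right) (subst sum.swap, simp add: mult_ac)
  then show ?thesis using ginv_transform[OF assms] by simp
qed

lemma jac_jac:
  assumes "c \<in> A" "c' \<in> A" "p \<in> cdom c" "p \<in> cdom c'"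
  shows "(\<Sum>a\<in>UNIV. jac c c' p i a * jac c' c p a j) = (if i = j then 1 else 0)"
  using Jac_inverse[OF assms(2,1,4,3)] by (simp add: vec_eq_iff matrix_matrix_mult_def mat_def)

lemma christoffel_smooth: "c \<in> A \<Longrightarrow> smooth_in_chart c (christoffel g c k i j)"
  unfolding christoffel_def[abs_def] by (intro smooth_intros ginv_smooth smooth_pd g_smooth)

lemma christoffel_lowered:
  assumes "c \<in> A" "p \<in> cdom c"
  shows "(\<Sum>m\<in>UNIV. christoffel g c m i j p * G c p m k) =
    1/2 * (pd c i (\<lambda>q. G c q j k) p + pd c j (\<lambda>q. G c q i k) p - pd c k (\<lambda>q. G c q i j) p)"
proof -
  let ?e = "\<lambda>l. pd c i (\<lambda>q. G c q j l) p + pd c j (\<lambda>q. G c q i l) p - pd c l (\<lambda>q. G c q i j) p"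
  have "(\<Sum>m\<in>UNIV. christoffel g c m i j p * G c p m k) = (\<Sum>m\<in>UNIV. \<Sum>l\<in>UNIV. 1/2 * (GI c p l m * G c p m k * ?e l))"
    unfolding christoffel_def by (simp add: sum_distrib_left sum_distrib_right ginv_sym[OF assms, of _ _] mult_ac)
  also have "\<dots> = (\<Sum>l\<in>UNIV. 1/2 * ((\<Sum>m\<in>UNIV. GI c p l m * G c p m k) * ?e l))"
    by (subst sum.swap) (simp add: sum_distrib_left sum_distrib_right)
  also have "\<dots> = 1/2 * ?e k" unfolding g_ginv[OF assms] sum_distrib_left[symmetric] sum_if_eq ..
  finally show ?thesis .
qed

lemma K_dV_transform:
  assumes "tensor_field_02 A K" "V \<in> smooth_functions A" "c \<in> A" "c' \<in> A" "p \<in> cdom c" "p \<in> cdom c'"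
  shows "K_dV g K V c j p = (\<Sum>i\<in>UNIV. jac c c' p i j * K_dV g K V c' i p)"
proof -
  let ?J = "Jac c c' p"
  let ?d = "\<lambda>c. (\<chi> i. pd c i V p)"
  have d: "?d c = transpose ?J *v ?d c'"
    using pd_transform[OF assms(3-6,2)]
    by (simp add: vec_eq_iff matrix_vector_mult_def transpose_def del: transpose_matrix_vector)
  have K: "K_dV g K V c j p = ((K c p ** ginv g c p) *v ?d c) $ j" for c j
    by (simp add: K_dV_def mixed_def matrix_matrix_mult_def matrix_vector_mult_def)
  have "(K c p ** ginv g c p) *v ?d c = (transpose ?J ** (K c' p ** (?J ** ginv g c p ** transpose ?J))) *v ?d c'"
    unfolding tensor_02_matrix[OF assms(1,3-6)] d matrix_vector_mul_assoc matrix_mul_assoc ..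
  also have "\<dots> = transpose ?J *v ((K c' p ** ginv g c' p) *v ?d c')"
    unfolding ginv_transform[OF assms(3-6)] matrix_vector_mul_assoc matrix_mul_assoc ..
  finally show ?thesis unfolding K by (simp add: matrix_vector_mult_def transpose_def del: transpose_matrix_vector)
qed

lemma mixed_smooth:
  assumes "tensor_field_02 A K" "c \<in> A"
  shows "smooth_in_chart c (\<lambda>p. mixed g K c p $ i $ j)"
proof -
  have "smooth_in_chart c (\<lambda>p. K c p $ i $ j)" for i j using assms by (simp add: tensor_field_02_def)
  then show ?thesis unfolding mixed_def using assms by (auto intro!: smooth_intros ginv_smooth)
qed

lemma raised_smooth:
  assumes "tensor_field_02 A K" "c \<in> A"
  shows "smooth_in_chart c (\<lambda>p. raised g K c p $ i $ j)"
proof -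
  have "smooth_in_chart c (\<lambda>p. K c p $ i $ j)" for i j using assms by (simp add: tensor_field_02_def)
  then show ?thesis unfolding raised_def using assms by (auto intro!: smooth_intros ginv_smooth)
qed

lemma K_dV_smooth:
  assumes "tensor_field_02 A K" "V \<in> smooth_functions A" "c \<in> A"
  shows "smooth_in_chart c (K_dV g K V c i)"
  unfolding K_dV_def[abs_def]
  using assms by (intro smooth_intros mixed_smooth smooth_pd smooth_functions_chart)

lemma hess_smooth:
  assumes "c \<in> A" "smooth_in_chart c V"
  shows "smooth_in_chart c (hess g c V i j)"
  unfolding hess_def[abs_def] using assms by (intro smooth_intros smooth_pd christoffel_smooth)

lemma laplacian_smooth:
  assumes "c \<in> A" "smooth_in_chart c V"
  shows "smooth_in_chart c (laplacian g c V)"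
  unfolding laplacian_def[abs_def] using assms by (intro smooth_intros hess_smooth ginv_smooth)

lemma potential_part_exists:
  assumes "simply_connected (UNIV :: 'a set)" "tensor_field_02 A K" "V \<in> smooth_functions A" "bertrand_darboux A g K V"
  shows "\<exists>W. is_potential_part A g K V W"
proof -
  obtain F where "F \<in> smooth_functions A" "\<And>c i p. c \<in> A \<Longrightarrow> p \<in> cdom c \<Longrightarrow> pd c i F p = K_dV g K V c i p"
  proof (rule closed_form_exact[OF assms(1), of "\<lambda>c i p. K_dV g K V c i p"])
    show "smooth_in_chart c (K_dV g K V c i)" if "c \<in> A" for c i
      by (rule K_dV_smooth[OF assms(2,3) that])
    show "K_dV g K V c j p = (\<Sum>i\<in>UNIV. jac c c' p i j * K_dV g K V c' i p)"
      if "c \<in> A" "c' \<in> A" "p \<in> cdom c" "p \<in> cdom c'" for c c' p j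
      by (rule K_dV_transform[OF assms(2,3) that])
    show "pd c i (K_dV g K V c j) p = pd c j (K_dV g K V c i) p" if "c \<in> A" "p \<in> cdom c" for c i j p
      using assms(4) that unfolding bertrand_darboux_def by simp
  qed blast
  then show ?thesis unfolding is_potential_part_def by blast
qed

end

locale structure_tensor = riemannian_manifold A g
  for A :: "('a::topological_space, 'n::finite) chart set" and g +
  fixes D :: "('a, 'n) tensor3"
  assumes D_tensor: "tensor_field_12 A D"
    and D_sym: "c \<in> A \<Longrightarrow> p \<in> cdom c \<Longrightarrow> D c p $ i $ j $ m = D c p $ j $ i $ m"
begin

section \<open>Traces of the structure tensor and the obstruction\<close>

definition D_trace :: "('a, 'n) chart \<Rightarrow> 'a \<Rightarrow> 'n \<Rightarrow> real" where
  "D_trace c p m = (\<Sum>a\<in>UNIV. \<Sum>b\<in>UNIV. GI c p a b * D c p $ b $ a $ m)"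

lemma D_smooth: "c \<in> A \<Longrightarrow> smooth_in_chart c (\<lambda>p. D c p $ i $ j $ m)"
  using D_tensor by (simp add: tensor_field_12_def)

lemma D_law:
  assumes "c \<in> A" "c' \<in> A" "p \<in> cdom c" "p \<in> cdom c'"
  shows "(\<Sum>m\<in>UNIV. jac c c' p k m * D c p $ a $ b $ m) =
     (\<Sum>i\<in>UNIV. \<Sum>j\<in>UNIV. jac c c' p i a * jac c c' p j b * D c' p $ i $ j $ k)"
  using D_tensor assms unfolding tensor_field_12_def by blast

lemma D_trace_smooth: "c \<in> A \<Longrightarrow> smooth_in_chart c (\<lambda>p. D_trace c p m)"
  unfolding D_trace_def by (intro smooth_intros ginv_smooth D_smooth)

lemma D_trace_law:
  assumes "c \<in> A" "c' \<in> A" "p \<in> cdom c" "p \<in> cdom c'"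
  shows "(\<Sum>m\<in>UNIV. jac c c' p k m * D_trace c p m) = D_trace c' p k"
proof -
  let ?J = "jac c c' p"
  have "(\<Sum>m\<in>UNIV. ?J k m * D_trace c p m) = (\<Sum>a\<in>UNIV. \<Sum>b\<in>UNIV. GI c p a b * (\<Sum>m\<in>UNIV. ?J k m * D c p $ b $ a $ m))"
    unfolding D_trace_def sum_distrib_left
    by (subst sum.swap, rule sum.cong[OF refl], subst sum.swap) (simp add: mult_ac)
  also have "\<dots> = (\<Sum>a\<in>UNIV. \<Sum>b\<in>UNIV. \<Sum>i\<in>UNIV. \<Sum>j\<in>UNIV. GI c p a b * ?J j a * ?J i b * D c' p $ i $ j $ k)"
    unfolding D_law[OF assms] by (simp add: sum_distrib_left mult_ac)
  also have "\<dots> = (\<Sum>i\<in>UNIV. \<Sum>j\<in>UNIV. \<Sum>a\<in>UNIV. \<Sum>b\<in>UNIV. GI c p a b * ?J j a * ?J i b * D c' p $ i $ j $ k)"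
    by (rule sum_swap4)
  also have "\<dots> = (\<Sum>i\<in>UNIV. \<Sum>j\<in>UNIV. GI c' p j i * D c' p $ i $ j $ k)"
    unfolding ginv_transform_sum[OF assms, symmetric] by (simp add: sum_distrib_right)
  also have "\<dots> = D_trace c' p k" unfolding D_trace_def by (rule sum.swap)
  finally show ?thesis .
qed

lemma trace_free_part_eq:
  "trace_free_part g D c p $ i $ j $ k = D c p $ i $ j $ k - 1 / real CARD('n) * G c p i j * D_trace c p k"
  by (simp add: trace_free_part_def D_trace_def)

lemma trace_free_part_tensor: "tensor_field_12 A (trace_free_part g D)"
  unfolding tensor_field_12_def
proof (intro conjI ballI allI)
  show "smooth_in_chart c (\<lambda>p. trace_free_part g D c p $ i $ j $ m)" if "c \<in> A" for c i j m
    unfolding trace_free_part_eq using that by (intro smooth_intros g_smooth D_smooth D_trace_smooth)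
  fix c c' p a b k assume c: "c \<in> A" "c' \<in> A" and "p \<in> cdom c \<inter> cdom c'"
  then have p: "p \<in> cdom c" "p \<in> cdom c'" by auto
  let ?J = "jac c c' p" and ?n = "real CARD('n)"
  have g: "G c p a b = (\<Sum>i\<in>UNIV. \<Sum>j\<in>UNIV. ?J i a * ?J j b * G c' p i j)"
    using g_tensor c p unfolding tensor_field_02_def by blast
  have "(\<Sum>m\<in>UNIV. ?J k m * trace_free_part g D c p $ a $ b $ m)
    = (\<Sum>m\<in>UNIV. ?J k m * D c p $ a $ b $ m) - 1 / ?n * G c p a b * (\<Sum>m\<in>UNIV. ?J k m * D_trace c p m)"
    unfolding trace_free_part_eq by (simp add: right_diff_distrib sum_subtractf sum_distrib_left mult_ac)
  also have "\<dots> = (\<Sum>i\<in>UNIV. \<Sum>j\<in>UNIV. ?J i a * ?J j b * trace_free_part g D c' p $ i $ j $ k)"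
    unfolding D_law[OF c p] D_trace_law[OF c p] g trace_free_part_eq
    by (simp add: right_diff_distrib sum_subtractf sum_distrib_left sum_distrib_right mult_ac)
  finally show "(\<Sum>m\<in>UNIV. ?J k m * trace_free_part g D c p $ a $ b $ m) =
     (\<Sum>i\<in>UNIV. \<Sum>j\<in>UNIV. ?J i a * ?J j b * trace_free_part g D c' p $ i $ j $ k)" .
qed

definition L :: "('a, 'n) chart \<Rightarrow> 'a \<Rightarrow> 'n \<Rightarrow> 'n \<Rightarrow> 'n \<Rightarrow> real" where
  "L c p i j k = (\<Sum>m\<in>UNIV. D c p $ i $ j $ m * G c p m k)"

lemma L_sym: "c \<in> A \<Longrightarrow> p \<in> cdom c \<Longrightarrow> L c p i j k = L c p j i k"
  by (simp add: L_def D_sym)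

definition \<mu> :: "('a, 'n) chart \<Rightarrow> 'n \<Rightarrow> 'a \<Rightarrow> real" where
  "\<mu> c k p = trace_difference g D c p $ k / (real CARD('n) - 1)"

lemma trace_difference_eq:
  "trace_difference g D c p $ j = (\<Sum>i\<in>UNIV. \<Sum>a\<in>UNIV. GI c p i a * (L c p a j i - L c p a i j))"
  by (simp add: trace_difference_def lowered_def L_def)

text \<open>Written as a contraction of \<open>D\<close> with itself minus a lowered trace, each
  term is visibly smooth and has a simple transformation law.\<close>

lemma trace_difference_eq':
  assumes "c \<in> A" "p \<in> cdom c"
  shows "trace_difference g D c p $ j = (\<Sum>a\<in>UNIV. D c p $ a $ j $ a) - (\<Sum>m\<in>UNIV. D_trace c p m * G c p m j)"
proof -
  have "(\<Sum>i\<in>UNIV. \<Sum>a\<in>UNIV. GI c p i a * L c p a j i) = (\<Sum>a\<in>UNIV. \<Sum>i\<in>UNIV. \<Sum>m\<in>UNIV. G c p m i * GI c p i a * D c p $ a $ j $ m)"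
    unfolding L_def sum_distrib_left by (subst sum.swap) (simp add: mult_ac)
  also have "\<dots> = (\<Sum>a\<in>UNIV. \<Sum>m\<in>UNIV. (\<Sum>i\<in>UNIV. G c p m i * GI c p i a) * D c p $ a $ j $ m)"
    unfolding sum_distrib_right by (intro sum.cong[OF refl] sum.swap)
  also have "\<dots> = (\<Sum>a\<in>UNIV. D c p $ a $ j $ a)"
    unfolding g_ginv[OF assms] sum_if_eq ..
  finally have 1: "(\<Sum>i\<in>UNIV. \<Sum>a\<in>UNIV. GI c p i a * L c p a j i) = (\<Sum>a\<in>UNIV. D c p $ a $ j $ a)" .
  have "(\<Sum>i\<in>UNIV. \<Sum>a\<in>UNIV. GI c p i a * L c p a i j) = (\<Sum>i\<in>UNIV. \<Sum>m\<in>UNIV. \<Sum>a\<in>UNIV. GI c p i a * D c p $ a $ i $ m * G c p m j)"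
    unfolding L_def sum_distrib_left by (subst (2) sum.swap) (simp add: mult_ac)
  also have "\<dots> = (\<Sum>m\<in>UNIV. D_trace c p m * G c p m j)"
    unfolding D_trace_def sum_distrib_right by (rule sum.swap)
  finally have 2: "(\<Sum>i\<in>UNIV. \<Sum>a\<in>UNIV. GI c p i a * L c p a i j) = (\<Sum>m\<in>UNIV. D_trace c p m * G c p m j)" .
  show ?thesis unfolding trace_difference_eq right_diff_distrib sum_subtractf 1 2 ..
qed

lemma \<mu>_smooth:
  assumes "c \<in> A"
  shows "smooth_in_chart c (\<mu> c k)"
proof -
  have "smooth_in_chart c (\<lambda>p. inverse (real CARD('n) - 1) * ((\<Sum>a\<in>UNIV. D c p $ a $ k $ a) - (\<Sum>m\<in>UNIV. D_trace c p m * G c p m k)))"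
    using assms by (intro smooth_intros g_smooth D_smooth D_trace_smooth)
  then show ?thesis
    by (rule smooth_in_chart_cong[OF assms, rotated]) (simp add: \<mu>_def trace_difference_eq'[OF assms] divide_inverse)
qed

lemma \<mu>_law:
  assumes "c \<in> A" "c' \<in> A" "p \<in> cdom c" "p \<in> cdom c'"
  shows "\<mu> c b p = (\<Sum>j\<in>UNIV. jac c c' p j b * \<mu> c' j p)"
proof -
  let ?J = "jac c c' p" and ?K = "jac c' c p"
  \<comment> \<open>The tensor law carries the Jacobian on the upper index to the left; it is
    inverted here so that the upper index can be contracted with a lower one.\<close>
  have D: "D c p $ a $ b $ m = (\<Sum>k\<in>UNIV. \<Sum>i\<in>UNIV. \<Sum>j\<in>UNIV. ?K m k * (?J i a * ?J j b * D c' p $ i $ j $ k))" for a m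
  proof -
    have "(\<Sum>k\<in>UNIV. ?K m k * (\<Sum>l\<in>UNIV. ?J k l * D c p $ a $ b $ l)) = (\<Sum>l\<in>UNIV. (\<Sum>k\<in>UNIV. ?K m k * ?J k l) * D c p $ a $ b $ l)"
      unfolding sum_distrib_left sum_distrib_right by (subst sum.swap) (simp add: mult_ac)
    also have "\<dots> = D c p $ a $ b $ m" unfolding jac_jac[OF assms(2,1,4,3)] sum_if_eq ..
    finally show ?thesis unfolding D_law[OF assms] by (simp add: sum_distrib_left)
  qed
  have "(\<Sum>a\<in>UNIV. D c p $ a $ b $ a) = (\<Sum>a\<in>UNIV. \<Sum>k\<in>UNIV. \<Sum>i\<in>UNIV. \<Sum>j\<in>UNIV. ?J i a * ?K a k * (?J j b * D c' p $ i $ j $ k))"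
    unfolding D by (simp add: mult_ac)
  also have "\<dots> = (\<Sum>k\<in>UNIV. \<Sum>i\<in>UNIV. \<Sum>j\<in>UNIV. \<Sum>a\<in>UNIV. ?J i a * ?K a k * (?J j b * D c' p $ i $ j $ k))"
    by (subst sum.swap, rule sum.cong[OF refl], subst sum.swap, rule sum.cong[OF refl], subst sum.swap, rule refl)
  also have "\<dots> = (\<Sum>k\<in>UNIV. \<Sum>i\<in>UNIV. (if i = k then 1 else 0) * (\<Sum>j\<in>UNIV. ?J j b * D c' p $ i $ j $ k))"
    unfolding sum_distrib_right[symmetric] jac_jac[OF assms] by (simp add: sum_distrib_left)
  also have "\<dots> = (\<Sum>j\<in>UNIV. ?J j b * (\<Sum>k\<in>UNIV. D c' p $ k $ j $ k))"
    unfolding sum_if_eq by (subst sum.swap) (simp add: sum_distrib_left)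
  finally have 1: "(\<Sum>a\<in>UNIV. D c p $ a $ b $ a) = (\<Sum>j\<in>UNIV. ?J j b * (\<Sum>k\<in>UNIV. D c' p $ k $ j $ k))" .
  have g: "G c p m b = (\<Sum>k\<in>UNIV. \<Sum>j\<in>UNIV. ?J k m * ?J j b * G c' p k j)" for m
    using g_tensor assms unfolding tensor_field_02_def by blast
  have "(\<Sum>m\<in>UNIV. D_trace c p m * G c p m b) = (\<Sum>m\<in>UNIV. \<Sum>k\<in>UNIV. \<Sum>j\<in>UNIV. ?J k m * D_trace c p m * (?J j b * G c' p k j))"
    unfolding g sum_distrib_left by (simp add: mult_ac)
  also have "\<dots> = (\<Sum>k\<in>UNIV. \<Sum>j\<in>UNIV. \<Sum>m\<in>UNIV. ?J k m * D_trace c p m * (?J j b * G c' p k j))"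
    by (subst sum.swap, rule sum.cong[OF refl], subst sum.swap, rule refl)
  also have "\<dots> = (\<Sum>k\<in>UNIV. \<Sum>j\<in>UNIV. D_trace c' p k * (?J j b * G c' p k j))"
    unfolding sum_distrib_right[symmetric] D_trace_law[OF assms] ..
  also have "\<dots> = (\<Sum>j\<in>UNIV. ?J j b * (\<Sum>k\<in>UNIV. D_trace c' p k * G c' p k j))"
    by (subst sum.swap) (simp add: sum_distrib_left mult_ac)
  finally have 2: "(\<Sum>m\<in>UNIV. D_trace c p m * G c p m b) = (\<Sum>j\<in>UNIV. ?J j b * (\<Sum>k\<in>UNIV. D_trace c' p k * G c' p k j))" .
  have lin: "((\<Sum>j\<in>UNIV. ?J j b * x j) - (\<Sum>j\<in>UNIV. ?J j b * y j)) / r = (\<Sum>j\<in>UNIV. ?J j b * ((x j - y j) / r))"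
    for x y :: "'n \<Rightarrow> real" and r
    by (simp add: sum_subtractf[symmetric] right_diff_distrib sum_divide_distrib)
  show ?thesis
    unfolding \<mu>_def trace_difference_eq'[OF assms(1,3)] trace_difference_eq'[OF assms(2,4)] 1 2 by (rule lin)
qed

text \<open>In g_ij e_k - g_ik e_j the trace over the first and last index leaves e_j - n e_j, which
  is the origin of n - 1. The factor \<open>s\<close> is kept so that, with e = ds, the equation for
  ds is available also at zeros of \<open>s\<close>.\<close>

lemma contraction:
  assumes "c \<in> A" "p \<in> cdom c"
    and eq: "\<And>i j k. s * (L c p i j k - L c p i k j) + e k * G c p i j - e j * G c p i k = 0"
  shows "(real CARD('n) - 1) * e j = s * trace_difference g D c p $ j"
proof -
  have "s * trace_difference g D c p $ j = (\<Sum>i\<in>UNIV. \<Sum>a\<in>UNIV. GI c p i a * (s * (L c p a j i - L c p a i j)))"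
    unfolding trace_difference_eq by (simp add: sum_distrib_left mult_ac)
  also have "\<dots> = (\<Sum>i\<in>UNIV. \<Sum>a\<in>UNIV. GI c p i a * G c p a i * e j - GI c p i a * G c p a j * e i)"
  proof -
    have "s * (L c p a j i - L c p a i j) = e j * G c p a i - e i * G c p a j" for a i
      using eq[of a j i] by simp
    then show ?thesis by (simp only:) (simp add: algebra_simps)
  qed
  also have "\<dots> = (\<Sum>i\<in>(UNIV :: 'n set). (if i = i then 1 else 0) * e j) - (\<Sum>i\<in>UNIV. (if i = j then 1 else 0) * e i)"
    unfolding sum_subtractf sum_distrib_right[symmetric] g_ginv(2)[OF assms(1,2)] ..
  also have "\<dots> = (real CARD('n) - 1) * e j"
    unfolding sum_if_eq by (simp add: algebra_simps)
  finally show ?thesis by simp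
qed

text \<open>The tensor on the right-hand side is antisymmetric in \<open>j, k\<close> with vanishing cyclic sum, and the
  obstruction tensor is its symmetrisation in \<open>i, j\<close>, up to a factor. If that vanishes, it is totally
  antisymmetric, hence zero.\<close>

lemma obstruction_tensor_zero_iff:
  assumes c: "c \<in> A" "p \<in> cdom c"
  shows "obstruction_tensor g D c p = 0 \<longleftrightarrow>
    (\<forall>i j k. L c p i j k - L c p i k j + \<mu> c k p * G c p i j - \<mu> c j p * G c p i k = 0)" (is "_ = (\<forall>i j k. ?B i j k = 0)")
proof -
  \<comment> \<open>Symmetrising in i, j doubles the term with g_ij \<mu>_k; this accounts for the
    coefficients 2/3 and 1/3 of the trace terms.\<close>
  have N: "obstruction_tensor g D c p $ i $ j $ k = 1/3 * (?B i j k + ?B j i k)" for i j k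
  proof -
    have d: "2 / (3 * r) * x * t = 2 / 3 * (x * (t / r))"
      "2 / (3 * r) * ((x * t + y * u) / 2) = 1 / 3 * (x * (t / r) + y * (u / r))" for r x y t u :: real
      by (cases "r = 0"; simp add: field_simps)+
    have "obstruction_tensor g D c p $ i $ j $ k =
       1/3 * (2 * ((L c p i j k + L c p j i k) / 2) - L c p i k j - L c p j k i)
       + 2 / (3 * (real CARD('n) - 1)) * G c p i j * trace_difference g D c p $ k
       - 2 / (3 * (real CARD('n) - 1)) * ((G c p k i * trace_difference g D c p $ j + G c p k j * trace_difference g D c p $ i) / 2)"
      by (simp add: obstruction_tensor_def Let_def lowered_def L_def)
    then show ?thesis unfolding d \<mu>_def[symmetric] g_sym[OF c, of k] g_sym[OF c, of j i] by (simp add: field_simps)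
  qed
  show ?thesis
  proof
    assume "obstruction_tensor g D c p = 0"
    then have 1: "?B i j k = - ?B j i k" for i j k using N[of i j k] by simp
    have 2: "?B i j k = - ?B i k j" for i j k by simp
    have 3: "?B i j k + ?B j k i + ?B k i j = 0" for i j k
      using L_sym[OF c, of i j k] L_sym[OF c, of j k i] L_sym[OF c, of k i j] g_sym[OF c, of i j] g_sym[OF c, of j k] g_sym[OF c, of k i]
      by simp
    show "\<forall>i j k. ?B i j k = 0"
    proof (intro allI)
      fix i j k
      show "?B i j k = 0" using 1[of i j k] 2[of j i k] 1[of j k i] 2[of k j i] 1[of k i j] 2[of i k j] 3[of i j k] by linarith
    qed
  next
    assume "\<forall>i j k. ?B i j k = 0"
    then show "obstruction_tensor g D c p = 0" using N by (simp add: vec_eq_iff)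
  qed
qed

end


section \<open>The flat frame of an (n+1)-parameter system\<close>

context smooth_manifold
begin

lemma open_nonzero:
  assumes "c \<in> A" "smooth_in_chart c f"
  shows "open {q \<in> cdom c. f q \<noteq> 0}"
proof -
  have "open (cdom c \<inter> f -` (- {0}))"
    by (rule continuous_open_preimage[OF smooth_continuous[OF assms] chart_props(1)[OF assms(1)]]) auto
  also have "cdom c \<inter> f -` (- {0}) = {q \<in> cdom c. f q \<noteq> 0}" by auto
  finally show ?thesis .
qed

end

lemma connected_UNIV_all:
  assumes conn: "connected (UNIV :: 'a::topological_space set)" and "P p0"
    and "\<And>p. P p \<Longrightarrow> \<exists>N. open N \<and> p \<in> N \<and> (\<forall>q\<in>N. P q)"
    and "\<And>p. \<not> P p \<Longrightarrow> \<exists>N. open N \<and> p \<in> N \<and> (\<forall>q\<in>N. \<not> P q)"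
  shows "P (p :: 'a)"
proof (rule ccontr)
  assume "\<not> P p"
  have 1: "open {p. P p}"
  proof (subst open_subopen, intro ballI)
    fix p assume "p \<in> {p. P p}"
    then obtain N where "open N" "p \<in> N" "\<forall>q\<in>N. P q" using assms(3)[of p] by auto
    then show "\<exists>T. open T \<and> p \<in> T \<and> T \<subseteq> {p. P p}" by (intro exI[of _ N]) auto
  qed
  have 2: "open {p. \<not> P p}"
  proof (subst open_subopen, intro ballI)
    fix p assume "p \<in> {p. \<not> P p}"
    then obtain N where "open N" "p \<in> N" "\<forall>q\<in>N. \<not> P q" using assms(4)[of p] by auto
    then show "\<exists>T. open T \<and> p \<in> T \<and> T \<subseteq> {p. \<not> P p}" by (intro exI[of _ N]) auto
  qed
  have "{p. P p} \<inter> UNIV = {} \<or> {p. \<not> P p} \<inter> UNIV = {}"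
    by (rule connectedD[OF conn 1 2]) auto
  then show False using \<open>P p0\<close> \<open>\<not> P p\<close> by auto
qed

context structure_tensor
begin

section \<open>Solutions of the homogeneous Hessian equation\<close>

definition solution :: "('a \<Rightarrow> real) \<Rightarrow> bool" where
  "solution f \<longleftrightarrow> f \<in> smooth_functions A \<and>
    (\<forall>c\<in>A. \<forall>p\<in>cdom c. \<forall>i j. hess g c f i j p = (\<Sum>m\<in>UNIV. D c p $ i $ j $ m * pd c m f p))"

lemma solution_pd_pd:
  assumes "solution f" "c \<in> A" "p \<in> cdom c"
  shows "pd c i (pd c j f) p = (\<Sum>m\<in>UNIV. (christoffel g c m i j p + D c p $ i $ j $ m) * pd c m f p)"
proof -
  have "hess g c f i j p = (\<Sum>m\<in>UNIV. D c p $ i $ j $ m * pd c m f p)"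
    using assms unfolding solution_def by blast
  then show ?thesis unfolding hess_def by (simp add: distrib_right sum.distrib)
qed

lemma grad_zero_chart_independent:
  assumes "f \<in> smooth_functions A" "c0 \<in> A" "p \<in> cdom c0" "\<And>i. pd c0 i f p = 0" "c \<in> A" "p \<in> cdom c"
  shows "pd c i f p = 0"
  using pd_transform[OF assms(5,2,6,3,1), of i] assms(4) by simp

text \<open>In a chart the Hessian equation is a linear first-order system for the components of the
  gradient, so the zeros of the gradient form an open set by uniqueness; by continuity they form a
  closed one. Quantifying over charts in \<open>?P\<close> makes this a property of the point
  alone.\<close>

lemma solution_grad_zero:
  assumes conn: "connected (UNIV :: 'a set)" and f: "solution f"
    and c0: "c0 \<in> A" "p0 \<in> cdom c0" "\<And>i. pd c0 i f p0 = 0" and c: "c \<in> A" "p \<in> cdom c"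
  shows "pd c i f p = 0"
proof -
  have sm: "f \<in> smooth_functions A" using f by (simp add: solution_def)
  let ?P = "\<lambda>p. \<forall>c\<in>A. p \<in> cdom c \<longrightarrow> (\<forall>i. pd c i f p = 0)"
  have "?P p"
  proof (rule connected_UNIV_all[OF conn, of ?P p0])
    show "?P p0" using grad_zero_chart_independent[OF sm c0(1,2) c0(3)] by blast
  next
    fix p assume p: "?P p"
    obtain c where c: "c \<in> A" "p \<in> cdom c" using ex_chart[of p] by (elim bexE)
    have "\<exists>N. open N \<and> p \<in> N \<and> (\<forall>q\<in>N. \<forall>b. pd c b f q = 0)"
    proof (rule linear_ode_unique_chart[OF c, where y = "\<lambda>b. pd c b f" and
          C = "\<lambda>i j m p. christoffel g c m i j p + D c p $ i $ j $ m"])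
      show "smooth_in_chart c (pd c b f)" for b using smooth_pd smooth_functions_chart[OF sm] c by blast
      show "smooth_in_chart c (\<lambda>p. christoffel g c m i j p + D c p $ i $ j $ m)" for i j m
        using c by (intro smooth_intros christoffel_smooth D_smooth)
      show "pd c b f p = 0" for b using p c by blast
    qed (rule solution_pd_pd[OF f c(1)])
    then obtain N where N: "open N" "p \<in> N" "\<forall>q\<in>N. \<forall>b. pd c b f q = 0" by blast
    have "open (N \<inter> cdom c)" using N chart_props c by (intro open_Int) auto
    moreover have "?P q" if "q \<in> N \<inter> cdom c" for q
      using grad_zero_chart_independent[OF sm c(1), of q] N(3) that by blast
    ultimately show "\<exists>N. open N \<and> p \<in> N \<and> (\<forall>q\<in>N. ?P q)" using N(2) c(2) by (intro exI[of _ "N \<inter> cdom c"]) blast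
  next
    fix p assume "\<not> ?P p"
    then obtain c i where c: "c \<in> A" "p \<in> cdom c" "pd c i f p \<noteq> 0" by blast
    have "open {q \<in> cdom c. pd c i f q \<noteq> 0}"
      by (rule open_nonzero[OF c(1) smooth_pd[OF c(1) smooth_functions_chart[OF sm c(1)]]])
    then show "\<exists>N. open N \<and> p \<in> N \<and> (\<forall>q\<in>N. \<not> ?P q)" using c by blast
  qed
  then show ?thesis using c by blast
qed

end

locale framed_structure = structure_tensor A g D
  for A :: "('a::topological_space, 'n::finite) chart set" and g D +
  fixes v :: "'n \<Rightarrow> 'a \<Rightarrow> real"
  assumes v_solution: "solution (v \<alpha>)"
    and v_frame: "c \<in> A \<Longrightarrow> p \<in> cdom c \<Longrightarrow> invertible (\<chi> \<alpha> i. pd c i (v \<alpha>) p)"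
begin

definition X :: "('a, 'n) chart \<Rightarrow> 'a \<Rightarrow> real^'n^'n" where
  "X c p = (\<chi> \<alpha> i. pd c i (v \<alpha>) p)"

definition Y :: "('a, 'n) chart \<Rightarrow> 'a \<Rightarrow> real^'n^'n" where
  "Y c p = matrix_inv (X c p)"

text \<open>The metric duals of the frame that is dual to \<open>dv\<^sub>\<alpha>\<close>.\<close>

definition \<Theta> :: "('a, 'n) chart \<Rightarrow> 'n \<Rightarrow> 'n \<Rightarrow> 'a \<Rightarrow> real" where
  "\<Theta> c \<alpha> j p = (\<Sum>i\<in>UNIV. Y c p $ i $ \<alpha> * G c p i j)"

lemma X_nth [simp]: "X c p $ \<alpha> $ i = pd c i (v \<alpha>) p"
  by (simp add: X_def)

lemma X_invertible: "c \<in> A \<Longrightarrow> p \<in> cdom c \<Longrightarrow> invertible (X c p)"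
  using v_frame by (simp add: X_def)

lemma v_smooth: "v \<alpha> \<in> smooth_functions A"
  using v_solution by (simp add: solution_def)

lemma v_pd_smooth: "c \<in> A \<Longrightarrow> smooth_in_chart c (pd c i (v \<alpha>))"
  using smooth_pd smooth_functions_chart[OF v_smooth] by blast

lemma Y_smooth: "c \<in> A \<Longrightarrow> smooth_in_chart c (\<lambda>p. Y c p $ i $ j)"
  unfolding Y_def by (rule smooth_matrix_inv) (auto simp: v_pd_smooth X_invertible)

lemma \<Theta>_smooth: "c \<in> A \<Longrightarrow> smooth_in_chart c (\<Theta> c \<alpha> j)"
  unfolding \<Theta>_def[abs_def] by (intro smooth_intros Y_smooth g_smooth)

lemma XY:
  assumes "c \<in> A" "p \<in> cdom c"
  shows "(\<Sum>i\<in>UNIV. pd c i (v \<alpha>) p * Y c p $ i $ \<beta>) = (if \<alpha> = \<beta> then 1 else 0)"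
    "(\<Sum>\<alpha>\<in>UNIV. Y c p $ i $ \<alpha> * pd c j (v \<alpha>) p) = (if i = j then 1 else 0)"
  using sum_matrix_inv[OF X_invertible[OF assms]] unfolding Y_def[symmetric] by simp_all

lemma X_\<Theta>:
  assumes "c \<in> A" "p \<in> cdom c"
  shows "(\<Sum>\<alpha>\<in>UNIV. pd c i (v \<alpha>) p * \<Theta> c \<alpha> j p) = G c p i j"
proof -
  have "(\<Sum>\<alpha>\<in>UNIV. pd c i (v \<alpha>) p * \<Theta> c \<alpha> j p) = (\<Sum>l\<in>UNIV. (\<Sum>\<alpha>\<in>UNIV. Y c p $ l $ \<alpha> * pd c i (v \<alpha>) p) * G c p l j)"
    unfolding \<Theta>_def sum_distrib_left sum_distrib_right by (subst sum.swap) (simp add: mult_ac)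
  also have "\<dots> = G c p i j" unfolding XY[OF assms] sum_if_eq ..
  finally show ?thesis .
qed

text \<open>Identities indexed by \<alpha> are proved by contracting them with the coframe and using
  \<open>X_\<Theta>\<close>. The derivative of the inverse matrix \<open>Y\<close> is thereby never
  computed.\<close>

lemma frame_zero:
  assumes "c \<in> A" "p \<in> cdom c" "\<And>i. (\<Sum>\<alpha>\<in>UNIV. pd c i (v \<alpha>) p * w \<alpha>) = 0"
  shows "w \<beta> = 0"
proof -
  have "(\<Sum>i\<in>UNIV. (\<Sum>\<alpha>\<in>UNIV. pd c i (v \<alpha>) p * w \<alpha>) * Y c p $ i $ \<beta>)
    = (\<Sum>\<alpha>\<in>UNIV. (\<Sum>i\<in>UNIV. pd c i (v \<alpha>) p * Y c p $ i $ \<beta>) * w \<alpha>)"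
    unfolding sum_distrib_left sum_distrib_right by (subst sum.swap) (simp add: mult_ac)
  also have "\<dots> = w \<beta>" unfolding XY[OF assms(1,2)] sum_if_eq ..
  finally show ?thesis unfolding assms(3) by simp
qed

lemma \<Theta>_nonzero:
  assumes "c \<in> A" "p \<in> cdom c" "\<And>\<alpha> j. s * \<Theta> c \<alpha> j p = 0"
  shows "s = 0"
proof (rule ccontr)
  assume "s \<noteq> 0"
  then have "\<Theta> c \<alpha> j p = 0" for \<alpha> j using assms(3) by simp
  then have "G c p i j = 0" for i j using X_\<Theta>[OF assms(1,2), of i j] by simp
  then show False using g_ginv(1)[OF assms(1,2), of undefined undefined] by simp
qed

lemma \<Theta>_law:
  assumes "c \<in> A" "c' \<in> A" "p \<in> cdom c" "p \<in> cdom c'"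
  shows "\<Theta> c \<alpha> j p = (\<Sum>b\<in>UNIV. jac c c' p b j * \<Theta> c' \<alpha> b p)"
proof -
  let ?J = "jac c c' p"
  have g_law: "G c p i j = (\<Sum>a\<in>UNIV. \<Sum>b\<in>UNIV. ?J a i * ?J b j * G c' p a b)" for i j
    using g_tensor assms unfolding tensor_field_02_def by blast
  have "\<Theta> c \<alpha> j p - (\<Sum>b\<in>UNIV. ?J b j * \<Theta> c' \<alpha> b p) = 0"
  proof (rule frame_zero[where w = "\<lambda>\<alpha>. \<Theta> c \<alpha> j p - (\<Sum>b\<in>UNIV. ?J b j * \<Theta> c' \<alpha> b p)", OF assms(1,3)])
    fix i
    have "(\<Sum>\<alpha>\<in>UNIV. pd c i (v \<alpha>) p * (\<Sum>b\<in>UNIV. ?J b j * \<Theta> c' \<alpha> b p))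
       = (\<Sum>\<alpha>\<in>UNIV. \<Sum>b\<in>UNIV. \<Sum>a\<in>UNIV. ?J a i * ?J b j * (pd c' a (v \<alpha>) p * \<Theta> c' \<alpha> b p))"
      unfolding pd_transform[OF assms v_smooth] sum_distrib_left sum_distrib_right by (simp add: mult_ac)
    also have "\<dots> = (\<Sum>a\<in>UNIV. \<Sum>b\<in>UNIV. \<Sum>\<alpha>\<in>UNIV. ?J a i * ?J b j * (pd c' a (v \<alpha>) p * \<Theta> c' \<alpha> b p))"
      by (subst sum.swap, subst (2) sum.swap, subst sum.swap, rule refl)
    also have "\<dots> = G c p i j"
      unfolding sum_distrib_left[symmetric] X_\<Theta>[OF assms(2,4)] g_law ..
    finally show "(\<Sum>\<alpha>\<in>UNIV. pd c i (v \<alpha>) p * (\<Theta> c \<alpha> j p - (\<Sum>b\<in>UNIV. ?J b j * \<Theta> c' \<alpha> b p))) = 0"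
      unfolding right_diff_distrib sum_subtractf X_\<Theta>[OF assms(1,3)] by simp
  qed
  then show ?thesis by simp
qed

text \<open>Obtained by differentiating g = \<Sum> dv \<otimes> \<Theta>, where the second
  derivatives of the \<open>v \<alpha>\<close> are replaced by first ones through the Hessian
  equation; contracting with \<open>\<Theta>\<close> once more gives back the metric.\<close>

lemma pd_\<Theta>:
  assumes "c \<in> A" "p \<in> cdom c"
  shows "(\<Sum>\<alpha>\<in>UNIV. pd c i (v \<alpha>) p * pd c k (\<Theta> c \<alpha> j) p) =
    pd c k (\<lambda>q. G c q i j) p - (\<Sum>m\<in>UNIV. christoffel g c m k i p * G c p m j) - L c p k i j"
proof -
  have "pd c k (\<lambda>q. G c q i j) p = pd c k (\<lambda>q. \<Sum>\<alpha>\<in>UNIV. pd c i (v \<alpha>) q * \<Theta> c \<alpha> j q) p"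
    by (rule pd_cong_cdom[OF assms]) (simp add: X_\<Theta>[OF assms(1)])
  also have "\<dots> = (\<Sum>\<alpha>\<in>UNIV. pd c k (pd c i (v \<alpha>)) p * \<Theta> c \<alpha> j p + pd c i (v \<alpha>) p * pd c k (\<Theta> c \<alpha> j) p)"
    using assms by (subst pd_sum) (auto simp: pd_mult v_pd_smooth \<Theta>_smooth smooth_mult)
  also have "\<dots> = (\<Sum>\<alpha>\<in>UNIV. pd c k (pd c i (v \<alpha>)) p * \<Theta> c \<alpha> j p) + (\<Sum>\<alpha>\<in>UNIV. pd c i (v \<alpha>) p * pd c k (\<Theta> c \<alpha> j) p)"
    by (simp add: sum.distrib)
  also have "(\<Sum>\<alpha>\<in>UNIV. pd c k (pd c i (v \<alpha>)) p * \<Theta> c \<alpha> j p) =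
      (\<Sum>m\<in>UNIV. (christoffel g c m k i p + D c p $ k $ i $ m) * (\<Sum>\<alpha>\<in>UNIV. pd c m (v \<alpha>) p * \<Theta> c \<alpha> j p))"
    unfolding solution_pd_pd[OF v_solution assms] sum_distrib_left sum_distrib_right
    by (subst sum.swap) (simp add: mult_ac)
  also have "\<dots> = (\<Sum>m\<in>UNIV. christoffel g c m k i p * G c p m j) + L c p k i j"
    unfolding X_\<Theta>[OF assms] by (simp add: distrib_right sum.distrib L_def)
  finally show ?thesis by simp
qed

text \<open>The exterior derivatives of the one-forms \<open>\<Theta>\<^sub>\<alpha>\<close> are the antisymmetric part of \<open>D\<close>.\<close>

lemma d_\<Theta>:
  assumes "c \<in> A" "p \<in> cdom c"
  shows "(\<Sum>\<alpha>\<in>UNIV. pd c i (v \<alpha>) p * (pd c k (\<Theta> c \<alpha> j) p - pd c j (\<Theta> c \<alpha> k) p)) = L c p i j k - L c p i k j"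
proof -
  have sy: "pd c l (\<lambda>q. G c q a b) p = pd c l (\<lambda>q. G c q b a) p" for l a b
    by (rule pd_cong_cdom[OF assms]) (use g_sym assms in auto)
  show ?thesis
    \<comment> \<open>Antisymmetrising in k and j cancels the derivatives of the metric against the
      lowered Christoffel symbols; only the two terms from \<open>D\<close> remain.\<close>
    unfolding right_diff_distrib sum_subtractf pd_\<Theta>[OF assms] christoffel_lowered[OF assms]
    using L_sym[OF assms, of k i j] L_sym[OF assms, of j i k] sy[of k i j] sy[of j i k] sy[of i k j]
    by (simp add: field_simps)
qed

subsection \<open>The obstruction to an additional potential\<close>

text \<open>The factor \<open>s\<close> is given chart by chart and is not known to be a scalar.
  What is needed, that its zeros do not depend on the chart, comes from du = s \<Theta> with global
  functions u.\<close>

lemma extra_solution_obstruction: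
  assumes conn: "connected (UNIV :: 'a set)" and n: "CARD('n) \<ge> 2"
    and U: "U \<in> smooth_functions A"
    and s: "\<And>c. c \<in> A \<Longrightarrow> smooth_in_chart c (s c)"
    and hess_U: "\<And>c i j p. c \<in> A \<Longrightarrow> p \<in> cdom c \<Longrightarrow>
      hess g c U i j p = (\<Sum>m\<in>UNIV. D c p $ i $ j $ m * pd c m U p) + s c p * G c p i j"
    and nonzero: "c0 \<in> A" "p0 \<in> cdom c0" "s c0 p0 \<noteq> 0"
    and c: "c \<in> A" "p \<in> cdom c"
  shows "obstruction_tensor g D c p = 0"
proof -
  \<comment> \<open>Choosing a chart at each point makes \<open>u\<close> a function on the whole
    manifold; \<open>u_eq\<close> then shows that any chart gives the same values, which yields
    smoothness.\<close>
  define cc where "cc p = (SOME c. c \<in> A \<and> p \<in> cdom c)" for p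
  have cc: "cc p \<in> A" "p \<in> cdom (cc p)" for p
    using someI_ex[of "\<lambda>c. c \<in> A \<and> p \<in> cdom c"] ex_chart[of p] unfolding cc_def by blast+
  define u where "u \<alpha> p = (\<Sum>i\<in>UNIV. Y (cc p) p $ i $ \<alpha> * pd (cc p) i U p)" for \<alpha> p
  have dU: "pd c i U p = (\<Sum>\<alpha>\<in>UNIV. pd c i (v \<alpha>) p * u \<alpha> p)" if c: "c \<in> A" "p \<in> cdom c" for c i p
  proof -
    have 1: "pd (cc p) i U p = (\<Sum>\<alpha>\<in>UNIV. pd (cc p) i (v \<alpha>) p * u \<alpha> p)" for i
    proof -
      have "(\<Sum>\<alpha>\<in>UNIV. pd (cc p) i (v \<alpha>) p * u \<alpha> p) =
        (\<Sum>l\<in>UNIV. (\<Sum>\<alpha>\<in>UNIV. Y (cc p) p $ l $ \<alpha> * pd (cc p) i (v \<alpha>) p) * pd (cc p) l U p)"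
        unfolding u_def sum_distrib_left sum_distrib_right by (subst sum.swap) (simp add: mult_ac)
      also have "\<dots> = pd (cc p) i U p" unfolding XY[OF cc] sum_if_eq ..
      finally show ?thesis by simp
    qed
    show ?thesis
      unfolding pd_transform[OF c(1) cc(1) c(2) cc(2) U] pd_transform[OF c(1) cc(1) c(2) cc(2) v_smooth] 1
        sum_distrib_left sum_distrib_right
      by (subst sum.swap) (simp add: mult_ac)
  qed
  have u_eq: "u \<alpha> p = (\<Sum>i\<in>UNIV. Y c p $ i $ \<alpha> * pd c i U p)" if c: "c \<in> A" "p \<in> cdom c" for c \<alpha> p
  proof -
    have "(\<Sum>i\<in>UNIV. Y c p $ i $ \<alpha> * pd c i U p) = (\<Sum>\<beta>\<in>UNIV. (\<Sum>i\<in>UNIV. pd c i (v \<beta>) p * Y c p $ i $ \<alpha>) * u \<beta> p)"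
      unfolding dU[OF c] sum_distrib_left sum_distrib_right by (subst sum.swap) (simp add: mult_ac)
    also have "\<dots> = u \<alpha> p" unfolding XY[OF c] sum_if_eq ..
    finally show ?thesis by simp
  qed
  have u_smooth_chart: "smooth_in_chart c (u \<alpha>)" if c: "c \<in> A" for c \<alpha>
  proof (rule smooth_in_chart_cong[OF c])
    show "smooth_in_chart c (\<lambda>p. \<Sum>i\<in>UNIV. Y c p $ i $ \<alpha> * pd c i U p)"
      using c U by (intro smooth_intros Y_smooth smooth_pd smooth_functions_chart)
  qed (use u_eq c in simp)
  then have u_smooth: "u \<alpha> \<in> smooth_functions A" for \<alpha> by (simp add: smooth_functions_def)
  have du: "pd c j (u \<alpha>) p = s c p * \<Theta> c \<alpha> j p" if c: "c \<in> A" "p \<in> cdom c" for c j \<alpha> p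
  proof -
    have "pd c j (u \<alpha>) p - s c p * \<Theta> c \<alpha> j p = 0"
    proof (rule frame_zero[where w = "\<lambda>\<alpha>. pd c j (u \<alpha>) p - s c p * \<Theta> c \<alpha> j p", OF c])
      fix i
      have "pd c j (pd c i U) p = pd c j (\<lambda>q. \<Sum>\<alpha>\<in>UNIV. pd c i (v \<alpha>) q * u \<alpha> q) p"
        by (rule pd_cong_cdom[OF c]) (simp add: dU c)
      also have "\<dots> = (\<Sum>\<alpha>\<in>UNIV. pd c j (pd c i (v \<alpha>)) p * u \<alpha> p + pd c i (v \<alpha>) p * pd c j (u \<alpha>) p)"
        using c by (subst pd_sum) (auto simp: pd_mult v_pd_smooth u_smooth_chart smooth_mult)
      also have "\<dots> = (\<Sum>\<alpha>\<in>UNIV. pd c j (pd c i (v \<alpha>)) p * u \<alpha> p) + (\<Sum>\<alpha>\<in>UNIV. pd c i (v \<alpha>) p * pd c j (u \<alpha>) p)"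
        by (simp add: sum.distrib)
      also have "(\<Sum>\<alpha>\<in>UNIV. pd c j (pd c i (v \<alpha>)) p * u \<alpha> p) =
          (\<Sum>m\<in>UNIV. (christoffel g c m j i p + D c p $ j $ i $ m) * (\<Sum>\<alpha>\<in>UNIV. pd c m (v \<alpha>) p * u \<alpha> p))"
        unfolding solution_pd_pd[OF v_solution c] sum_distrib_left sum_distrib_right
        by (subst sum.swap) (simp add: mult_ac)
      also have "\<dots> = (\<Sum>m\<in>UNIV. christoffel g c m j i p * pd c m U p) + (\<Sum>m\<in>UNIV. D c p $ j $ i $ m * pd c m U p)"
        unfolding dU[OF c, symmetric] by (simp add: distrib_right sum.distrib)
      finally have "(\<Sum>\<alpha>\<in>UNIV. pd c i (v \<alpha>) p * pd c j (u \<alpha>) p) = s c p * G c p i j"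
        using hess_U[OF c, of j i] g_sym[OF c, of i j] unfolding hess_def by simp
      moreover have "(\<Sum>\<alpha>\<in>UNIV. pd c i (v \<alpha>) p * (s c p * \<Theta> c \<alpha> j p)) = s c p * G c p i j"
        unfolding X_\<Theta>[OF c, symmetric] by (simp add: sum_distrib_left mult_ac)
      ultimately show "(\<Sum>\<alpha>\<in>UNIV. pd c i (v \<alpha>) p * (pd c j (u \<alpha>) p - s c p * \<Theta> c \<alpha> j p)) = 0"
        by (simp add: right_diff_distrib sum_subtractf)
    qed
    then show ?thesis by simp
  qed
  have eq: "s c p * (L c p i j k - L c p i k j) + pd c k (s c) p * G c p i j - pd c j (s c) p * G c p i k = 0"
    if c: "c \<in> A" "p \<in> cdom c" for c p i j k
  proof -
    \<comment> \<open>Symmetry of the second derivatives of \<open>u \<alpha>\<close> says that s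
      \<Theta> is closed; contraction with the coframe expresses this through
      \<open>L\<close>.\<close>
    have pp: "pd c k (pd c j (u \<alpha>)) p = pd c k (s c) p * \<Theta> c \<alpha> j p + s c p * pd c k (\<Theta> c \<alpha> j) p" for \<alpha> j k
    proof -
      have "pd c k (pd c j (u \<alpha>)) p = pd c k (\<lambda>q. s c q * \<Theta> c \<alpha> j q) p"
        by (rule pd_cong_cdom[OF c]) (simp add: du c)
      then show ?thesis using c by (simp add: pd_mult s \<Theta>_smooth)
    qed
    have "s c p * (pd c k (\<Theta> c \<alpha> j) p - pd c j (\<Theta> c \<alpha> k) p) = pd c j (s c) p * \<Theta> c \<alpha> k p - pd c k (s c) p * \<Theta> c \<alpha> j p" for \<alpha>
      using pd_commute[OF c u_smooth_chart[OF c(1)], of k j \<alpha>] unfolding pp by (simp add: algebra_simps)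
    then have "(\<Sum>\<alpha>\<in>UNIV. pd c i (v \<alpha>) p * (s c p * (pd c k (\<Theta> c \<alpha> j) p - pd c j (\<Theta> c \<alpha> k) p))) =
       (\<Sum>\<alpha>\<in>UNIV. pd c i (v \<alpha>) p * (pd c j (s c) p * \<Theta> c \<alpha> k p - pd c k (s c) p * \<Theta> c \<alpha> j p))"
      by (simp only:)
    also have "\<dots> = pd c j (s c) p * G c p i k - pd c k (s c) p * G c p i j"
      unfolding X_\<Theta>[OF c, symmetric] right_diff_distrib sum_subtractf by (simp add: sum_distrib_left mult_ac)
    also have "(\<Sum>\<alpha>\<in>UNIV. pd c i (v \<alpha>) p * (s c p * (pd c k (\<Theta> c \<alpha> j) p - pd c j (\<Theta> c \<alpha> k) p)))
       = s c p * (L c p i j k - L c p i k j)"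
      unfolding d_\<Theta>[OF c, symmetric] sum_distrib_left by (simp add: mult_ac)
    finally show ?thesis by simp
  qed
  have ds: "pd c j (s c) p = \<mu> c j p * s c p" if c: "c \<in> A" "p \<in> cdom c" for c j p
    using contraction[OF c, of "s c p" "\<lambda>k. pd c k (s c) p" j] eq[OF c] n unfolding \<mu>_def
    by (simp add: field_simps)
  let ?P = "\<lambda>p. \<forall>c\<in>A. p \<in> cdom c \<longrightarrow> s c p = 0"
  have indep: "?P p" if c: "c \<in> A" "p \<in> cdom c" "s c p = 0" for c p
  proof (intro ballI impI)
    fix c' assume c': "c' \<in> A" "p \<in> cdom c'"
    have z: "pd c i (u \<alpha>) p = 0" for i \<alpha> unfolding du[OF c(1,2)] c(3) by simp
    have "pd c' j (u \<alpha>) p = 0" for j \<alpha>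
      by (rule grad_zero_chart_independent[OF u_smooth c(1,2) z c'])
    then show "s c' p = 0" unfolding du[OF c'] by (rule \<Theta>_nonzero[OF c'])
  qed
  \<comment> \<open>A zero would spread: the equation for ds makes the zero set open, continuity
    makes it closed, and it would reach \<open>p0\<close>.\<close>
  have never: "s c p \<noteq> 0" if c: "c \<in> A" "p \<in> cdom c" for c p
  proof
    assume 0: "s c p = 0"
    have "?P p0"
    proof (rule connected_UNIV_all[OF conn, of ?P p])
      show "?P p" by (rule indep[OF c 0])
    next
      fix p assume p: "?P p"
      obtain c where c: "c \<in> A" "p \<in> cdom c" using ex_chart[of p] by (elim bexE)
      have scp: "s c p = 0" using p c by (elim ballE impE) auto
      \<comment> \<open>The index type \<open>unit\<close> presents the scalar equation as a system
        with one component.\<close>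
      have "\<exists>N. open N \<and> p \<in> N \<and> (\<forall>q\<in>N. \<forall>b::unit. s c q = 0)"
      proof (rule linear_ode_unique_chart[OF c, where y = "\<lambda>b. s c" and C = "\<lambda>i j m p. \<mu> c i p"])
        show "pd c i (s c) q = (\<Sum>d\<in>(UNIV :: unit set). \<mu> c i q * s c q)" if "q \<in> cdom c" for i q
          using ds[OF c(1) that] by simp
        show "s c p = 0" by (rule scp)
      qed (rule s[OF c(1)], rule \<mu>_smooth[OF c(1)])
      then obtain N where N: "open N" "p \<in> N" "\<forall>q\<in>N. s c q = 0" by blast
      have "open (N \<inter> cdom c)" using N chart_props c by (intro open_Int) auto
      moreover have "?P q" if "q \<in> N \<inter> cdom c" for q
        using indep[OF c(1), of q] N(3) that by blast
      ultimately show "\<exists>N. open N \<and> p \<in> N \<and> (\<forall>q\<in>N. ?P q)" using N(2) c(2) by (intro exI[of _ "N \<inter> cdom c"]) blast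
    next
      fix p assume "\<not> ?P p"
      then obtain c where c: "c \<in> A" "p \<in> cdom c" "s c p \<noteq> 0" by blast
      have "open {q \<in> cdom c. s c q \<noteq> 0}" by (rule open_nonzero[OF c(1) s[OF c(1)]])
      then show "\<exists>N. open N \<and> p \<in> N \<and> (\<forall>q\<in>N. \<not> ?P q)" using c by blast
    qed
    then show False using nonzero by blast
  qed
  show ?thesis
    unfolding obstruction_tensor_zero_iff[OF c]
  proof (intro allI)
    fix i j k
    have "s c p * (L c p i j k - L c p i k j + \<mu> c k p * G c p i j - \<mu> c j p * G c p i k) = 0"
      using eq[OF c, of i j k] unfolding ds[OF c] by (simp add: algebra_simps)
    then show "L c p i j k - L c p i k j + \<mu> c k p * G c p i j - \<mu> c j p * G c p i k = 0"
      using never[OF c] by simp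
  qed
qed

subsection \<open>Construction of an additional potential\<close>

lemma d_\<Theta>_unobstructed:
  assumes "obstruction_tensor g D c p = 0" "c \<in> A" "p \<in> cdom c"
  shows "pd c k (\<Theta> c \<alpha> j) p - pd c j (\<Theta> c \<alpha> k) p = \<mu> c j p * \<Theta> c \<alpha> k p - \<mu> c k p * \<Theta> c \<alpha> j p"
proof -
  have B: "L c p i j k - L c p i k j + \<mu> c k p * G c p i j - \<mu> c j p * G c p i k = 0" for i
    using assms unfolding obstruction_tensor_zero_iff[OF assms(2,3)] by blast
  have "(pd c k (\<Theta> c \<alpha> j) p - pd c j (\<Theta> c \<alpha> k) p) - (\<mu> c j p * \<Theta> c \<alpha> k p - \<mu> c k p * \<Theta> c \<alpha> j p) = 0"
  proof (rule frame_zero[where w = "\<lambda>\<alpha>. (pd c k (\<Theta> c \<alpha> j) p - pd c j (\<Theta> c \<alpha> k) p) - (\<mu> c j p * \<Theta> c \<alpha> k p - \<mu> c k p * \<Theta> c \<alpha> j p)", OF assms(2,3)])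
    fix i
    have "(\<Sum>\<alpha>\<in>UNIV. pd c i (v \<alpha>) p * (\<mu> c j p * \<Theta> c \<alpha> k p - \<mu> c k p * \<Theta> c \<alpha> j p)) = \<mu> c j p * G c p i k - \<mu> c k p * G c p i j"
      unfolding X_\<Theta>[OF assms(2,3), symmetric] right_diff_distrib sum_subtractf by (simp add: sum_distrib_left mult_ac)
    then show "(\<Sum>\<alpha>\<in>UNIV. pd c i (v \<alpha>) p * ((pd c k (\<Theta> c \<alpha> j) p - pd c j (\<Theta> c \<alpha> k) p) - (\<mu> c j p * \<Theta> c \<alpha> k p - \<mu> c k p * \<Theta> c \<alpha> j p))) = 0"
      using d_\<Theta>[OF assms(2,3), of i k j] B[of i]
      by (simp add: right_diff_distrib[of "pd c i _ p" "_ - _" "_ - _"] sum_subtractf)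
  qed
  then show ?thesis by simp
qed

text \<open>From \<open>d\<Theta> = -\<mu> \<and> \<Theta>\<close> one gets \<open>d\<mu> \<and> \<Theta> = 0\<close>, and the \<open>\<Theta>\<^sub>\<alpha>\<close> span the cotangent space.\<close>

lemma \<mu>_closed:
  assumes n: "CARD('n) \<ge> 3" and N: "\<And>c p. c \<in> A \<Longrightarrow> p \<in> cdom c \<Longrightarrow> obstruction_tensor g D c p = 0"
    and c: "c \<in> A" "p \<in> cdom c"
  shows "pd c l (\<mu> c j) p = pd c j (\<mu> c l) p"
proof -
  define C where "C l j = pd c l (\<mu> c j) p - pd c j (\<mu> c l) p" for l j
  have cyc: "C l j * \<Theta> c \<alpha> k p + C j k * \<Theta> c \<alpha> l p + C k l * \<Theta> c \<alpha> j p = 0" for \<alpha> j k l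
  proof -
    let ?\<theta> = "\<lambda>k. \<Theta> c \<alpha> k p" and ?m = "\<lambda>j. \<mu> c j p" and ?P = "\<lambda>l k. pd c l (\<Theta> c \<alpha> k) p"
    let ?T = "\<lambda>l k j. pd c l (pd c k (\<Theta> c \<alpha> j)) p" and ?M = "\<lambda>l j. pd c l (\<mu> c j) p"
    have E: "?T l k j - ?T l j k = (?M l j * ?\<theta> k + ?m j * ?P l k) - (?M l k * ?\<theta> j + ?m k * ?P l j)" for l j k
    proof -
      have "?T l k j - ?T l j k = pd c l (\<lambda>q. pd c k (\<Theta> c \<alpha> j) q - pd c j (\<Theta> c \<alpha> k) q) p"
        using c by (simp add: pd_diff smooth_pd \<Theta>_smooth)
      also have "\<dots> = pd c l (\<lambda>q. \<mu> c j q * \<Theta> c \<alpha> k q - \<mu> c k q * \<Theta> c \<alpha> j q) p"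
        by (rule pd_cong_cdom[OF c]) (simp add: d_\<Theta>_unobstructed N c)
      also have "\<dots> = (?M l j * ?\<theta> k + ?m j * ?P l k) - (?M l k * ?\<theta> j + ?m k * ?P l j)"
        using c by (simp add: pd_diff pd_mult smooth_mult \<mu>_smooth \<Theta>_smooth)
      finally show ?thesis .
    qed
    have T: "?T l k j = ?T k l j" for l k j by (rule pd_commute[OF c \<Theta>_smooth[OF c(1)]])
    have P: "?m a * (?P k j - ?P j k) = ?m a * (?m j * ?\<theta> k - ?m k * ?\<theta> j)" for a j k
      using d_\<Theta>_unobstructed[OF N[OF c] c, of k \<alpha> j] by simp
    \<comment> \<open>The identity dd\<Theta> = 0 in components.\<close>
    have "(?T l k j - ?T l j k) + (?T j l k - ?T j k l) + (?T k j l - ?T k l j) = 0"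
      using T[of l k j] T[of l j k] T[of j k l] by simp
    then have "(?M l j * ?\<theta> k + ?m j * ?P l k) - (?M l k * ?\<theta> j + ?m k * ?P l j) +
       ((?M j k * ?\<theta> l + ?m k * ?P j l) - (?M j l * ?\<theta> k + ?m l * ?P j k)) +
       ((?M k l * ?\<theta> j + ?m l * ?P k j) - (?M k j * ?\<theta> l + ?m j * ?P k l)) = 0"
      unfolding E .
    \<comment> \<open>The terms in which \<mu> is not differentiated form \<mu> \<and> d\<Theta>, a
      multiple of \<mu> \<and> \<mu> \<and> \<Theta>, and cancel.\<close>
    moreover have "?m j * ?P l k - ?m j * ?P k l + (?m k * ?P j l - ?m k * ?P l j) + (?m l * ?P k j - ?m l * ?P j k) = 0"
      using P[of j l k] P[of k j l] P[of l k j] by (simp add: right_diff_distrib mult_ac)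
    ultimately show ?thesis unfolding C_def by (simp add: left_diff_distrib)
  qed
  have cycG: "C l j * G c p i k + C j k * G c p i l + C k l * G c p i j = 0" for i j k l
  proof -
    have "C l j * G c p i k + C j k * G c p i l + C k l * G c p i j
      = (\<Sum>\<alpha>\<in>UNIV. pd c i (v \<alpha>) p * (C l j * \<Theta> c \<alpha> k p + C j k * \<Theta> c \<alpha> l p + C k l * \<Theta> c \<alpha> j p))"
      unfolding X_\<Theta>[OF c, symmetric] by (simp add: sum_distrib_left distrib_left sum.distrib mult_ac)
    then show ?thesis unfolding cyc by simp
  qed
  \<comment> \<open>The trace leaves n C + 2 C with transposed indices in the second term, that is
    (n - 2) C.\<close>
  have "0 = (\<Sum>k\<in>UNIV. \<Sum>i\<in>UNIV. GI c p k i * (C l j * G c p i k + C j k * G c p i l + C k l * G c p i j))"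
    unfolding cycG by simp
  also have "\<dots> = (\<Sum>k\<in>UNIV. (\<Sum>i\<in>UNIV. GI c p k i * G c p i k) * C l j) +
     (\<Sum>k\<in>UNIV. (\<Sum>i\<in>UNIV. GI c p k i * G c p i l) * C j k) + (\<Sum>k\<in>UNIV. (\<Sum>i\<in>UNIV. GI c p k i * G c p i j) * C k l)"
    by (simp add: sum_distrib_left sum_distrib_right sum.distrib distrib_left mult_ac)
  also have "\<dots> = real CARD('n) * C l j + C j l + C j l"
    unfolding g_ginv[OF c] sum_if_eq by simp
  finally have "(real CARD('n) - 2) * C l j = 0" unfolding C_def by (simp add: algebra_simps)
  then show ?thesis using n unfolding C_def by simp
qed

text \<open>Three closed forms are integrated in turn. Closedness of the second reflects that
  d\<sigma> = \<sigma> \<mu> compensates d\<Theta> = -\<mu> \<and> \<Theta>; that of the third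
  reflects the symmetry of g, since \<Sum> du \<and> dv = \<sigma> \<Sum> \<Theta> \<and>
  dv.\<close>

lemma extra_solution_exists:
  assumes sc: "simply_connected (UNIV :: 'a set)" and n: "CARD('n) \<ge> 3"
    and N: "\<And>c p. c \<in> A \<Longrightarrow> p \<in> cdom c \<Longrightarrow> obstruction_tensor g D c p = 0"
  obtains U \<sigma> u where "U \<in> smooth_functions A" "\<And>p. \<sigma> p > 0" "\<And>\<alpha>. u \<alpha> \<in> smooth_functions A"
    "\<And>c \<alpha> j p. c \<in> A \<Longrightarrow> p \<in> cdom c \<Longrightarrow> pd c j (u \<alpha>) p = \<sigma> p * \<Theta> c \<alpha> j p"
    "\<And>c i p. c \<in> A \<Longrightarrow> p \<in> cdom c \<Longrightarrow> pd c i U p = (\<Sum>\<alpha>\<in>UNIV. u \<alpha> p * pd c i (v \<alpha>) p)"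
    "\<And>c i j p. c \<in> A \<Longrightarrow> p \<in> cdom c \<Longrightarrow>
      hess g c U i j p = (\<Sum>m\<in>UNIV. D c p $ i $ j $ m * pd c m U p) + \<sigma> p * G c p i j"
proof -
  obtain \<phi> where \<phi>: "\<phi> \<in> smooth_functions A" "\<And>c i p. c \<in> A \<Longrightarrow> p \<in> cdom c \<Longrightarrow> pd c i \<phi> p = \<mu> c i p"
    by (rule closed_form_exact[OF sc, of \<mu>]) (use \<mu>_smooth \<mu>_law \<mu>_closed[OF n N] in blast)+
  \<comment> \<open>The exponential turns the additive primitive of \<mu> into a solution of
    d\<sigma> = \<sigma> \<mu>, and its positivity later keeps \<open>U\<close> out of the old
    space.\<close>
  define \<sigma> where "\<sigma> p = exp (\<phi> p)" for p
  have \<sigma>_smooth: "smooth_in_chart c \<sigma>" if "c \<in> A" for c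
    unfolding \<sigma>_def[abs_def] using that \<phi>(1) by (intro smooth_exp smooth_functions_chart)
  have d\<sigma>: "pd c i \<sigma> p = \<sigma> p * \<mu> c i p" if "c \<in> A" "p \<in> cdom c" for c i p
    unfolding \<sigma>_def[abs_def] using that \<phi> by (simp add: pd_exp smooth_functions_chart)
  have "\<exists>u. u \<in> smooth_functions A \<and> (\<forall>c\<in>A. \<forall>p\<in>cdom c. \<forall>j. pd c j u p = \<sigma> p * \<Theta> c \<alpha> j p)" for \<alpha>
  proof -
    obtain F where "F \<in> smooth_functions A" "\<And>c i p. c \<in> A \<Longrightarrow> p \<in> cdom c \<Longrightarrow> pd c i F p = \<sigma> p * \<Theta> c \<alpha> i p"
    proof (rule closed_form_exact[OF sc, of "\<lambda>c j p. \<sigma> p * \<Theta> c \<alpha> j p"])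
      show "smooth_in_chart c (\<lambda>p. \<sigma> p * \<Theta> c \<alpha> i p)" if "c \<in> A" for c i
        using that by (intro smooth_mult \<sigma>_smooth \<Theta>_smooth)
      show "\<sigma> p * \<Theta> c \<alpha> j p = (\<Sum>i\<in>UNIV. jac c c' p i j * (\<sigma> p * \<Theta> c' \<alpha> i p))"
        if "c \<in> A" "c' \<in> A" "p \<in> cdom c" "p \<in> cdom c'" for c c' p j
        unfolding \<Theta>_law[OF that] by (simp add: sum_distrib_left mult_ac)
      fix c i j p assume c: "c \<in> A" "p \<in> cdom c"
      have 1: "pd c i (\<lambda>p. \<sigma> p * \<Theta> c \<alpha> j p) p = \<sigma> p * (\<mu> c i p * \<Theta> c \<alpha> j p + pd c i (\<Theta> c \<alpha> j) p)" for i j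
        using c by (simp add: pd_mult \<sigma>_smooth \<Theta>_smooth d\<sigma> algebra_simps)
      have "\<mu> c i p * \<Theta> c \<alpha> j p + pd c i (\<Theta> c \<alpha> j) p = \<mu> c j p * \<Theta> c \<alpha> i p + pd c j (\<Theta> c \<alpha> i) p"
        using d_\<Theta>_unobstructed[OF N[OF c] c, of i \<alpha> j] by simp
      then show "pd c i (\<lambda>p. \<sigma> p * \<Theta> c \<alpha> j p) p = pd c j (\<lambda>p. \<sigma> p * \<Theta> c \<alpha> i p) p"
        unfolding 1 by simp
    qed blast
    then show ?thesis by blast
  qed
  then obtain u where u: "\<And>\<alpha>. u \<alpha> \<in> smooth_functions A"
    "\<And>c \<alpha> j p. c \<in> A \<Longrightarrow> p \<in> cdom c \<Longrightarrow> pd c j (u \<alpha>) p = \<sigma> p * \<Theta> c \<alpha> j p"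
    by metis
  have pp: "pd c i (\<lambda>q. \<Sum>\<alpha>\<in>UNIV. u \<alpha> q * pd c j (v \<alpha>) q) p = \<sigma> p * G c p i j + (\<Sum>\<alpha>\<in>UNIV. u \<alpha> p * pd c i (pd c j (v \<alpha>)) p)"
    if c: "c \<in> A" "p \<in> cdom c" for c i j p
  proof -
    have "pd c i (\<lambda>q. \<Sum>\<alpha>\<in>UNIV. u \<alpha> q * pd c j (v \<alpha>) q) p
      = (\<Sum>\<alpha>\<in>UNIV. pd c i (u \<alpha>) p * pd c j (v \<alpha>) p + u \<alpha> p * pd c i (pd c j (v \<alpha>)) p)"
      using c u(1) by (subst pd_sum) (auto simp: pd_mult v_pd_smooth smooth_functions_chart smooth_mult)
    also have "\<dots> = \<sigma> p * (\<Sum>\<alpha>\<in>UNIV. pd c j (v \<alpha>) p * \<Theta> c \<alpha> i p) + (\<Sum>\<alpha>\<in>UNIV. u \<alpha> p * pd c i (pd c j (v \<alpha>)) p)"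
      unfolding u(2)[OF c] by (simp add: sum.distrib sum_distrib_left mult_ac)
    finally show ?thesis unfolding X_\<Theta>[OF c] g_sym[OF c, of j i] .
  qed
  obtain U where U: "U \<in> smooth_functions A" "\<And>c i p. c \<in> A \<Longrightarrow> p \<in> cdom c \<Longrightarrow> pd c i U p = (\<Sum>\<alpha>\<in>UNIV. u \<alpha> p * pd c i (v \<alpha>) p)"
  proof (rule closed_form_exact[OF sc, of "\<lambda>c i p. \<Sum>\<alpha>\<in>UNIV. u \<alpha> p * pd c i (v \<alpha>) p"])
    show "smooth_in_chart c (\<lambda>p. \<Sum>\<alpha>\<in>UNIV. u \<alpha> p * pd c i (v \<alpha>) p)" if "c \<in> A" for c i
      using that u(1) by (intro smooth_intros v_pd_smooth smooth_functions_chart)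
    show "(\<Sum>\<alpha>\<in>UNIV. u \<alpha> p * pd c j (v \<alpha>) p) = (\<Sum>i\<in>UNIV. jac c c' p i j * (\<Sum>\<alpha>\<in>UNIV. u \<alpha> p * pd c' i (v \<alpha>) p))"
      if "c \<in> A" "c' \<in> A" "p \<in> cdom c" "p \<in> cdom c'" for c c' p j
      unfolding pd_transform[OF that v_smooth] sum_distrib_left by (subst sum.swap) (simp add: mult_ac)
    show "pd c i (\<lambda>p. \<Sum>\<alpha>\<in>UNIV. u \<alpha> p * pd c j (v \<alpha>) p) p = pd c j (\<lambda>p. \<Sum>\<alpha>\<in>UNIV. u \<alpha> p * pd c i (v \<alpha>) p) p"
      if c: "c \<in> A" "p \<in> cdom c" for c i j p
      unfolding pp[OF c] g_sym[OF c, of i j]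
      using pd_commute[OF c smooth_functions_chart[OF v_smooth c(1)], of i j] by simp
  qed blast
  have "hess g c U i j p = (\<Sum>m\<in>UNIV. D c p $ i $ j $ m * pd c m U p) + \<sigma> p * G c p i j"
    if c: "c \<in> A" "p \<in> cdom c" for c i j p
  proof -
    have "pd c i (pd c j U) p = pd c i (\<lambda>q. \<Sum>\<alpha>\<in>UNIV. u \<alpha> q * pd c j (v \<alpha>) q) p"
      by (rule pd_cong_cdom[OF c]) (simp add: U(2) c)
    also have "\<dots> = \<sigma> p * G c p i j + (\<Sum>m\<in>UNIV. (christoffel g c m i j p + D c p $ i $ j $ m) * (\<Sum>\<alpha>\<in>UNIV. u \<alpha> p * pd c m (v \<alpha>) p))"
      unfolding pp[OF c] solution_pd_pd[OF v_solution c] sum_distrib_left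
      by (subst sum.swap) (simp add: mult_ac)
    also have "\<dots> = \<sigma> p * G c p i j + (\<Sum>m\<in>UNIV. christoffel g c m i j p * pd c m U p) + (\<Sum>m\<in>UNIV. D c p $ i $ j $ m * pd c m U p)"
      unfolding U(2)[OF c, symmetric] by (simp add: distrib_right sum.distrib)
    finally show ?thesis unfolding hess_def by simp
  qed
  moreover have "\<sigma> p > 0" for p by (simp add: \<sigma>_def)
  ultimately show ?thesis using that[OF U(1) _ u U(2)] by blast
qed

text \<open>Since K dU = \<Sum> u K dv and every K dv is closed, d(K dU) reduces to \<sigma> \<Sum>
  \<Theta> \<and> K dv. Its components are the differences of K_ij and K_ji.\<close>

lemma extra_solution_bertrand_darboux:
  assumes K: "killing_tensor A g K" and BD: "\<And>\<alpha>. bertrand_darboux A g K (v \<alpha>)"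
    and u: "\<And>\<alpha>. u \<alpha> \<in> smooth_functions A"
    "\<And>c \<alpha> j p. c \<in> A \<Longrightarrow> p \<in> cdom c \<Longrightarrow> pd c j (u \<alpha>) p = \<sigma> p * \<Theta> c \<alpha> j p"
    and U: "\<And>c i p. c \<in> A \<Longrightarrow> p \<in> cdom c \<Longrightarrow> pd c i U p = (\<Sum>\<alpha>\<in>UNIV. u \<alpha> p * pd c i (v \<alpha>) p)"
  shows "bertrand_darboux A g K U"
  unfolding bertrand_darboux_def
proof (intro ballI allI)
  fix c p i j assume c: "c \<in> A" "p \<in> cdom c"
  have Kt: "tensor_field_02 A K" using K by (simp add: killing_tensor_def)
  have K_sym: "K c p $ i $ j = K c p $ j $ i" for i j
  proof -
    have "transpose (K c p) = K c p" using K c by (simp add: killing_tensor_def)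
    then have "transpose (K c p) $ i $ j = K c p $ i $ j" by simp
    then show ?thesis by (simp add: transpose_def)
  qed
  have KdU: "K_dV g K U c j q = (\<Sum>\<alpha>\<in>UNIV. u \<alpha> q * K_dV g K (v \<alpha>) c j q)" if "q \<in> cdom c" for j q
    unfolding K_dV_def U[OF c(1) that] sum_distrib_left by (subst sum.swap) (simp add: mult_ac)
  have \<Theta>K: "(\<Sum>\<alpha>\<in>UNIV. \<Theta> c \<alpha> i p * K_dV g K (v \<alpha>) c j p) = K c p $ j $ i" for i j
  proof -
    have "(\<Sum>\<alpha>\<in>UNIV. \<Theta> c \<alpha> i p * K_dV g K (v \<alpha>) c j p) = (\<Sum>a\<in>UNIV. mixed g K c p $ j $ a * (\<Sum>\<alpha>\<in>UNIV. pd c a (v \<alpha>) p * \<Theta> c \<alpha> i p))"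
      unfolding K_dV_def sum_distrib_left by (subst sum.swap) (simp add: mult_ac)
    also have "\<dots> = (\<Sum>b\<in>UNIV. K c p $ j $ b * (\<Sum>a\<in>UNIV. GI c p b a * G c p a i))"
      unfolding X_\<Theta>[OF c] mixed_def by (simp add: sum_distrib_left sum_distrib_right, subst sum.swap) (simp add: mult_ac)
    also have "\<dots> = K c p $ j $ i" unfolding g_ginv[OF c] sum_if_eq ..
    finally show ?thesis .
  qed
  have "pd c i (K_dV g K U c j) p = \<sigma> p * K c p $ j $ i + (\<Sum>\<alpha>\<in>UNIV. u \<alpha> p * pd c i (K_dV g K (v \<alpha>) c j) p)" for i j
  proof -
    have "pd c i (K_dV g K U c j) p = pd c i (\<lambda>q. \<Sum>\<alpha>\<in>UNIV. u \<alpha> q * K_dV g K (v \<alpha>) c j q) p"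
      by (rule pd_cong_cdom[OF c]) (rule KdU)
    also have "\<dots> = (\<Sum>\<alpha>\<in>UNIV. pd c i (u \<alpha>) p * K_dV g K (v \<alpha>) c j p + u \<alpha> p * pd c i (K_dV g K (v \<alpha>) c j) p)"
      using c u(1) K_dV_smooth[OF Kt v_smooth c(1)]
      by (subst pd_sum) (auto simp: pd_mult smooth_functions_chart smooth_mult)
    also have "\<dots> = \<sigma> p * (\<Sum>\<alpha>\<in>UNIV. \<Theta> c \<alpha> i p * K_dV g K (v \<alpha>) c j p) + (\<Sum>\<alpha>\<in>UNIV. u \<alpha> p * pd c i (K_dV g K (v \<alpha>) c j) p)"
      unfolding u(2)[OF c] by (simp add: sum.distrib sum_distrib_left mult_ac)
    finally show ?thesis unfolding \<Theta>K .
  qed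
  moreover have "pd c i (K_dV g K (v \<alpha>) c j) p = pd c j (K_dV g K (v \<alpha>) c i) p" for \<alpha>
    using BD[of \<alpha>] c unfolding bertrand_darboux_def by simp
  ultimately show "pd c i (K_dV g K U c j) p - pd c j (K_dV g K U c i) p = 0"
    using K_sym[of i j] by simp
qed

end


section \<open>Spaces of potentials\<close>

lemma sum_fun_apply: "(\<Sum>k\<in>I. f k) p = (\<Sum>k\<in>I. f k p)" for f :: "'k \<Rightarrow> 'b \<Rightarrow> real"
  by (induction I rule: infinite_finite_induct) auto

context structure_tensor
begin

section \<open>Linear combinations of potentials\<close>

lemma pd_lincomb:
  assumes "c \<in> A" "p \<in> cdom c" "f \<in> smooth_functions A" "h \<in> smooth_functions A"
  shows "pd c i (a *\<^sub>R f + b *\<^sub>R h) p = a * pd c i f p + b * pd c i h p"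
proof -
  have "a *\<^sub>R f + b *\<^sub>R h = (\<lambda>p. a * f p + b * h p)" by (simp add: fun_eq_iff)
  then show ?thesis using assms by (simp add: pd_add pd_cmult smooth_cmult smooth_functions_chart)
qed

lemma smooth_lincomb:
  assumes "f \<in> smooth_functions A" "h \<in> smooth_functions A"
  shows "a *\<^sub>R f + b *\<^sub>R h \<in> smooth_functions A"
proof -
  have "a *\<^sub>R f + b *\<^sub>R h = (\<lambda>p. a * f p + b * h p)" by (simp add: fun_eq_iff)
  then show ?thesis using assms by (auto simp: smooth_functions_def intro!: smooth_add smooth_cmult)
qed

lemma hess_lincomb:
  assumes "c \<in> A" "p \<in> cdom c" "f \<in> smooth_functions A" "h \<in> smooth_functions A"
  shows "hess g c (a *\<^sub>R f + b *\<^sub>R h) i j p = a * hess g c f i j p + b * hess g c h i j p"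
proof -
  have "pd c i (pd c j (a *\<^sub>R f + b *\<^sub>R h)) p = pd c i (\<lambda>q. a * pd c j f q + b * pd c j h q) p"
    by (rule pd_cong_cdom[OF assms(1,2)]) (simp add: pd_lincomb assms)
  also have "\<dots> = a * pd c i (pd c j f) p + b * pd c i (pd c j h) p"
    using assms by (simp add: pd_add pd_cmult smooth_cmult smooth_pd smooth_functions_chart)
  finally show ?thesis
    unfolding hess_def pd_lincomb[OF assms]
    by (simp add: right_diff_distrib distrib_left sum.distrib sum_distrib_left mult_ac)
qed

lemma solution_lincomb:
  assumes "solution f" "solution h"
  shows "solution (a *\<^sub>R f + b *\<^sub>R h)"
proof -
  have f: "f \<in> smooth_functions A" and h: "h \<in> smooth_functions A" using assms by (auto simp: solution_def)
  have "hess g c (a *\<^sub>R f + b *\<^sub>R h) i j p = (\<Sum>m\<in>UNIV. D c p $ i $ j $ m * pd c m (a *\<^sub>R f + b *\<^sub>R h) p)"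
    if c: "c \<in> A" "p \<in> cdom c" for c p i j
  proof -
    have "hess g c f i j p = (\<Sum>m\<in>UNIV. D c p $ i $ j $ m * pd c m f p)"
      "hess g c h i j p = (\<Sum>m\<in>UNIV. D c p $ i $ j $ m * pd c m h p)"
      using assms c unfolding solution_def by blast+
    then show ?thesis unfolding hess_lincomb[OF c f h] pd_lincomb[OF c f h]
      by (simp add: distrib_left sum.distrib sum_distrib_left mult_ac)
  qed
  then show ?thesis unfolding solution_def using smooth_lincomb[OF f h] by blast
qed

text \<open>The difference is a solution with vanishing gradient at one point, hence everywhere, so
  it is constant.\<close>

lemma solution_eqI:
  assumes conn: "connected (UNIV :: 'a set)" and f: "solution f" and h: "solution h"
    and c: "c \<in> A" "p \<in> cdom c" and eq: "f p = h p" "\<And>i. pd c i f p = pd c i h p"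
  shows "f = h"
proof
  fix q
  define e where "e = 1 *\<^sub>R f + (-1) *\<^sub>R h"
  have e: "solution e" unfolding e_def by (rule solution_lincomb[OF f h])
  have sm: "f \<in> smooth_functions A" "h \<in> smooth_functions A" "e \<in> smooth_functions A"
    using f h e by (auto simp: solution_def)
  have 0: "pd c i e p = 0" for i unfolding e_def pd_lincomb[OF c sm(1,2)] using eq by simp
  have "e q = e p"
    by (rule constant_if_pd_zero[OF conn sm(3)]) (rule solution_grad_zero[OF conn e c 0])
  then show "f q = h q" using eq(1) by (simp add: e_def)
qed

lemma K_dV_lincomb:
  assumes "c \<in> A" "p \<in> cdom c" "f \<in> smooth_functions A" "h \<in> smooth_functions A"
  shows "K_dV g K (a *\<^sub>R f + b *\<^sub>R h) c i p = a * K_dV g K f c i p + b * K_dV g K h c i p"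
  unfolding K_dV_def pd_lincomb[OF assms] by (simp add: distrib_left sum.distrib sum_distrib_left mult_ac)

lemma bertrand_darboux_lincomb:
  assumes K: "tensor_field_02 A K" and f: "f \<in> smooth_functions A" "bertrand_darboux A g K f"
    and h: "h \<in> smooth_functions A" "bertrand_darboux A g K h"
  shows "bertrand_darboux A g K (a *\<^sub>R f + b *\<^sub>R h)"
  unfolding bertrand_darboux_def
proof (intro ballI allI)
  fix c p i j assume c: "c \<in> A" "p \<in> cdom c"
  have "pd c i (K_dV g K (a *\<^sub>R f + b *\<^sub>R h) c j) p = a * pd c i (K_dV g K f c j) p + b * pd c i (K_dV g K h c j) p" for i j
  proof -
    have "pd c i (K_dV g K (a *\<^sub>R f + b *\<^sub>R h) c j) p = pd c i (\<lambda>q. a * K_dV g K f c j q + b * K_dV g K h c j q) p"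
      by (rule pd_cong_cdom[OF c]) (simp add: K_dV_lincomb c f h)
    also have "\<dots> = a * pd c i (K_dV g K f c j) p + b * pd c i (K_dV g K h c j) p"
      using c K_dV_smooth[OF K] f h by (simp add: pd_add pd_cmult smooth_cmult)
    finally show ?thesis .
  qed
  moreover have "pd c i (K_dV g K f c j) p = pd c j (K_dV g K f c i) p"
    "pd c i (K_dV g K h c j) p = pd c j (K_dV g K h c i) p"
    using f(2) h(2) c unfolding bertrand_darboux_def by simp_all
  ultimately show "pd c i (K_dV g K (a *\<^sub>R f + b *\<^sub>R h) c j) p - pd c j (K_dV g K (a *\<^sub>R f + b *\<^sub>R h) c i) p = 0"
    by simp
qed

lemma D_trace_eq:
  assumes "c \<in> A" "p \<in> cdom c"
  shows "(\<Sum>i\<in>UNIV. \<Sum>j\<in>UNIV. GI c p i j * D c p $ i $ j $ m) = D_trace c p m"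
  unfolding D_trace_def by (simp add: D_sym[OF assms])

lemma g_trace:
  assumes "c \<in> A" "p \<in> cdom c"
  shows "(\<Sum>i\<in>UNIV. \<Sum>j\<in>UNIV. GI c p i j * G c p i j) = real CARD('n)"
proof -
  have "(\<Sum>j\<in>UNIV. GI c p i j * G c p i j) = 1" for i
    using g_ginv(2)[OF assms, of i i] g_sym[OF assms] by simp
  then show ?thesis by simp
qed

lemma trace_free_part_trace:
  assumes "c \<in> A" "p \<in> cdom c"
  shows "(\<Sum>i\<in>UNIV. \<Sum>j\<in>UNIV. GI c p i j * trace_free_part g D c p $ i $ j $ m) = 0"
proof -
  have eq: "(\<Sum>i\<in>UNIV. \<Sum>j\<in>UNIV. GI c p i j * (D c p $ i $ j $ m - r * G c p i j * D_trace c p m)) =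
    (\<Sum>i\<in>UNIV. \<Sum>j\<in>UNIV. GI c p i j * D c p $ i $ j $ m) -
    (\<Sum>i\<in>UNIV. \<Sum>j\<in>UNIV. GI c p i j * G c p i j) * (r * D_trace c p m)" for r
    by (simp add: right_diff_distrib sum_subtractf sum_distrib_left sum_distrib_right mult_ac)
  show ?thesis unfolding trace_free_part_eq eq D_trace_eq[OF assms] g_trace[OF assms] by simp
qed

text \<open>Tracing the hypothesis determines \<open>s\<close> from the Laplacian and the trace of
  \<open>D\<close>; substituting it moves the trace of \<open>D\<close> into the Laplacian
  term.\<close>

lemma hess_trace_free:
  assumes c: "c \<in> A" "p \<in> cdom c"
    and hess: "\<And>i j. hess g c f i j p = (\<Sum>m\<in>UNIV. D c p $ i $ j $ m * pd c m f p) + s * G c p i j"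
  shows "hess g c f i j p = (\<Sum>m\<in>UNIV. trace_free_part g D c p $ i $ j $ m * pd c m f p)
     + 1 / real CARD('n) * G c p i j * laplacian g c f p"
proof -
  have "laplacian g c f p = (\<Sum>i\<in>UNIV. \<Sum>j\<in>UNIV. \<Sum>m\<in>UNIV. GI c p i j * D c p $ i $ j $ m * pd c m f p)
      + (\<Sum>i\<in>UNIV. \<Sum>j\<in>UNIV. GI c p i j * G c p i j) * s"
    unfolding laplacian_def hess by (simp add: distrib_left sum.distrib sum_distrib_left sum_distrib_right mult_ac)
  also have "(\<Sum>i\<in>UNIV. \<Sum>j\<in>UNIV. \<Sum>m\<in>UNIV. GI c p i j * D c p $ i $ j $ m * pd c m f p)
      = (\<Sum>m\<in>UNIV. (\<Sum>i\<in>UNIV. \<Sum>j\<in>UNIV. GI c p i j * D c p $ i $ j $ m) * pd c m f p)"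
    unfolding sum_distrib_right by (subst (2) sum.swap, subst sum.swap, rule refl)
  finally have "laplacian g c f p = (\<Sum>m\<in>UNIV. D_trace c p m * pd c m f p) + real CARD('n) * s"
    unfolding D_trace_eq[OF c] g_trace[OF c] .
  note lap = this
  have eq: "(\<Sum>m\<in>UNIV. (D c p $ i $ j $ m - r * G c p i j * D_trace c p m) * pd c m f p) =
      (\<Sum>m\<in>UNIV. D c p $ i $ j $ m * pd c m f p) - r * G c p i j * (\<Sum>m\<in>UNIV. D_trace c p m * pd c m f p)" for r
    by (simp add: left_diff_distrib right_diff_distrib sum_subtractf sum_distrib_left mult_ac)
  show ?thesis
    unfolding hess trace_free_part_eq eq lap by (simp add: field_simps)
qed

end

locale np1_system = structure_tensor A g D
  for A :: "('a::topological_space, 'n::finite) chart set" and g D +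
  fixes \<K> :: "('a, 'n) tensor2 set" and \<V> :: "('a \<Rightarrow> real) set"
  assumes sc: "simply_connected (UNIV :: 'a set)"
    and n3: "CARD('n) \<ge> 3"
    and system: "superintegrable_system A g \<K> \<V>"
    and dim_V: "dim \<V> = CARD('n) + 1"
    and V_hess: "V \<in> \<V> \<Longrightarrow> c \<in> A \<Longrightarrow> p \<in> cdom c \<Longrightarrow>
      hess g c V i j p = (\<Sum>m\<in>UNIV. D c p $ i $ j $ m * pd c m V p)"
begin

section \<open>The potential space of an (n+1)-parameter system and both implications\<close>

lemma conn: "connected (UNIV :: 'a set)"
  by (rule simply_connected_connected[OF sc])

lemma V_subspace: "subspace \<V>"
  and V_smooth: "\<V> \<subseteq> smooth_functions A"
  and K_subspace: "subspace \<K>"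
  and K_killing: "K \<in> \<K> \<Longrightarrow> killing_tensor A g K"
  and K_irreducible: "irreducible_set A g \<K>"
  and V_bertrand_darboux: "V \<in> \<V> \<Longrightarrow> K \<in> \<K> \<Longrightarrow> bertrand_darboux A g K V"
  using system unfolding superintegrable_system_def by auto

lemma V_solution: "V \<in> \<V> \<Longrightarrow> solution V"
  using V_smooth V_hess unfolding solution_def by auto

lemma V_basis:
  obtains B where "B \<subseteq> \<V>" "independent B" "span B = \<V>" "finite B" "card B = CARD('n) + 1"
proof -
  obtain B where B: "B \<subseteq> \<V>" "independent B" "\<V> \<subseteq> span B" "card B = dim \<V>"
    using real_vector.basis_exists[of \<V>] by blast
  moreover have "span B \<subseteq> \<V>" using B(1) V_subspace by (rule span_minimal)
  moreover have "finite B" using B(4) dim_V by (intro card_ge_0_finite) simp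
  ultimately show ?thesis using that dim_V by auto
qed

text \<open>A solution is determined by its value and its gradient at one point, and \<open>dim \<V> = n + 1\<close>, so
  that these data can be prescribed.\<close>

lemma prescribed_potential:
  assumes c: "c \<in> A" "p \<in> cdom c"
  obtains f where "f \<in> \<V>" "f p = a" "\<And>i. pd c i f p = w i"
proof -
  obtain B where B: "B \<subseteq> \<V>" "independent B" "span B = \<V>" "finite B" "card B = CARD('n) + 1" by (rule V_basis)
  \<comment> \<open>The type \<open>'n option\<close> has n + 1 elements. It indexes the basis and
    also the data at \<open>p\<close>, with \<open>None\<close> for the value and
    \<open>Some i\<close> for the derivatives, so that the evaluation matrix \<open>M\<close> is
    square and injectivity suffices.\<close>
  have "card (UNIV :: 'n option set) = card B" using B(5) by (simp add: card_UNIV_option)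
  then obtain b :: "'n option \<Rightarrow> 'a \<Rightarrow> real" where b: "bij_betw b UNIV B"
    using B(4) finite_same_card_bij[of "UNIV :: 'n option set" B] by auto
  have bV: "b k \<in> \<V>" for k using b B(1) by (auto simp: bij_betw_def)
  have bs: "b k \<in> smooth_functions A" for k using bV V_smooth by blast
  define F where "F x = (\<Sum>k\<in>UNIV. x $ k *\<^sub>R b k)" for x :: "real^'n option"
  have F_eq: "F x = (\<lambda>q. \<Sum>k\<in>UNIV. x $ k * b k q)" for x
    by (simp add: F_def fun_eq_iff sum_fun_apply)
  have FV: "F x \<in> \<V>" for x
    unfolding F_def using V_subspace bV by (intro subspace_sum subspace_scale)
  have F_pd: "pd c i (F x) p = (\<Sum>k\<in>UNIV. x $ k * pd c i (b k) p)" for i x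
  proof -
    have "pd c i (F x) p = (\<Sum>k\<in>UNIV. pd c i (\<lambda>q. x $ k * b k q) p)"
      unfolding F_eq by (rule pd_sum[OF c]) (intro smooth_cmult smooth_functions_chart bs c)
    then show ?thesis using c bs by (simp add: pd_cmult smooth_functions_chart)
  qed
  define M :: "real^'n option^'n option" where
    "M = (\<chi> r k. case r of None \<Rightarrow> b k p | Some i \<Rightarrow> pd c i (b k) p)"
  have M: "(M *v x) $ None = F x p" "(M *v x) $ Some i = pd c i (F x) p" for x i
    by (simp add: M_def matrix_vector_mult_def F_eq mult.commute) (simp add: M_def matrix_vector_mult_def F_pd mult.commute)
  have "x = 0" if "M *v x = 0" for x
  proof -
    have z: "solution (\<lambda>q. 0)" using V_solution[OF subspace_0[OF V_subspace]] by (simp add: zero_fun_def)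
    have "F x = (\<lambda>q. 0)"
      by (rule solution_eqI[OF conn V_solution[OF FV] z c]) (use that M[of x] in auto)
    moreover have "F x = (\<Sum>y\<in>B. x $ (inv_into UNIV b y) *\<^sub>R y)"
      unfolding F_def using b by (subst sum.reindex_bij_betw[OF b, symmetric]) (simp add: bij_betw_def)
    ultimately have "(\<Sum>y\<in>B. x $ (inv_into UNIV b y) *\<^sub>R y) = 0" by (simp add: zero_fun_def)
    then have "x $ (inv_into UNIV b y) = 0" if "y \<in> B" for y
      using real_vector.independentD[OF B(2,4) subset_refl, of "\<lambda>y. x $ (inv_into UNIV b y)" y] that by simp
    then have "x $ k = 0" for k
      using b by (metis bij_betw_def inv_into_f_f UNIV_I rangeI)
    then show ?thesis by (simp add: vec_eq_iff)
  qed
  then have "invertible M"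
    using matrix_left_invertible_ker[of M] invertible_left_inverse[of M] by blast
  define x where "x = matrix_inv M *v (\<chi> r. case r of None \<Rightarrow> a | Some i \<Rightarrow> w i)"
  have Mx: "M *v x = (\<chi> r. case r of None \<Rightarrow> a | Some i \<Rightarrow> w i)"
    unfolding x_def by (simp add: matrix_vector_mul_assoc matrix_inv_inverse[OF \<open>invertible M\<close>])
  show ?thesis
    by (rule that[OF FV[of x]]) (use M[of x] in \<open>simp_all add: Mx\<close>)
qed

text \<open>By the dimension count the space contains a solution with the same value and gradient at
  a point, and these data determine the solution. Hence the space cannot be enlarged within the
  homogeneous equation.\<close>

lemma solution_in_V:
  assumes "solution f"
  shows "f \<in> \<V>"
proof -
  obtain c p where c: "c \<in> A" "p \<in> cdom c" using ex_chart by blast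
  obtain h where h: "h \<in> \<V>" "h p = f p" "\<And>i. pd c i h p = pd c i f p"
    by (rule prescribed_potential[OF c, of "f p" "\<lambda>i. pd c i f p"]) (use that in blast)
  have "f = h" by (rule solution_eqI[OF conn assms V_solution[OF h(1)] c]) (simp_all add: h)
  then show ?thesis using h by simp
qed

lemma frame_exists:
  obtains v where "\<And>\<alpha>. v \<alpha> \<in> \<V>" "framed_structure A g D v"
proof -
  obtain c0 p0 where c0: "c0 \<in> A" "p0 \<in> cdom c0" using ex_chart by blast
  have "\<exists>f\<in>\<V>. \<forall>i. pd c0 i f p0 = (if i = \<alpha> then 1 else 0)" for \<alpha>
    by (rule prescribed_potential[OF c0, of 0 "\<lambda>i. if i = \<alpha> then 1 else 0"]) blast
  then obtain v where v: "\<And>\<alpha>. v \<alpha> \<in> \<V>" "\<And>\<alpha> i. pd c0 i (v \<alpha>) p0 = (if i = \<alpha> then 1 else 0)" by metis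
  have vs: "v \<alpha> \<in> smooth_functions A" for \<alpha> using v(1) V_smooth by blast
  have "invertible (\<chi> \<alpha> i. pd c i (v \<alpha>) p)" if c: "c \<in> A" "p \<in> cdom c" for c p
  proof -
    let ?X = "\<chi> \<alpha> i. pd c i (v \<alpha>) p"
    \<comment> \<open>A kernel vector gives a combination of the \<open>v \<alpha>\<close> with
      vanishing gradient at \<open>p\<close>, hence at \<open>p0\<close>, where the gradients are
      the standard basis.\<close>
    have "x = 0" if x: "transpose ?X *v x = 0" for x
    proof -
      define f where "f = (\<Sum>\<alpha>\<in>UNIV. x $ \<alpha> *\<^sub>R v \<alpha>)"
      have f_eq: "f = (\<lambda>q. \<Sum>\<alpha>\<in>UNIV. x $ \<alpha> * v \<alpha> q)"
        by (simp add: f_def fun_eq_iff sum_fun_apply)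
      have fV: "f \<in> \<V>" unfolding f_def using V_subspace v(1) by (intro subspace_sum subspace_scale)
      have f_pd: "pd c i f p = (\<Sum>\<alpha>\<in>UNIV. x $ \<alpha> * pd c i (v \<alpha>) p)" if c: "c \<in> A" "p \<in> cdom c" for i c p
        unfolding f_eq using c vs by (subst pd_sum) (auto simp: pd_cmult smooth_cmult smooth_functions_chart)
      have "pd c i f p = 0" for i
      proof -
        have "pd c i f p = (transpose ?X *v x) $ i"
          unfolding f_pd[OF c] by (simp add: matrix_vector_mult_def transpose_def mult.commute del: transpose_matrix_vector)
        then show ?thesis using x by simp
      qed
      then have "pd c0 i f p0 = 0" for i
        by (rule solution_grad_zero[OF conn V_solution[OF fV] c _ c0])
      then have "x $ i = 0" for i
        unfolding f_pd[OF c0] v(2) sum_if_eq by simp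
      then show ?thesis by (simp add: vec_eq_iff)
    qed
    then have "invertible (transpose ?X)"
      using matrix_left_invertible_ker[of "transpose ?X"] invertible_left_inverse[of "transpose ?X"] by blast
    then show ?thesis by (metis transpose_invertible transpose_transpose)
  qed
  then have "framed_structure A g D v"
    by unfold_locales (use V_solution v(1) in auto)
  then show ?thesis using that v(1) by blast
qed

text \<open>Comparing dimensions provides a potential outside \<V>, to which the obstruction
  argument is applied.\<close>

lemma obstruction_zero_if_restriction:
  assumes "\<V> \<subseteq> \<V>'" "nondegenerate_system A g \<K> \<V>'"
    and T: "nondegenerate_structure_tensor A g \<V>' (trace_free_part g D)"
    and c: "c \<in> A" "p \<in> cdom c"
  shows "obstruction_tensor g D c p = 0"
proof -
  have "dim \<V>' = CARD('n) + 2" using assms(2) by (simp add: nondegenerate_system_def)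
  then obtain U where U: "U \<in> \<V>'" "U \<notin> \<V>" using assms(1) dim_V by (metis Suc_n_not_n add_2_eq_Suc' add.commute plus_1_eq_Suc subsetI subset_antisym)
  have Us: "U \<in> smooth_functions A"
    using assms(2) U(1) unfolding nondegenerate_system_def superintegrable_system_def by blast
  \<comment> \<open>The defect of \<open>U\<close> in the traced homogeneous equation, divided by n;
    with the trace-free structure tensor it is the full defect.\<close>
  define s where "s c p = 1 / real CARD('n) * (laplacian g c U p - (\<Sum>m\<in>UNIV. D_trace c p m * pd c m U p))" for c p
  have s_smooth: "smooth_in_chart c (s c)" if "c \<in> A" for c
    unfolding s_def[abs_def] using that Us
    by (intro smooth_intros laplacian_smooth D_trace_smooth smooth_pd smooth_functions_chart)
  have hess_U: "hess g c U i j p = (\<Sum>m\<in>UNIV. D c p $ i $ j $ m * pd c m U p) + s c p * G c p i j"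
    if c: "c \<in> A" "p \<in> cdom c" for c p i j
  proof -
    have "hess g c U i j p = (\<Sum>m\<in>UNIV. trace_free_part g D c p $ i $ j $ m * pd c m U p)
          + 1 / real CARD('n) * G c p i j * laplacian g c U p"
      using T U(1) c unfolding nondegenerate_structure_tensor_def by blast
    then show ?thesis unfolding trace_free_part_eq s_def
      by (simp add: left_diff_distrib right_diff_distrib sum_subtractf sum_distrib_left mult_ac)
  qed
  \<comment> \<open>If the defect vanished identically, \<open>U\<close> would be a solution and so
    belong to \<V>.\<close>
  have "\<exists>c p. c \<in> A \<and> p \<in> cdom c \<and> s c p \<noteq> 0"
  proof (rule ccontr)
    assume "\<not> (\<exists>c p. c \<in> A \<and> p \<in> cdom c \<and> s c p \<noteq> 0)"
    then have s0: "s c p = 0" if "c \<in> A" "p \<in> cdom c" for c p using that by blast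
    have "solution U" unfolding solution_def using Us hess_U by (simp add: s0)
    then show False using solution_in_V U(2) by blast
  qed
  then obtain c0 p0 where nz: "c0 \<in> A" "p0 \<in> cdom c0" "s c0 p0 \<noteq> 0" by blast
  obtain v where v: "framed_structure A g D v" by (rule frame_exists) (use that in blast)
  then interpret framed_structure A g D v .
  show ?thesis
    using extra_solution_obstruction[OF conn _ Us s_smooth hess_U nz c] n3 by simp
qed

text \<open>One new potential suffices: \<V>' is spanned by \<V> and \<open>U\<close>, and every
  condition except functional independence is inherited by linear combinations.\<close>

lemma restriction_if_obstruction_zero:
  assumes N: "\<And>c p. c \<in> A \<Longrightarrow> p \<in> cdom c \<Longrightarrow> obstruction_tensor g D c p = 0"
  shows "\<exists>\<V>'. \<V> \<subseteq> \<V>' \<and> nondegenerate_system A g \<K> \<V>' \<and>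
    nondegenerate_structure_tensor A g \<V>' (trace_free_part g D)"
proof -
  obtain v where v: "\<And>\<alpha>. v \<alpha> \<in> \<V>" "framed_structure A g D v" by (rule frame_exists) (use that in blast)
  then interpret framed_structure A g D v by blast
  obtain U \<sigma> u where U: "U \<in> smooth_functions A" "\<And>p. \<sigma> p > 0" "\<And>\<alpha>. u \<alpha> \<in> smooth_functions A"
    "\<And>c \<alpha> j p. c \<in> A \<Longrightarrow> p \<in> cdom c \<Longrightarrow> pd c j (u \<alpha>) p = \<sigma> p * \<Theta> c \<alpha> j p"
    "\<And>c i p. c \<in> A \<Longrightarrow> p \<in> cdom c \<Longrightarrow> pd c i U p = (\<Sum>\<alpha>\<in>UNIV. u \<alpha> p * pd c i (v \<alpha>) p)"
    "\<And>c i j p. c \<in> A \<Longrightarrow> p \<in> cdom c \<Longrightarrow>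
      hess g c U i j p = (\<Sum>m\<in>UNIV. D c p $ i $ j $ m * pd c m U p) + \<sigma> p * G c p i j"
    by (rule extra_solution_exists[OF sc n3 N]) (use that in blast)+
  define \<V>' where "\<V>' = span (insert U \<V>)"
  have span_V: "span \<V> = \<V>" using V_subspace by (rule real_vector.span_eq_iff[THEN iffD2])
  have V'_E: "\<exists>k. \<exists>f\<in>\<V>. V = k *\<^sub>R U + 1 *\<^sub>R f" if V: "V \<in> \<V>'" for V
  proof -
    obtain k where "V - k *\<^sub>R U \<in> \<V>" using V unfolding \<V>'_def real_vector.span_breakdown_eq span_V by blast
    then show ?thesis by (intro exI[of _ k] bexI[of _ "V - k *\<^sub>R U"]) auto
  qed
  have sub: "\<V> \<subseteq> \<V>'" unfolding \<V>'_def using real_vector.span_superset by blast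
  have V'_smooth: "\<V>' \<subseteq> smooth_functions A"
  proof
    fix V assume "V \<in> \<V>'"
    then obtain k f where f: "f \<in> \<V>" "V = k *\<^sub>R U + 1 *\<^sub>R f" using V'_E by blast
    then show "V \<in> smooth_functions A" using smooth_lincomb[OF U(1)] V_smooth by blast
  qed
  have V'_hess: "\<exists>s. \<forall>i j. hess g c V i j p = (\<Sum>m\<in>UNIV. D c p $ i $ j $ m * pd c m V p) + s * G c p i j"
    if V: "V \<in> \<V>'" and c: "c \<in> A" "p \<in> cdom c" for V c p
  proof -
    obtain k f where f: "f \<in> \<V>" "V = k *\<^sub>R U + 1 *\<^sub>R f" using V'_E V by blast
    have fs: "f \<in> smooth_functions A" using f(1) V_smooth by blast
    have "hess g c V i j p = (\<Sum>m\<in>UNIV. D c p $ i $ j $ m * pd c m V p) + (k * \<sigma> p) * G c p i j" for i j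
      unfolding f(2) hess_lincomb[OF c U(1) fs] pd_lincomb[OF c U(1) fs] U(6)[OF c] V_hess[OF f(1) c]
      by (simp add: distrib_left sum.distrib sum_distrib_left mult_ac)
    then show ?thesis by blast
  qed
  have V'_BD: "bertrand_darboux A g K V" if V: "V \<in> \<V>'" and K: "K \<in> \<K>" for V K
  proof -
    obtain k f where f: "f \<in> \<V>" "V = k *\<^sub>R U + 1 *\<^sub>R f" using V'_E V by blast
    have "tensor_field_02 A K" using K_killing[OF K] by (simp add: killing_tensor_def)
    moreover have "bertrand_darboux A g K U"
      by (rule extra_solution_bertrand_darboux[OF K_killing[OF K] V_bertrand_darboux[OF v(1) K] U(3,4,5)])
    moreover have "f \<in> smooth_functions A" using f(1) V_smooth by blast
    ultimately show ?thesis unfolding f(2) using U(1) V_bertrand_darboux[OF f(1) K] by (intro bertrand_darboux_lincomb)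
  qed
  \<comment> \<open>Comparing the two Hessian equations would give \<sigma> g = 0 although \<sigma>
    is positive.\<close>
  have "U \<notin> \<V>"
  proof
    assume "U \<in> \<V>"
    obtain c p where c: "c \<in> A" "p \<in> cdom c" using ex_chart by blast
    have "\<sigma> p * G c p i j = 0" for i j using V_hess[OF \<open>U \<in> \<V>\<close> c] U(6)[OF c] by simp
    then have "\<sigma> p * \<Theta> c \<alpha> j p = 0" for \<alpha> j using U(2)[of p] unfolding \<Theta>_def by simp
    then have "\<sigma> p = 0" by (rule \<Theta>_nonzero[OF c])
    then show False using U(2)[of p] by simp
  qed
  have dim_V': "dim \<V>' = CARD('n) + 2"
  proof -
    obtain B where B: "B \<subseteq> \<V>" "independent B" "span B = \<V>" "finite B" "card B = CARD('n) + 1" by (rule V_basis)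
    have "U \<notin> span B" using B(3) \<open>U \<notin> \<V>\<close> by simp
    then have "independent (insert U B)" using B(2) by (rule real_vector.independent_insertI)
    moreover have "span (insert U B) = span \<V>'"
    proof
      show "span (insert U B) \<subseteq> span \<V>'"
        unfolding \<V>'_def real_vector.span_span using B(1) by (intro real_vector.span_mono insert_mono)
      have "\<V> \<subseteq> span (insert U B)"
        using real_vector.span_mono[OF subset_insertI[of B U]] unfolding B(3) .
      moreover have "U \<in> span (insert U B)" by (rule real_vector.span_base) simp
      ultimately show "span \<V>' \<subseteq> span (insert U B)"
        unfolding \<V>'_def real_vector.span_span by (intro real_vector.span_minimal real_vector.subspace_span) simp
    qed
    ultimately have "dim \<V>' = card (insert U B)" by (intro real_vector.dim_eq_card)
    moreover have "U \<notin> B" using B(1) \<open>U \<notin> \<V>\<close> by blast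
    ultimately show ?thesis using B(4,5) by simp
  qed
  have S2: "\<exists>K W. (\<forall>k\<in>{1..2 * CARD('n) - 2}. K k \<in> \<K> \<and> is_potential_part A g (K k) V (W k)) \<and>
        functionally_independent A (2 * CARD('n) - 1)
          (\<lambda>k. if k = 0 then quadratic_integral (ginv g) V else quadratic_integral (raised g (K k)) (W k))"
    if V: "V \<in> \<V>'" for V
  proof -
    let ?I = "{1..2 * CARD('n) - 2}" and ?N = "2 * CARD('n) - 1"
    \<comment> \<open>The Killing tensors supplied for the zero potential serve every
      \<open>V\<close>: their potential parts have zero differential, so replacing these by the
      parts for \<open>V\<close> is a perturbation covered by
      \<open>functionally_independent_potentials\<close>.\<close>
    have "0 \<in> \<V>" using V_subspace by (rule subspace_0)
    then obtain K W0 where K: "\<forall>k\<in>?I. K k \<in> \<K> \<and> is_potential_part A g (K k) 0 (W0 k)"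
      "functionally_independent A ?N (\<lambda>k. if k = 0 then quadratic_integral (ginv g) 0 else quadratic_integral (raised g (K k)) (W0 k))"
      using system unfolding superintegrable_system_def by blast
    have Kt: "tensor_field_02 A (K k)" if "k \<in> ?I" for k
      using K(1) K_killing that unfolding killing_tensor_def by blast
    have "\<forall>k\<in>?I. \<exists>W. is_potential_part A g (K k) V W"
      using potential_part_exists[OF sc Kt] V'_smooth V V'_BD K(1) by blast
    then obtain W where W: "\<forall>k\<in>?I. is_potential_part A g (K k) V (W k)" by metis
    \<comment> \<open>The Hamiltonian has the number 0 and the other integrals the numbers 1 to 2n -
      2, which makes 2n - 1 functions.\<close>
    define Q where "Q k = (if k = 0 then ginv g else raised g (K k))" for k
    define P0 where "P0 k = (if k = 0 then 0 else W0 k)" for k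
    define P where "P k = (if k = 0 then V else W k)" for k
    have I: "k \<in> ?I" if "k < ?N" "k \<noteq> 0" for k using that by auto
    have pd0: "pd c i (0 :: 'a \<Rightarrow> real) p = 0" for c :: "('a, 'n) chart" and i p by (simp add: zero_fun_def)
    have zero_smooth: "(0 :: 'a \<Rightarrow> real) \<in> smooth_functions A" using \<open>0 \<in> \<V>\<close> V_smooth by blast
    have "functionally_independent A ?N (\<lambda>k. quadratic_integral (Q k) (P k))"
    proof (rule functionally_independent_potentials[where ?W0.0 = P0])
      show "smooth_in_chart c (\<lambda>p. Q k c p $ i $ j)" if "c \<in> A" "k < ?N" for c k i j
        using ginv_smooth[OF that(1)] raised_smooth[OF Kt[OF I[OF that(2)]] that(1)] by (auto simp: Q_def)
      show "P0 k \<in> smooth_functions A" if "k < ?N" for k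
        using K(1) I[OF that] zero_smooth by (auto simp: P0_def is_potential_part_def)
      show "pd c i (P0 k) p = 0" if "c \<in> A" "p \<in> cdom c" "k < ?N" for c k i p
      proof (cases "k = 0")
        case False
        then have "pd c i (W0 k) p = K_dV g (K k) 0 c i p"
          using K(1) I[OF that(3)] that unfolding is_potential_part_def by blast
        then show ?thesis using False by (simp add: P0_def K_dV_def pd0)
      qed (simp add: P0_def pd0)
      show "P k \<in> smooth_functions A" if "k < ?N" for k
        using W I[OF that] V V'_smooth by (auto simp: P_def is_potential_part_def)
      have "(\<lambda>k. if k = 0 then quadratic_integral (ginv g) 0 else quadratic_integral (raised g (K k)) (W0 k))
          = (\<lambda>k. quadratic_integral (Q k) (P0 k))" by (auto simp: fun_eq_iff Q_def P0_def)
      then show "functionally_independent A ?N (\<lambda>k. quadratic_integral (Q k) (P0 k))" using K(2) by simp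
    qed
    moreover have "(\<lambda>k. if k = 0 then quadratic_integral (ginv g) V else quadratic_integral (raised g (K k)) (W k))
          = (\<lambda>k. quadratic_integral (Q k) (P k))" by (auto simp: fun_eq_iff Q_def P_def)
    ultimately show ?thesis using K(1) W by (intro exI[of _ K] exI[of _ W]) auto
  qed
  have "subspace \<V>'" unfolding \<V>'_def by (rule real_vector.subspace_span)
  then have "superintegrable_system A g \<K> \<V>'"
    unfolding superintegrable_system_def
    using K_subspace K_killing K_irreducible V'_smooth V'_BD S2 by blast
  then have nd: "nondegenerate_system A g \<K> \<V>'"
    unfolding nondegenerate_system_def using dim_V' by blast
  have "nondegenerate_structure_tensor A g \<V>' (trace_free_part g D)"
    unfolding nondegenerate_structure_tensor_def
  proof (intro conjI ballI allI)
    show "tensor_field_12 A (trace_free_part g D)" by (rule trace_free_part_tensor)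
    show "trace_free_part g D c p $ i $ j $ m = trace_free_part g D c p $ j $ i $ m"
      if "c \<in> A" "p \<in> cdom c" for c p i j m
      unfolding trace_free_part_eq D_sym[OF that, of i j] g_sym[OF that, of i j] ..
    show "(\<Sum>i\<in>UNIV. \<Sum>j\<in>UNIV. GI c p i j * trace_free_part g D c p $ i $ j $ m) = 0"
      if "c \<in> A" "p \<in> cdom c" for c p m
      by (rule trace_free_part_trace[OF that])
    fix V c p i j assume V: "V \<in> \<V>'" and c: "c \<in> A" "p \<in> cdom c"
    obtain s where "\<And>i j. hess g c V i j p = (\<Sum>m\<in>UNIV. D c p $ i $ j $ m * pd c m V p) + s * G c p i j"
      using V'_hess[OF V c] by blast
    then show "hess g c V i j p = (\<Sum>m\<in>UNIV. trace_free_part g D c p $ i $ j $ m * pd c m V p)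
          + 1 / real CARD('n) * G c p i j * laplacian g c V p"
      by (rule hess_trace_free[OF c])
  qed
  then show ?thesis using sub nd by blast
qed

end

theorem theorem1:
  fixes A :: "('a::{t2_space, second_countable_topology}, 'n::finite) chart set"
    and g :: "('a, 'n) tensor2"
    and \<K> :: "('a, 'n) tensor2 set"
    and \<V> :: "('a \<Rightarrow> real) set"
    and D :: "('a, 'n) tensor3"
  assumes "smooth_atlas A"
    and "simply_connected (UNIV :: 'a set)"
    and "riemannian_metric A g"
    and "CARD('n) \<ge> 3"
    and "np1_parameter_system A g \<K> \<V>"
    and "np1_structure_tensor A g \<V> D"
  shows "(\<exists>\<V>'. \<V> \<subseteq> \<V>' \<and> nondegenerate_system A g \<K> \<V>' \<and>
            nondegenerate_structure_tensor A g \<V>' (trace_free_part g D))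
         \<longleftrightarrow> (\<forall>c\<in>A. \<forall>p\<in>cdom c. obstruction_tensor g D c p = 0)"
proof -
  interpret np1_system A g D \<K> \<V>
    by unfold_locales (use assms in \<open>auto simp: np1_parameter_system_def np1_structure_tensor_def\<close>)
  show ?thesis
    using obstruction_zero_if_restriction restriction_if_obstruction_zero by blast
qed

end
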